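(* For every integer $k\ge0$: $$|L_5(k)|=\sum_{j=0}^{\lfloor k/2\rfloor}\binom{k-2j+1}{1},\qquad |L_6(k)|=\binom{k+3}{3},\qquad |L_7(k)|=\sum_{j=0}^{\lfloor 2k/3\rfloor}\binom{2k-3j+2}{2},$$ $$|L_8(k)|=\sum_{j=0}^{k}\binom{2k-2j+3}{3},\qquad |L_9(k)|=\sum_{j=0}^{k}\ \sum_{\ell=0}^{\left\lfloor\frac{3k}2-\frac{3j}2\right\rfloor}\binom{3k-3j-2\ell+2}{2},$$ $$|L_{10}(k)|=\sum_{j=0}^{\lfloor 3k/2\rfloor}(j+1)\binom{3k-2j+3}{3},\qquad |L_{12}(k)|=\sum_{j=0}^{2k}\binom{j+2}{2}\binom{4k-2j+3}{3}.$$ (These are exactly the levels $N\ge5$ for which $X_1(N)$ has genus zero.)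
   Context: Notation: $q=e^{2\pi i\tau}$, $\operatorname{Im}\tau>0$; $(x_1,\dots,x_s;q)_\infty=\prod_{i=1}^s\prod_{n\ge0}(1-x_iq^n)$. For $N\ge5$ put $m=\lfloor N/2\rfloor$. For an even integer $a_0\ge0$ and $\mathbf a=(a_1,\dots,a_m)\in\mathbb Z^m$, $$f^{(N)}_{\mathbf a}(\tau)=q^{\frac N{24}S_1-\frac1{2N}S_2}(q^N;q^N)_\infty^{a_0}\prod_{j=1}^m(q^j,q^{N-j};q^N)_\infty^{a_j},\quad S_1=a_0+2\sum_{j=1}^m a_j,\quad S_2=\sum_{j=1}^m j(N-j)a_j.$$ For an integer $k\ge0$, $L_N(k)$ is the set of all $\mathbf a\in\mathbb Z^m$ such that, with $a_0=2k$, $f^{(N)}_{\mathbf a}\in M_k(\Gamma_1(N))$, the space of holomorphic modular forms of weight $k$ on $\Gamma_1(N)=\{\begin{pmatrix}a&b\\c&d\end{pmatrix}\in\mathrm{SL}_2(\mathbb Z):a\equiv d\equiv1,\ c\equiv0\pmod N\}$. $X_1(N)$ is the corresponding compact modular curve. *)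

theory Defs
  imports "HOL-Analysis.Analysis" "HOL-Library.Extended_Nat" "HOL-Library.FuncSet"
begin

definition upper_half_plane :: "complex set" where
  "upper_half_plane = {\<tau>. Im \<tau> > 0}"

definition SL2Z :: "(int^2^2) set" where
  "SL2Z = {\<gamma>. det \<gamma> = 1}"

definition Gamma1 :: "nat \<Rightarrow> (int^2^2) set" where
  "Gamma1 N = {\<gamma> \<in> SL2Z. (\<gamma>$1$1) mod int N = 1 mod int N \<and> (\<gamma>$2$2) mod int N = 1 mod int N
                 \<and> int N dvd \<gamma>$2$1}"

definition aut_factor :: "int^2^2 \<Rightarrow> complex \<Rightarrow> complex" where
  "aut_factor \<gamma> \<tau> = of_int (\<gamma>$2$1) * \<tau> + of_int (\<gamma>$2$2)"

definition moebius_act :: "int^2^2 \<Rightarrow> complex \<Rightarrow> complex" where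
  "moebius_act \<gamma> \<tau> = (of_int (\<gamma>$1$1) * \<tau> + of_int (\<gamma>$1$2)) / aut_factor \<gamma> \<tau>"

definition slash :: "nat \<Rightarrow> int^2^2 \<Rightarrow> (complex \<Rightarrow> complex) \<Rightarrow> complex \<Rightarrow> complex" where
  "slash k \<gamma> f \<tau> = f (moebius_act \<gamma> \<tau>) / aut_factor \<gamma> \<tau> ^ k"

text \<open>Modular forms are functions on the upper half-plane: their values elsewhere are irrelevant.
  Holomorphy at the cusp \<open>\<gamma>\<infinity>\<close> is boundedness of \<open>f|\<gamma>\<close> as \<open>Im \<tau>\<close> tends to infinity.\<close>

definition modular_forms :: "nat \<Rightarrow> (int^2^2) set \<Rightarrow> (complex \<Rightarrow> complex) set" where
  "modular_forms k G = {f. f holomorphic_on upper_half_plane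
     \<and> (\<forall>\<gamma>\<in>G. \<forall>\<tau>\<in>upper_half_plane. slash k \<gamma> f \<tau> = f \<tau>)
     \<and> (\<forall>\<gamma>\<in>SL2Z. \<exists>B C. \<forall>\<tau>\<in>upper_half_plane. Im \<tau> \<ge> B \<longrightarrow> norm (slash k \<gamma> f \<tau>) \<le> C)}"

text \<open>\<open>qpoch [x\<^sub>1, \<dots>, x\<^sub>s] q\<close> is \<open>(x\<^sub>1, \<dots>, x\<^sub>s; q)\<^sub>\<infinity>\<close>. A list is used because
  entries may repeat: \<open>q\<^sup>j\<close> and \<open>q\<^sup>N\<^sup>-\<^sup>j\<close> coincide for \<open>j = N/2\<close>.\<close>

definition qpoch :: "complex list \<Rightarrow> complex \<Rightarrow> complex" where
  "qpoch xs q = (\<Prod>x\<leftarrow>xs. prodinf (\<lambda>n. 1 - x * q ^ n))"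

text \<open>The power \<open>q\<^sup>r\<close> of \<open>q = e\<^sup>2\<^sup>\<pi>\<^sup>i\<^sup>\<tau>\<close> for real \<open>r\<close>; it depends on \<open>\<tau>\<close>, not only on \<open>q\<close>.\<close>

definition qpow :: "complex \<Rightarrow> real \<Rightarrow> complex" where
  "qpow \<tau> r = exp (2 * of_real pi * \<i> * \<tau> * of_real r)"

definition S1 :: "nat \<Rightarrow> nat \<Rightarrow> (nat \<Rightarrow> int) \<Rightarrow> int" where
  "S1 N a0 a = int a0 + 2 * (\<Sum>j = 1..N div 2. a j)"

definition S2 :: "nat \<Rightarrow> (nat \<Rightarrow> int) \<Rightarrow> int" where
  "S2 N a = (\<Sum>j = 1..N div 2. int j * int (N - j) * a j)"

definition fprod :: "nat \<Rightarrow> nat \<Rightarrow> (nat \<Rightarrow> int) \<Rightarrow> complex \<Rightarrow> complex" where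
  "fprod N a0 a \<tau> =
     qpow \<tau> (real N / 24 * of_int (S1 N a0 a) - 1 / (2 * real N) * of_int (S2 N a))
     * qpoch [qpow \<tau> (real N)] (qpow \<tau> (real N)) ^ a0
     * (\<Prod>j = 1..N div 2.
          qpoch [qpow \<tau> (real j), qpow \<tau> (real (N - j))] (qpow \<tau> (real N)) powi a j)"

text \<open>Vectors \<open>(a\<^sub>1, \<dots>, a\<^sub>m)\<close> of integers, \<open>m = \<lfloor>N/2\<rfloor>\<close>, are extensional functions on \<open>{1..m}\<close>.\<close>

definition L :: "nat \<Rightarrow> nat \<Rightarrow> (nat \<Rightarrow> int) set" where
  "L N k = {a \<in> {1..N div 2} \<rightarrow>\<^sub>E UNIV. fprod N (2 * k) a \<in> modular_forms k (Gamma1 N)}"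

text \<open>The genus of the compact Riemann surface \<open>X\<^sub>1(N)\<close>, the quotient of the upper half-plane
  and the cusps by \<open>\<Gamma>\<^sub>1(N)\<close>, is the dimension of its space of holomorphic differentials.
  A differential is represented by its pullback \<open>f d\<tau>\<close> to the upper half-plane. The local chart at
  the cusp \<open>\<gamma>\<infinity>\<close> is \<open>exp (2\<pi>i \<gamma>\<^sup>-\<^sup>1\<tau> / h)\<close> with \<open>h\<close> the width of the cusp, where the stabiliser
  is taken modulo \<open>\<plusminus>1\<close>. (At an elliptic point an invariant holomorphic \<open>f d\<tau>\<close> automatically
  descends to a holomorphic differential.)\<close>

definition translation :: "nat \<Rightarrow> int^2^2" where
  "translation h = vector [vector [1, int h], vector [0, 1]]"

definition cusp_width :: "(int^2^2) set \<Rightarrow> int^2^2 \<Rightarrow> nat" where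
  "cusp_width G \<gamma> = (LEAST h. h > 0 \<and>
     (\<exists>\<delta>\<in>G. \<gamma> ** translation h = \<delta> ** \<gamma> \<or> \<gamma> ** translation h = - (\<delta> ** \<gamma>)))"

definition cusp_chart :: "nat \<Rightarrow> complex \<Rightarrow> complex" where
  "cusp_chart h \<tau> = exp (2 * of_real pi * \<i> * \<tau> / of_nat h)"

definition X1_differentials :: "nat \<Rightarrow> (complex \<Rightarrow> complex) set" where
  "X1_differentials N = {f. f holomorphic_on upper_half_plane
     \<and> (\<forall>\<gamma>\<in>Gamma1 N. \<forall>\<tau>\<in>upper_half_plane. f (moebius_act \<gamma> \<tau>) * deriv (moebius_act \<gamma>) \<tau> = f \<tau>)
     \<and> (\<forall>\<gamma>\<in>SL2Z. \<exists>g. g holomorphic_on ball 0 1 \<and>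
          (\<forall>\<tau>\<in>upper_half_plane. f (moebius_act \<gamma> \<tau>) * deriv (moebius_act \<gamma>) \<tau> =
             g (cusp_chart (cusp_width (Gamma1 N) \<gamma>) \<tau>)
             * deriv (cusp_chart (cusp_width (Gamma1 N) \<gamma>)) \<tau>))}"

text \<open>The dimension is the least size of a spanning family, functions being identified when they
  agree on the upper half-plane.\<close>

definition X1_genus :: "nat \<Rightarrow> enat" where
  "X1_genus N = Inf {enat g | g. \<exists>\<omega> :: nat \<Rightarrow> complex \<Rightarrow> complex.
     (\<forall>i<g. \<omega> i \<in> X1_differentials N) \<and>
     (\<forall>f\<in>X1_differentials N. \<exists>c :: nat \<Rightarrow> complex. \<forall>\<tau>\<in>upper_half_plane.
        f \<tau> = (\<Sum>i<g. c i * \<omega> i \<tau>))}"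

end

theory Submission
  imports Defs "HOL-Complex_Analysis.Complex_Analysis"
begin

text \<open>
  Up to powers of \<open>q\<close>, the factors \<open>(q\<^sup>j, q\<^sup>N\<^sup>-\<^sup>j; q\<^sup>N)\<^sub>\<infinity>\<close> are \<open>\<eta>(N\<tau>)\<^sup>2\<close> times Klein forms \<open>k\<^sub>r\<close> with characteristic
  \<open>r = (j/N, 0)\<close>, evaluated at \<open>N\<tau>\<close>. Klein forms come from the Jacobi theta function, whose behaviour under
  \<open>SL\<^sub>2(\<int>)\<close> follows from Liouville's theorem, because a quotient of two theta functions with the same zeros is
  an entire doubly periodic function (\<open>phi_modular\<close>). They have weight \<open>-1\<close>, and the group acts on
  the characteristics without multiplier (\<open>kl_modular\<close>, \<open>kl_shift\<close>). The modularity of \<open>\<Delta>\<close> is a consequence,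
  since \<open>\<Delta>\<close> is built from the Klein forms of level \<open>2\<close> (\<open>Delta_modular\<close>).

  The function \<open>f\<^sub>a\<close> is therefore \<open>\<eta>(N\<tau>)\<^sup>2\<^sup>M\<close>, with \<open>M = k + \<Sum>a\<^sub>j\<close>, times a product of Klein forms. It is invariant under
  \<open>\<Gamma>\<^sub>1(N)\<close> if and only if \<open>12\<close> divides \<open>M\<close> and \<open>2N\<close> divides \<open>S\<^sub>2\<close>, and its order at each cusp is an explicit linear
  form in \<open>a\<close> given by second Bernoulli polynomials. So membership in \<open>L\<^sub>N(k)\<close> is a system of congruences and
  linear inequalities (\<open>L_characterisation\<close>). The order at the cusp \<open>A / C\<close> depends only on \<open>g = gcd C N\<close> and on
  \<open>\<plusminus>A\<close> modulo \<open>g\<close>. For the seven levels the passage from \<open>a\<close> to the orders is a bijection onto all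
  vectors of nonnegative integers with the total number of zeros prescribed by the weight
  (\<open>card_L_eqI\<close>), and counting these gives the binomial sums (\<open>card_L\<close>).

  The same products decide when the genus vanishes. For the seven levels there is a product \<open>h\<close> of weight \<open>2\<close>
  with order \<open>0\<close> or \<open>1\<close> at every cusp, not always \<open>1\<close>. If \<open>f d\<tau>\<close> is a holomorphic differential, then \<open>f / h\<close> is
  bounded and vanishes at a cusp; the product of its translates is a function of level one that
  vanishes at the cusp, hence zero by the maximum modulus principle (\<open>Gamma1_invariant_zero\<close>). Conversely, a
  product of weight \<open>2\<close> with positive order at all cusps is a nonzero differential, on its level and on
  all multiples. Such products exist for the levels in \<open>has_cusp_product_small\<close>, and a single
  theta block works for all levels from \<open>13\<close> on that are prime to \<open>6\<close> (\<open>has_cusp_product_coprime_6\<close>). Every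
  other \<open>N \<ge> 5\<close> outside the list is a multiple of one of these levels.
\<close>

section \<open>The q-Pochhammer symbol\<close>

text \<open>\<open>qinf x q\<close> is \<open>(x; q)\<^sub>\<infinity>\<close>, meaningful for \<open>\<bar>q\<bar> < 1\<close>.\<close>

definition qinf :: "complex \<Rightarrow> complex \<Rightarrow> complex" where
  "qinf x q = prodinf (\<lambda>n. 1 - x * q ^ n)"

lemma summable_norm_geometric_factor:
  fixes x q :: complex
  assumes "norm q < 1"
  shows "summable (\<lambda>n. norm (x * q ^ n))"
  using assms by (auto simp: norm_mult norm_power intro!: summable_mult summable_geometric)

lemma qinf_convergent:
  fixes x q :: complex
  assumes "norm q < 1"
  shows "convergent_prod (\<lambda>n. 1 - x * q ^ n)"
proof -
  have "abs_convergent_prod (\<lambda>n. 1 - x * q ^ n)"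
    unfolding abs_convergent_prod_conv_summable
    using summable_norm_geometric_factor[OF assms, of x] by simp
  then show ?thesis
    by (rule abs_convergent_prod_imp_convergent_prod)
qed

lemma qinf_LIMSEQ:
  fixes x q :: complex
  assumes "norm q < 1"
  shows "(\<lambda>N. \<Prod>n<N. 1 - x * q ^ n) \<longlonglongrightarrow> qinf x q"
  using convergent_prod_LIMSEQ[OF qinf_convergent[OF assms, of x]]
  unfolding qinf_def LIMSEQ_lessThan_iff_atMost .

lemma qinf_rec:
  assumes "norm q < 1"
  shows "qinf x q = (1 - x) * qinf (x * q) q"
proof -
  have "(\<lambda>N. (1 - x) * (\<Prod>n<N. 1 - (x * q) * q ^ n)) \<longlonglongrightarrow> (1 - x) * qinf (x * q) q"
    by (intro tendsto_intros qinf_LIMSEQ assms)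
  moreover have "(1 - x) * (\<Prod>n<N. 1 - (x * q) * q ^ n) = (\<Prod>n<Suc N. 1 - x * q ^ n)" for N
    by (subst prod.lessThan_Suc_shift) (simp add: mult.assoc)
  moreover have "(\<lambda>N. \<Prod>n<Suc N. 1 - x * q ^ n) \<longlonglongrightarrow> qinf x q"
    using qinf_LIMSEQ[OF assms, of x] by (rule LIMSEQ_Suc)
  ultimately show ?thesis
    using LIMSEQ_unique by auto
qed

lemma qinf_eq_0_iff:
  assumes "norm q < 1"
  shows "qinf x q = 0 \<longleftrightarrow> (\<exists>n. x * q ^ n = 1)"
proof -
  have "(\<lambda>n. 1 - x * q ^ n) has_prod qinf x q"
    unfolding qinf_def using qinf_convergent[OF assms] by (rule convergent_prod_has_prod)
  from has_prod_eq_0_iff[OF this] have "qinf x q = 0 \<longleftrightarrow> 0 \<in> range (\<lambda>n. 1 - x * q ^ n)" .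
  also have "\<dots> \<longleftrightarrow> (\<exists>n. x * q ^ n = 1)" by (auto simp: image_iff)
  finally show ?thesis .
qed

lemma qinf_self_nonzero:
  assumes "norm q < 1" shows "qinf q q \<noteq> 0"
proof -
  have "norm (q * q ^ n) < 1" for n
  proof -
    have "norm q * norm q ^ n \<le> norm q * 1"
      using assms by (intro mult_left_mono) (auto simp: power_le_one)
    with assms show ?thesis by (simp add: norm_mult norm_power)
  qed
  then have "q * q ^ n \<noteq> 1" for n
    using norm_one less_irrefl[of "1::real"] by metis
  then show ?thesis by (simp add: qinf_eq_0_iff[OF assms])
qed

text \<open>The \<open>q\<close>-Pochhammer symbol is holomorphic in both arguments jointly: its partial products
  converge locally uniformly by the Weierstrass test.\<close>

lemma holomorphic_qinf:
  assumes "open A" and f: "f holomorphic_on A" and g: "g holomorphic_on A"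
    and lt: "\<And>z. z \<in> A \<Longrightarrow> norm (g z) < 1"
  shows "(\<lambda>z. qinf (f z) (g z)) holomorphic_on A"
proof (rule holomorphic_uniform_sequence[OF \<open>open A\<close>, where f = "\<lambda>N z. \<Prod>n<N. 1 - f z * g z ^ n"])
  show "(\<lambda>z. \<Prod>n<N. 1 - f z * g z ^ n) holomorphic_on A" for N
    by (intro holomorphic_intros f g)
  fix x assume x: "x \<in> A"
  then obtain d where d: "d > 0" "cball x d \<subseteq> A"
    using \<open>open A\<close> open_contains_cball by blast
  let ?K = "cball x d"
  have cf: "continuous_on ?K f" and cg: "continuous_on ?K g"
    using f g d by (meson holomorphic_on_imp_continuous_on continuous_on_subset)+
  obtain C where C: "\<And>z. z \<in> ?K \<Longrightarrow> norm (f z) \<le> C"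
    using compact_imp_bounded[OF compact_continuous_image[OF cf compact_cball]]
    unfolding bounded_iff by (meson imageI)
  have "continuous_on ?K (\<lambda>z. norm (g z))" by (intro continuous_intros cg)
  from continuous_attains_sup[OF compact_cball _ this]
  obtain z0 where z0: "z0 \<in> ?K" "\<And>z. z \<in> ?K \<Longrightarrow> norm (g z) \<le> norm (g z0)"
    using d(1) by force
  define r where "r = norm (g z0)"
  have r: "0 \<le> r" "r < 1" using lt z0 d by (auto simp: r_def)
  have C0: "0 \<le> C" using C[of x] d(1) norm_ge_zero[of "f x"] by (smt (verit) centre_in_cball)
  have "uniformly_convergent_on ?K (\<lambda>N z. \<Prod>n<N. 1 - f z * g z ^ n)"
  proof (rule uniformly_convergent_on_prod')
    show "continuous_on ?K (\<lambda>z. 1 - f z * g z ^ n)" for n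
      by (intro continuous_intros cf cg)
    show "uniformly_convergent_on ?K (\<lambda>N z. \<Sum>n<N. norm (1 - f z * g z ^ n - 1))"
    proof (rule Weierstrass_m_test')
      show "summable (\<lambda>n. C * r ^ n)" using r by (intro summable_mult summable_geometric) auto
      fix n z assume z: "z \<in> ?K"
      show "norm (norm (1 - f z * g z ^ n - 1)) \<le> C * r ^ n"
        using C[OF z] z0(2)[OF z] C0 by (auto simp: norm_mult norm_power r_def intro!: mult_mono power_mono)
    qed
  qed simp
  then obtain l where l: "uniform_limit ?K (\<lambda>N z. \<Prod>n<N. 1 - f z * g z ^ n) l sequentially"
    unfolding uniformly_convergent_on_def by auto
  have "l z = qinf (f z) (g z)" if "z \<in> ?K" for z
    using tendsto_uniform_limitI[OF l that] qinf_LIMSEQ[OF lt, of z "f z"] that d(2)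
    by (meson LIMSEQ_unique subsetD)
  then have "uniform_limit ?K (\<lambda>N z. \<Prod>n<N. 1 - f z * g z ^ n) (\<lambda>z. qinf (f z) (g z)) sequentially"
    by (subst uniform_limit_cong'[where g = "\<lambda>N z. \<Prod>n<N. 1 - f z * g z ^ n" and i = l]) (use l in auto)
  then show "\<exists>d>0. cball x d \<subseteq> A \<and>
      uniform_limit (cball x d) (\<lambda>N z. \<Prod>n<N. 1 - f z * g z ^ n) (\<lambda>z. qinf (f z) (g z)) sequentially"
    using d by blast
qed

text \<open>Near \<open>q = 0\<close> the symbol is bounded, and bounded away from zero, uniformly in \<open>x\<close>: compare the
  factors with those at \<open>x = \<plusminus>1/2\<close>, \<open>q = 1/2\<close>. This gives the growth of all the products at the cusps.\<close>

lemma qinf_bounds: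
  obtains c C where "0 < c" "0 < C"
    "\<And>x q. norm x \<le> 1/2 \<Longrightarrow> norm q \<le> 1/2 \<Longrightarrow> c \<le> norm (qinf x q) \<and> norm (qinf x q) \<le> C"
proof -
  have nz: "qinf (a/2) (1/2) \<noteq> 0" if "norm a \<le> 1" for a
  proof -
    have "a / 2 * (1/2) ^ n \<noteq> 1" for n
    proof
      assume *: "a / 2 * (1/2) ^ n = 1"
      have "norm (a / 2 * (1/2) ^ n) \<le> 1/2 * 1"
        unfolding norm_mult using that
        by (intro mult_mono) (auto simp: norm_divide norm_power power_le_one)
      with * show False by simp
    qed
    then show ?thesis by (simp add: qinf_eq_0_iff)
  qed
  have *: "norm (qinf (1/2) (1/2)) \<le> norm (qinf x q) \<and> norm (qinf x q) \<le> norm (qinf (-1/2) (1/2))"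
    if x: "norm x \<le> 1/2" and q: "norm q \<le> 1/2" for x q
  proof -
    have l: "(\<lambda>N. norm (\<Prod>n<N. 1 - y * p ^ n)) \<longlonglongrightarrow> norm (qinf y p)" if "norm p \<le> 1/2" for y p
      by (intro tendsto_norm qinf_LIMSEQ) (use that in auto)
    have b: "norm (x * q ^ n) \<le> (1/2) * (1/2) ^ n" for n
      unfolding norm_mult norm_power using x q by (intro mult_mono power_mono) auto
    have h: "(1/2) * (1/2) ^ n \<le> (1/2 :: real)" for n by (simp add: power_le_one)
    have lo: "norm (1 - (1/2) * (1/2) ^ n :: complex) \<le> norm (1 - x * q ^ n)" for n
    proof -
      have "norm (1 - (1/2) * (1/2) ^ n :: complex) = norm (of_real (1 - (1/2) * (1/2) ^ n) :: complex)"
        by simp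
      also have "\<dots> = 1 - (1/2) * (1/2) ^ n"
        unfolding norm_of_real using h[of n] by linarith
      also have "\<dots> \<le> 1 - norm (x * q ^ n)" using b[of n] by simp
      also have "\<dots> \<le> norm (1 - x * q ^ n)"
        using norm_triangle_ineq2[of 1 "x * q ^ n"] by simp
      finally show ?thesis .
    qed
    have up: "norm (1 - x * q ^ n) \<le> norm (1 - (-1/2) * (1/2) ^ n :: complex)" for n
    proof -
      have "norm (1 - x * q ^ n) \<le> 1 + norm (x * q ^ n)"
        using norm_triangle_ineq4[of 1 "x * q ^ n"] by simp
      also have "\<dots> \<le> 1 + (1/2) * (1/2) ^ n" using b[of n] by simp
      also have "\<dots> = norm (of_real (1 + (1/2) * (1/2) ^ n) :: complex)"
        unfolding norm_of_real by (simp add: add_pos_pos)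
      also have "\<dots> = norm (1 - (-1/2) * (1/2) ^ n :: complex)" by simp
      finally show ?thesis .
    qed
    have "norm (\<Prod>n<N. 1 - (1/2) * (1/2) ^ n :: complex) \<le> norm (\<Prod>n<N. 1 - x * q ^ n)"
         "norm (\<Prod>n<N. 1 - x * q ^ n) \<le> norm (\<Prod>n<N. 1 - (-1/2) * (1/2) ^ n :: complex)" for N
      unfolding prod_norm[symmetric] using lo up by (auto intro!: prod_mono)
    moreover have "(\<lambda>N. norm (\<Prod>n<N. 1 - (1/2) * (1/2) ^ n :: complex)) \<longlonglongrightarrow> norm (qinf (1/2) (1/2))"
      "(\<lambda>N. norm (\<Prod>n<N. 1 - (-1/2) * (1/2) ^ n :: complex)) \<longlonglongrightarrow> norm (qinf (-1/2) (1/2))"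
      by (rule l, simp)+
    ultimately show ?thesis
      using l[OF q, of x] by (meson LIMSEQ_le)
  qed
  show ?thesis
    by (rule that[of "norm (qinf (1/2) (1/2))" "norm (qinf (-1/2) (1/2))"])
       (use nz[of 1] nz[of "-1"] * in auto)
qed

section \<open>The theta function\<close>

text \<open>\<open>ee z\<close> is \<open>e\<^sup>2\<^sup>\<pi>\<^sup>i\<^sup>z\<close>.\<close>

definition ee :: "complex \<Rightarrow> complex" where "ee z = exp (2 * of_real pi * \<i> * z)"

lemma ee_0 [simp]: "ee 0 = 1"
  by (simp add: ee_def)

lemma ee_add: "ee (z + w) = ee z * ee w"
  by (simp add: ee_def exp_add algebra_simps)

lemma ee_minus: "ee (- z) = inverse (ee z)"
  by (simp add: ee_def exp_minus)

lemma ee_of_int [simp]: "ee (of_int n) = 1"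
  using exp_integer_2pi[of "of_int n"] by (simp add: ee_def mult_ac)

lemma ee_of_nat [simp]: "ee (of_nat n) = 1"
  using ee_of_int[of "int n"] by simp

lemma ee_1 [simp]: "ee 1 = 1"
  using ee_of_int[of 1] by simp

lemma ee_power: "ee z ^ n = ee (of_nat n * z)"
  by (simp add: ee_def mult_ac flip: exp_of_nat_mult)

lemma ee_power_int: "ee z powi n = ee (of_int n * z)"
  by (cases n rule: int_cases2) (simp_all add: power_int_minus ee_power flip: ee_minus)

lemma ee_eq_1_iff: "ee z = 1 \<longleftrightarrow> z \<in> \<int>"
proof
  assume "ee z = 1"
  then obtain n :: int where "2 * of_real pi * \<i> * z = 2 * of_real pi * \<i> * of_int n"
    unfolding ee_def exp_eq_1 by (auto simp: complex_eq_iff)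
  then show "z \<in> \<int>" by simp
qed (auto elim!: Ints_cases)

lemma norm_ee: "norm (ee z) = exp (- 2 * pi * Im z)"
  by (simp add: ee_def norm_exp_eq_Re)

lemma norm_ee_less_1: "Im z > 0 \<Longrightarrow> norm (ee z) < 1"
  by (simp add: norm_ee)

lemma ee_nonzero [simp]: "ee z \<noteq> 0"
  by (simp add: ee_def)

lemma ee_half: "ee (1/2) = -1" "ee (-1/2) = -1" "ee (- (1/2)) = -1"
  by (simp_all add: ee_def exp_minus)

lemma holomorphic_ee [holomorphic_intros]:
  "f holomorphic_on A \<Longrightarrow> (\<lambda>z. ee (f z)) holomorphic_on A"
  unfolding ee_def by (intro holomorphic_intros)

lemma DERIV_ee [derivative_intros]:
  "(f has_field_derivative D) (at z within A) \<Longrightarrow>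
    ((\<lambda>z. ee (f z)) has_field_derivative ee (f z) * (2 * of_real pi * \<i> * D)) (at z within A)"
  unfolding ee_def by (auto intro!: derivative_eq_intros)

text \<open>The odd Jacobi theta function divided by \<open>\<eta>\<^sup>3\<close>, written as a product. As a function of \<open>z\<close> it is
  entire, quasi-periodic for the lattice \<open>\<int> + \<int>\<tau>\<close>, and its zeros are exactly the lattice points. The
  normalisation makes its derivative at \<open>0\<close> equal to \<open>-2\<pi>i\<close>, independently of \<open>\<tau>\<close>.\<close>

definition phi :: "complex \<Rightarrow> complex \<Rightarrow> complex" where
  "phi z \<tau> = ee (- z / 2) * qinf (ee z) (ee \<tau>) * qinf (ee \<tau> / ee z) (ee \<tau>) / qinf (ee \<tau>) (ee \<tau>) ^ 2"

lemma holomorphic_phi: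
  assumes "open A" "f holomorphic_on A" "g holomorphic_on A" "\<And>z. z \<in> A \<Longrightarrow> Im (g z) > 0"
  shows "(\<lambda>z. phi (f z) (g z)) holomorphic_on A"
  unfolding phi_def
  using assms by (intro holomorphic_intros holomorphic_qinf)
    (auto simp: norm_ee qinf_self_nonzero norm_ee_less_1)

lemma phi_shift_1: "phi (z + 1) \<tau> = - phi z \<tau>"
proof -
  have "ee (- (z + 1) / 2) = ee (- z / 2) * ee (-1/2)"
    by (simp flip: ee_add add: field_simps)
  then have 1: "ee (- (z + 1) / 2) = - ee (- z / 2)" by (simp add: ee_half)
  have 2: "ee (z + 1) = ee z" using ee_add[of z 1] by simp
  show ?thesis unfolding phi_def 1 2 by simp
qed

lemma phi_shift_tau:
  assumes "Im \<tau> > 0"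
  shows "phi (z + \<tau>) \<tau> = - ee (- \<tau> / 2 - z) * phi z \<tau>"
proof -
  define \<zeta> q P where "\<zeta> = ee z" and "q = ee \<tau>" and "P = qinf q q"
  have q: "norm q < 1" using norm_ee_less_1[OF assms] by (simp add: q_def)
  have nz: "\<zeta> \<noteq> 0" "q \<noteq> 0" by (auto simp: \<zeta>_def q_def)
  have 1: "ee (- (z + \<tau>) / 2) = ee (- z / 2) * ee (- \<tau> / 2)"
    by (simp flip: ee_add add: field_simps)
  have 2: "ee (- \<tau> / 2 - z) = ee (- \<tau> / 2) / \<zeta>"
    using ee_add[of "- \<tau> / 2" "- z"]
    by (simp only: \<zeta>_def ee_minus[of z] divide_inverse[of "ee _"] add_uminus_conv_diff)
  have 3: "qinf (1 / \<zeta>) q = (1 - 1 / \<zeta>) * qinf (q / \<zeta>) q"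
    using qinf_rec[OF q, of "1 / \<zeta>"] by simp
  have 4: "qinf \<zeta> q = (1 - \<zeta>) * qinf (\<zeta> * q) q"
    using qinf_rec[OF q] .
  have 5: "1 - 1 / \<zeta> = - (1 - \<zeta>) / \<zeta>"
    using nz by (simp add: field_simps)
  have 6: "A * B * X * (- w / \<zeta> * Y) / p = - (B / \<zeta>) * (A * (w * X) * Y / p)" for A B X Y w p
    by (simp add: mult_ac)
  have "phi (z + \<tau>) \<tau> = ee (- z / 2) * ee (- \<tau> / 2) * qinf (\<zeta> * q) q * qinf (1 / \<zeta>) q / P ^ 2"
    unfolding phi_def 1 ee_add using nz by (simp add: \<zeta>_def[symmetric] q_def[symmetric] P_def)
  also have "\<dots> = - ee (- \<tau> / 2 - z) * (ee (- z / 2) * qinf \<zeta> q * qinf (q / \<zeta>) q / P ^ 2)"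
    unfolding 2 3 4 5 by (rule 6)
  finally show ?thesis
    by (simp add: phi_def \<zeta>_def q_def P_def)
qed

lemma phi_shift_int: "phi (z + of_int n) \<tau> = ee (of_int n / 2) * phi z \<tau>"
proof (induction n rule: int_induct[where k = 0])
  case (step1 i)
  have "phi (z + of_int (i + 1)) \<tau> = - phi (z + of_int i) \<tau>"
    using phi_shift_1[of "z + of_int i"] by (simp add: add_ac)
  with step1 show ?case
    using ee_add[of "of_int i / 2" "1/2"] by (simp add: ee_half add_divide_distrib)
next
  case (step2 i)
  have "phi (z + of_int i) \<tau> = - phi (z + of_int (i - 1)) \<tau>"
    using phi_shift_1[of "z + of_int (i - 1)"] by (simp add: add_ac)
  with step2 show ?case
    using ee_add[of "of_int i / 2" "-1/2"] by (simp add: ee_half diff_divide_distrib minus_equation_iff[of "phi _ _"])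
qed auto

lemma phi_shift_tau_int:
  assumes "Im \<tau> > 0"
  shows "phi (z + of_int m * \<tau>) \<tau> = ee (of_int m / 2 - of_int m ^ 2 * \<tau> / 2 - of_int m * z) * phi z \<tau>"
proof (induction m rule: int_induct[where k = 0])
  case (step1 i)
  have "phi (z + of_int (i + 1) * \<tau>) \<tau> = ee (1/2) * ee (- \<tau> / 2 - (z + of_int i * \<tau>)) * phi (z + of_int i * \<tau>) \<tau>"
    using phi_shift_tau[OF assms, of "z + of_int i * \<tau>"] by (simp add: algebra_simps ee_half)
  also have "\<dots> = ee (1/2 + (- \<tau> / 2 - (z + of_int i * \<tau>)) + (of_int i / 2 - of_int i ^ 2 * \<tau> / 2 - of_int i * z)) * phi z \<tau>"
    unfolding step1 ee_add by simp
  also have "1/2 + (- \<tau> / 2 - (z + of_int i * \<tau>)) + (of_int i / 2 - of_int i ^ 2 * \<tau> / 2 - of_int i * z)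
     = of_int (i + 1) / 2 - of_int (i + 1) ^ 2 * \<tau> / 2 - of_int (i + 1) * z"
    by (simp add: field_simps power2_eq_square)
  finally show ?case .
next
  case (step2 i)
  have "phi (z + of_int i * \<tau>) \<tau> = ee (1/2) * ee (- \<tau> / 2 - (z + of_int (i - 1) * \<tau>)) * phi (z + of_int (i - 1) * \<tau>) \<tau>"
    using phi_shift_tau[OF assms, of "z + of_int (i - 1) * \<tau>"] by (simp add: algebra_simps ee_half)
  then have "phi (z + of_int (i - 1) * \<tau>) \<tau> = inverse (ee (1/2 + (- \<tau> / 2 - (z + of_int (i - 1) * \<tau>)))) * phi (z + of_int i * \<tau>) \<tau>"
    unfolding ee_add[of "1/2"] by (simp add: field_simps)
  also have "\<dots> = ee (- (1/2 + (- \<tau> / 2 - (z + of_int (i - 1) * \<tau>))) + (of_int i / 2 - of_int i ^ 2 * \<tau> / 2 - of_int i * z)) * phi z \<tau>"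
    unfolding step2 ee_add ee_minus by simp
  also have "- (1/2 + (- \<tau> / 2 - (z + of_int (i - 1) * \<tau>))) + (of_int i / 2 - of_int i ^ 2 * \<tau> / 2 - of_int i * z)
     = of_int (i - 1) / 2 - of_int (i - 1) ^ 2 * \<tau> / 2 - of_int (i - 1) * z"
    by (simp add: field_simps power2_eq_square)
  finally show ?case .
qed auto

lemma phi_shift:
  assumes "Im \<tau> > 0"
  shows "phi (z + of_int m * \<tau> + of_int n) \<tau> =
    ee ((of_int m + of_int n) / 2 - of_int m ^ 2 * \<tau> / 2 - of_int m * z) * phi z \<tau>"
proof -
  have *: "of_int n / 2 + (of_int m / 2 - of_int m ^ 2 * \<tau> / 2 - of_int m * z)
    = (of_int m + of_int n) / 2 - of_int m ^ 2 * \<tau> / 2 - of_int m * z"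
    by (simp add: field_simps)
  show ?thesis
    unfolding phi_shift_int phi_shift_tau_int[OF assms] mult.assoc[symmetric] ee_add[symmetric] * ..
qed

lemma phi_0 [simp]: "Im \<tau> > 0 \<Longrightarrow> phi 0 \<tau> = 0"
  using qinf_eq_0_iff[of "ee \<tau>" 1] norm_ee_less_1[of \<tau>]
  by (auto simp: phi_def intro!: exI[of _ 0])

lemma phi_eq_0_iff:
  assumes "Im \<tau> > 0"
  shows "phi z \<tau> = 0 \<longleftrightarrow> (\<exists>m n :: int. z = of_int m * \<tau> + of_int n)"
proof
  assume "\<exists>m n :: int. z = of_int m * \<tau> + of_int n"
  then show "phi z \<tau> = 0"
    using phi_shift[OF assms, of 0] assms by auto
next
  note q = norm_ee_less_1[OF assms]
  assume "phi z \<tau> = 0"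
  then have "qinf (ee z) (ee \<tau>) = 0 \<or> qinf (ee \<tau> / ee z) (ee \<tau>) = 0"
    using qinf_self_nonzero[OF q] by (auto simp: phi_def)
  then show "\<exists>m n :: int. z = of_int m * \<tau> + of_int n"
  proof
    assume "qinf (ee z) (ee \<tau>) = 0"
    then obtain n where "ee z * ee \<tau> ^ n = 1" using qinf_eq_0_iff[OF q] by auto
    then have "ee (z + of_nat n * \<tau>) = 1" by (simp add: ee_power ee_add)
    then obtain k where "z + of_nat n * \<tau> = of_int k" unfolding ee_eq_1_iff by (auto elim: Ints_cases)
    then have "z = of_int (- int n) * \<tau> + of_int k" by (simp add: algebra_simps)
    then show ?thesis by blast
  next
    assume "qinf (ee \<tau> / ee z) (ee \<tau>) = 0"
    then obtain n where "ee \<tau> / ee z * ee \<tau> ^ n = 1" using qinf_eq_0_iff[OF q] by auto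
    then have "ee (\<tau> + of_nat n * \<tau> + (- z)) = 1"
      unfolding ee_add ee_minus ee_power by (simp add: field_simps)
    then obtain k where "\<tau> + of_nat n * \<tau> + (- z) = of_int k" unfolding ee_eq_1_iff by (auto elim: Ints_cases)
    then have "z = of_int (int (n + 1)) * \<tau> + of_int (- k)" by (simp add: algebra_simps)
    then show ?thesis by blast
  qed
qed

lemma DERIV_phi_0:
  assumes "Im \<tau> > 0"
  shows "((\<lambda>z. phi z \<tau>) has_field_derivative (- 2 * of_real pi * \<i>)) (at 0)"
proof -
  note q = norm_ee_less_1[OF assms]
  define g where "g z = ee (- z / 2) * qinf (ee z * ee \<tau>) (ee \<tau>) * qinf (ee \<tau> / ee z) (ee \<tau>) / qinf (ee \<tau>) (ee \<tau>) ^ 2" for z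
  have eq: "phi z \<tau> = (1 - ee z) * g z" for z
    using qinf_rec[OF q, of "ee z"] by (simp add: phi_def g_def)
  have "g holomorphic_on UNIV"
    unfolding g_def using assms q by (intro holomorphic_intros holomorphic_qinf) (auto simp: qinf_self_nonzero)
  then obtain D where D: "(g has_field_derivative D) (at 0)"
    by (meson UNIV_I field_differentiable_def holomorphic_on_imp_differentiable_at open_UNIV)
  have g0: "g 0 = 1" using qinf_self_nonzero[OF q] by (simp add: g_def power2_eq_square)
  show ?thesis
    unfolding eq by (rule derivative_eq_intros D refl | simp add: g0)+
qed

lemma periodic_of_int:
  fixes f :: "complex \<Rightarrow> 'a"
  assumes "\<And>z. f (z + w) = f z"
  shows "f (z + of_int n * w) = f z"
proof (induction n rule: int_induct[where k = 0])
  case (step1 i)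
  then show ?case using assms[of "z + of_int i * w"] by (simp add: algebra_simps)
next
  case (step2 i)
  then show ?case using assms[of "z + of_int (i - 1) * w"] by (simp add: algebra_simps)
qed simp

lemma Im_moebius:
  fixes a b c d :: int
  assumes "a * d - b * c = 1"
  shows "Im ((of_int a * \<tau> + of_int b) / (of_int c * \<tau> + of_int d)) = Im \<tau> / (norm (of_int c * \<tau> + of_int d))\<^sup>2"
proof -
  have "real_of_int a * real_of_int d - real_of_int b * real_of_int c = 1"
    using assms by (metis of_int_1 of_int_diff of_int_mult)
  then have *: "real_of_int a * real_of_int d = 1 + real_of_int b * real_of_int c" by simp
  have "real_of_int a * Im \<tau> * (real_of_int c * Re \<tau> + real_of_int d) -
      (real_of_int a * Re \<tau> + real_of_int b) * (real_of_int c * Im \<tau>) = (real_of_int a * real_of_int d) * Im \<tau> - real_of_int b * real_of_int c * Im \<tau>"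
    by (simp add: algebra_simps)
  also have "\<dots> = Im \<tau>" unfolding * by (simp add: algebra_simps)
  finally show ?thesis by (simp add: Im_divide cmod_power2)
qed

lemma aut_nonzero:
  fixes a b c d :: int
  assumes "a * d - b * c = 1" "Im \<tau> > 0"
  shows "of_int c * \<tau> + of_int d \<noteq> (0 :: complex)"
proof
  assume *: "of_int c * \<tau> + of_int d = 0"
  then have "Im (of_int c * \<tau> + of_int d) = 0" by simp
  then have "c = 0" using assms by simp
  with * assms show False by simp
qed


text \<open>The transformation law of the theta function under the full modular group. The quotient of
  the two sides is doubly periodic in \<open>z\<close>; both sides vanish to first order exactly on the lattice,
  so the quotient extends to a bounded entire function and is constant by Liouville's theorem.\<close>

theorem phi_modular:
  fixes a b c d :: int
  assumes det: "a * d - b * c = 1" and \<tau>: "Im \<tau> > 0"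
  defines "j \<equiv> of_int c * \<tau> + of_int d"
  shows "phi (z / j) ((of_int a * \<tau> + of_int b) / j) = ee (of_int c * z\<^sup>2 / (2 * j)) / j * phi z \<tau>"
proof -
  define \<tau>' where "\<tau>' = (of_int a * \<tau> + of_int b) / j"
  have j0: "j \<noteq> 0" unfolding j_def using aut_nonzero[OF det \<tau>] .
  have \<tau>': "Im \<tau>' > 0"
    unfolding \<tau>'_def j_def Im_moebius[OF det] using \<tau> j0 by (simp add: j_def)
  have detc: "of_int a * of_int d - of_int b * of_int c = (1 :: complex)"
    using det by (metis of_int_1 of_int_diff of_int_mult)
  have jt: "\<tau>' * j = of_int a * \<tau> + of_int b" using j0 by (simp add: \<tau>'_def)
  have j1: "(of_int (- c) * \<tau>' + of_int a) * j = 1"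
  proof -
    have "(of_int (- c) * \<tau>' + of_int a) * j = of_int a * j - of_int c * (\<tau>' * j)" by (simp add: algebra_simps)
    also have "\<dots> = of_int a * of_int d - of_int b * of_int c" unfolding jt by (simp add: j_def algebra_simps)
    finally show ?thesis using detc by simp
  qed
  have j2: "(of_int d * \<tau>' + of_int (- b)) * j = \<tau>"
  proof -
    have "(of_int d * \<tau>' + of_int (- b)) * j = of_int d * (\<tau>' * j) - of_int b * j" by (simp add: algebra_simps)
    also have "\<dots> = (of_int a * of_int d - of_int b * of_int c) * \<tau>" unfolding jt by (simp add: j_def algebra_simps)
    finally show ?thesis using detc by simp
  qed
  define G where "G z = j * phi (z / j) \<tau>' * ee (- (of_int c * z\<^sup>2 / (2 * j)))" for z
  have par: "odd (x * y + x + y)" if "odd x \<or> odd y" for x y :: int using that by auto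
  have hpar: "ee (of_int k / 2) = -1" if "odd k" for k :: int
  proof -
    from that obtain l where "k = 2 * l + 1" by (rule oddE)
    then have "of_int k / 2 = of_int l + (1/2 :: complex)" by (simp add: add_divide_distrib)
    then show ?thesis by (simp only: ee_add ee_of_int ee_half mult_1_left)
  qed
  have odd_ac: "odd a \<or> odd c" "odd b \<or> odd d"
  proof -
    have "even (a * d - b * c)" if "even a \<and> even c \<or> even b \<and> even d" using that by auto
    then show "odd a \<or> odd c" "odd b \<or> odd d" unfolding det by auto
  qed
  \<comment> \<open>\<open>G\<close> has the quasi-periods of \<open>phi\<close>; in the basis \<open>\<tau>', 1\<close> the translations by \<open>1 / j\<close> and \<open>\<tau> / j\<close>
    have the coordinates \<open>(-c, a)\<close> and \<open>(d, -b)\<close>\<close>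
  have G1: "G (z + 1) = - G z" for z
  proof -
    have j1': "of_int (- c) * \<tau>' + of_int a = 1 / j"
      using eq_divide_imp[OF j0 j1] .
    have zj: "(z + 1) / j = z / j + of_int (- c) * \<tau>' + of_int a"
      unfolding add.assoc j1' by (simp add: add_divide_distrib)
    have cj: "of_int c * \<tau>' = of_int a - 1 / j" unfolding j1'[symmetric] by simp
    have sq: "(of_int (- c))\<^sup>2 * \<tau>' / 2 = of_int c * (of_int a - 1 / j) / 2"
      unfolding cj[symmetric] by (simp add: power2_eq_square)
    have ex: "(of_int (- c) + of_int a) / 2 - (of_int (- c))\<^sup>2 * \<tau>' / 2 - of_int (- c) * (z / j)
        + - (of_int c * (z + 1)\<^sup>2 / (2 * j))
      = of_int (a * c + a + c) / 2 + of_int (- c - a * c) + - (of_int c * z\<^sup>2 / (2 * j))"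
      unfolding sq using j0 by (simp add: field_simps power2_eq_square)
    have "G (z + 1) = j * (ee ((of_int (- c) + of_int a) / 2 - (of_int (- c))\<^sup>2 * \<tau>' / 2 - of_int (- c) * (z / j)
        + - (of_int c * (z + 1)\<^sup>2 / (2 * j)))) * phi (z / j) \<tau>'"
      unfolding G_def zj phi_shift[OF \<tau>'] ee_add by (simp add: mult_ac)
    also have "\<dots> = - G z"
      unfolding ex ee_add ee_of_int hpar[OF par[OF odd_ac(1)]] by (simp add: G_def mult_ac)
    finally show ?thesis .
  qed
  have G2: "G (z + \<tau>) = - ee (- \<tau> / 2 - z) * G z" for z
  proof -
    have j2': "of_int d * \<tau>' + of_int (- b) = \<tau> / j"
      using eq_divide_imp[OF j0 j2] .
    have zj: "(z + \<tau>) / j = z / j + of_int d * \<tau>' + of_int (- b)"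
      unfolding add.assoc j2' by (simp add: add_divide_distrib)
    have dj: "of_int d * \<tau>' = \<tau> / j + of_int b" unfolding j2'[symmetric] by simp
    have sq: "(of_int d)\<^sup>2 * \<tau>' / 2 = of_int d * (\<tau> / j + of_int b) / 2"
      unfolding dj[symmetric] by (simp add: power2_eq_square)
    have jj: "(of_int d + of_int c * \<tau>) / j = 1" using j0 by (simp add: j_def add_ac)
    have "(of_int d + of_int (- b)) / 2 - (of_int d)\<^sup>2 * \<tau>' / 2 - of_int d * (z / j)
        + - (of_int c * (z + \<tau>)\<^sup>2 / (2 * j))
      = (of_int d - of_int b - of_int b * of_int d) / 2 - of_int c * z\<^sup>2 / (2 * j)
        - (\<tau> / 2 + z) * ((of_int d + of_int c * \<tau>) / j)"
      unfolding sq using j0 by (simp add: field_simps power2_eq_square)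
    also have "\<dots> = of_int (b * d + b + d) / 2 + of_int (- b - b * d) + - (of_int c * z\<^sup>2 / (2 * j)) + (- \<tau> / 2 - z)"
      unfolding jj by (simp add: field_simps)
    finally have ex: "(of_int d + of_int (- b)) / 2 - (of_int d)\<^sup>2 * \<tau>' / 2 - of_int d * (z / j)
        + - (of_int c * (z + \<tau>)\<^sup>2 / (2 * j))
        = of_int (b * d + b + d) / 2 + of_int (- b - b * d) + - (of_int c * z\<^sup>2 / (2 * j)) + (- \<tau> / 2 - z)" .
    have "G (z + \<tau>) = j * (ee ((of_int d + of_int (- b)) / 2 - (of_int d)\<^sup>2 * \<tau>' / 2 - of_int d * (z / j)
        + - (of_int c * (z + \<tau>)\<^sup>2 / (2 * j)))) * phi (z / j) \<tau>'"
      unfolding G_def zj phi_shift[OF \<tau>'] ee_add by (simp add: mult_ac)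
    also have "\<dots> = - ee (- \<tau> / 2 - z) * G z"
      unfolding ex ee_add[of _ "- \<tau> / 2 - z"] ee_add[of _ "- (of_int c * z\<^sup>2 / (2 * j))"] ee_add[of "of_int _ / 2"]
        ee_of_int hpar[OF par[OF odd_ac(2)]] by (simp add: G_def mult_ac)
    finally show ?thesis .
  qed
  \<comment> \<open>the value \<open>1\<close> at the lattice points is the limit, as both derivatives at \<open>0\<close> are \<open>-2\<pi>i\<close>\<close>
  define R where "R z = (if phi z \<tau> = 0 then 1 else G z / phi z \<tau>)" for z
  have R1: "R (z + 1) = R z" for z by (simp add: R_def phi_shift_1 G1)
  have R2: "R (z + \<tau>) = R z" for z by (simp add: R_def phi_shift_tau[OF \<tau>] G2)
  have R12: "R (z + of_int m * \<tau> + of_int n) = R z" for z m n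
    using periodic_of_int[of R 1 "z + of_int m * \<tau>" n] periodic_of_int[of R \<tau> z m] R1 R2 by simp
  have Rm: "R (z - of_int m * \<tau> - of_int n) = R z" for z m n
    using R12[of z "-m" "-n"] by simp

  have holphi: "(\<lambda>z. phi z \<tau>) holomorphic_on UNIV"
    using \<tau> by (intro holomorphic_phi holomorphic_intros) auto
  have holG: "G holomorphic_on UNIV"
    unfolding G_def using j0 \<tau>' by (intro holomorphic_intros holomorphic_phi) auto
  have dphi: "((\<lambda>z. phi z \<tau> / z) \<longlongrightarrow> - 2 * of_real pi * \<i>) (at 0)"
    using DERIV_phi_0[OF \<tau>] \<tau> by (simp add: DERIV_def)
  have dG: "((\<lambda>z. G z / z) \<longlongrightarrow> - 2 * of_real pi * \<i>) (at 0)"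
  proof -
    have *: "((\<lambda>z. phi z \<tau>') has_field_derivative (- 2 * of_real pi * \<i>)) (at (0 / j))"
      using DERIV_phi_0[OF \<tau>'] by simp
    have "((\<lambda>z. z / j) has_field_derivative (1 / j)) (at 0)"
      using j0 by (auto intro!: derivative_eq_intros)
    from DERIV_chain2[OF * this]
    have "((\<lambda>z. phi (z / j) \<tau>') has_field_derivative (- 2 * of_real pi * \<i> * (1 / j))) (at 0)" .
    then have "(G has_field_derivative (- 2 * of_real pi * \<i>)) (at 0)"
      unfolding G_def using j0 \<tau>' by (auto intro!: derivative_eq_intros)
    moreover have "G 0 = 0" using \<tau>' by (simp add: G_def)
    ultimately show ?thesis by (simp add: DERIV_def)
  qed
  have ev: "eventually (\<lambda>z. phi z \<tau> \<noteq> 0) (at 0)"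
  proof -
    have "eventually (\<lambda>z. phi z \<tau> / z \<in> - {0}) (at 0)"
      by (rule topological_tendstoD[OF dphi]) auto
    then show ?thesis by eventually_elim auto
  qed
  then obtain \<delta> where \<delta>: "\<delta> > 0" "\<And>z. z \<noteq> 0 \<Longrightarrow> dist z 0 < \<delta> \<Longrightarrow> phi z \<tau> \<noteq> 0"
    unfolding eventually_at by auto
  have Rlim: "(R \<longlongrightarrow> R 0) (at 0)"
  proof -
    have "((\<lambda>z. (G z / z) / (phi z \<tau> / z)) \<longlongrightarrow> (- 2 * of_real pi * \<i>) / (- 2 * of_real pi * \<i>)) (at 0)"
      by (intro tendsto_divide dG dphi) auto
    moreover have "eventually (\<lambda>z. (G z / z) / (phi z \<tau> / z) = R z) (at 0)"
      using ev eventually_neq_at_within[of 0 0 UNIV] by eventually_elim (auto simp: R_def)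
    ultimately have "(R \<longlongrightarrow> (- 2 * of_real pi * \<i>) / (- 2 * of_real pi * \<i>)) (at 0)"
      by (rule Lim_transform_eventually)
    then show ?thesis using \<tau> by (simp add: R_def)
  qed
  have Rhol_nz: "R holomorphic_on {z. phi z \<tau> \<noteq> 0}"
  proof -
    have "(\<lambda>z. G z / phi z \<tau>) holomorphic_on {z. phi z \<tau> \<noteq> 0}"
      by (intro holomorphic_intros holomorphic_on_subset[OF holphi] holomorphic_on_subset[OF holG]) auto
    then show ?thesis by (rule holomorphic_transform) (auto simp: R_def)
  qed
  have opn: "open {z. phi z \<tau> \<noteq> 0}"
    using holomorphic_on_imp_continuous_on[OF holphi]
    by (intro open_Collect_neq continuous_intros)
  have Rhol0: "R holomorphic_on ball 0 \<delta>"
  proof (rule no_isolated_singularity'[where K = "{0}"])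
    show "R holomorphic_on ball 0 \<delta> - {0}"
      by (rule holomorphic_on_subset[OF Rhol_nz]) (use \<delta> in \<open>auto simp: dist_commute\<close>)
    show "(R \<longlongrightarrow> R z) (at z within ball 0 \<delta>)" if "z \<in> {0}" for z
      using Rlim that by (auto intro: tendsto_within_subset)
  qed auto
  have "R field_differentiable (at z)" for z
  proof (cases "phi z \<tau> = 0")
    case False
    then show ?thesis
      using holomorphic_on_imp_differentiable_at[OF Rhol_nz opn] by simp
  next
    case True
    then obtain m n where z: "z = of_int m * \<tau> + of_int n" using phi_eq_0_iff[OF \<tau>] by auto
    have "R field_differentiable (at (z - z))"
      using holomorphic_on_imp_differentiable_at[OF Rhol0] \<delta>(1) by simp
    then obtain D where D: "(R has_field_derivative D) (at (z - z))" by (auto simp: field_differentiable_def)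
    have "((\<lambda>w. w - z) has_field_derivative 1) (at z)" by (auto intro!: derivative_eq_intros)
    from DERIV_chain2[OF D this] have "((\<lambda>w. R (w - z)) has_field_derivative D * 1) (at z)" .
    moreover have "R (w - z) = R w" for w
      using Rm[of w m n] by (simp add: z algebra_simps)
    ultimately show ?thesis by (auto simp: field_differentiable_def)
  qed
  then have Rhol: "R holomorphic_on UNIV"
    by (simp add: holomorphic_on_def field_differentiable_at_within)
  have bdd: "bounded (range R)"
  proof -
    define K where "K = (\<lambda>(u, v). of_real u + of_real v * \<tau>) ` (({0..1} :: real set) \<times> ({0..1} :: real set))"
    have "compact K" unfolding K_def case_prod_beta
      by (intro compact_continuous_image compact_Times continuous_intros) auto
    moreover have "continuous_on K R"
      using holomorphic_on_imp_continuous_on[OF Rhol] continuous_on_subset by blast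
    ultimately have "bounded (R ` K)"
      using compact_continuous_image compact_imp_bounded by blast
    moreover have "range R \<subseteq> R ` K"
    proof
      fix y assume "y \<in> range R"
      then obtain z where z: "y = R z" by auto
      define v where "v = Im z / Im \<tau>"
      define u where "u = Re z - v * Re \<tau>"
      have zuv: "z = of_real u + of_real v * \<tau>"
        using \<tau> by (simp add: complex_eq_iff u_def v_def)
      define w where "w = of_real (frac u) + of_real (frac v) * \<tau>"
      have "w = z - of_int \<lfloor>v\<rfloor> * \<tau> - of_int \<lfloor>u\<rfloor>"
        by (simp add: w_def zuv frac_def algebra_simps)
      then have "R w = R z" using Rm by simp
      moreover have "w \<in> K" unfolding K_def w_def
        by (rule image_eqI[of _ _ "(frac u, frac v)"]) (auto simp: frac_ge_0 less_imp_le[OF frac_lt_1])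
      ultimately show "y \<in> R ` K" using z by (metis imageI)
    qed
    ultimately show ?thesis using bounded_subset by blast
  qed
  obtain k where k: "\<And>z. R z = k"
    using Liouville_theorem[OF Rhol bdd] by (auto simp: constant_on_def)
  have "k = 1" using k[of 0] \<tau> by (simp add: R_def)
  have Geq: "G z = phi z \<tau>"
  proof (cases "phi z \<tau> = 0")
    case False
    then show ?thesis using k[of z] \<open>k = 1\<close> by (simp add: R_def split: if_splits)
  next
    case True
    then obtain m n where z: "z = of_int m * \<tau> + of_int n" using phi_eq_0_iff[OF \<tau>] by auto
    have "z = (of_int m * (of_int d * \<tau>' + of_int (- b)) + of_int n * (of_int (- c) * \<tau>' + of_int a)) * j"
      unfolding distrib_right[of "of_int m * _"] mult.assoc[of "of_int m"] mult.assoc[of "of_int n"] j1 j2 mult_1_right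
      by (rule z)
    from divide_eq_imp[OF j0 this]
    have "z / j = of_int (m * d - n * c) * \<tau>' + of_int (n * a - m * b)"
      by (simp add: algebra_simps)
    then have "phi (z / j) \<tau>' = 0" using phi_eq_0_iff[OF \<tau>'] by blast
    then show ?thesis using True by (simp add: G_def)
  qed
  have "phi (z / j) \<tau>' = ee (of_int c * z\<^sup>2 / (2 * j)) / j * G z"
    using j0 by (simp add: G_def ee_minus)
  then show ?thesis unfolding Geq \<tau>'_def .
qed

section \<open>Klein forms\<close>

text \<open>The Klein form with characteristic \<open>(r\<^sub>1, r\<^sub>2)\<close>, up to a constant factor.\<close>

definition kl :: "real \<Rightarrow> real \<Rightarrow> complex \<Rightarrow> complex" where
  "kl r1 r2 \<tau> = ee (of_real r1 * (of_real r1 * \<tau> + of_real r2) / 2) * phi (of_real r1 * \<tau> + of_real r2) \<tau>"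

lemma holomorphic_kl:
  assumes "open A" "g holomorphic_on A" "\<And>z. z \<in> A \<Longrightarrow> Im (g z) > 0"
  shows "(\<lambda>z. kl r1 r2 (g z)) holomorphic_on A"
  unfolding kl_def using assms by (intro holomorphic_intros holomorphic_phi) auto

lemma kl_nonzero:
  assumes "Im \<tau> > 0" "\<not> (r1 \<in> \<int> \<and> r2 \<in> \<int>)"
  shows "kl r1 r2 \<tau> \<noteq> 0"
proof
  assume "kl r1 r2 \<tau> = 0"
  then obtain m n :: int where *: "of_real r1 * \<tau> + of_real r2 = of_int m * \<tau> + of_int n"
    using phi_eq_0_iff[OF assms(1)] by (auto simp: kl_def)
  from arg_cong[OF this, of Im] have 1: "r1 = of_int m" using assms(1) by simp
  from arg_cong[OF *, of Re] 1 have "r2 = of_int n" by simp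
  with 1 assms(2) show False by simp
qed

text \<open>Klein forms have weight \<open>-1\<close>; the group acts on the characteristics, and no multiplier occurs.\<close>

lemma kl_modular:
  fixes a b c d :: int
  assumes det: "a * d - b * c = 1" and \<tau>: "Im \<tau> > 0"
  shows "kl r1 r2 ((of_int a * \<tau> + of_int b) / (of_int c * \<tau> + of_int d)) =
    kl (r1 * of_int a + r2 * of_int c) (r1 * of_int b + r2 * of_int d) \<tau> / (of_int c * \<tau> + of_int d)"
proof -
  define j where "j = of_int c * \<tau> + of_int d"
  define z where "z = of_real (r1 * of_int a + r2 * of_int c) * \<tau> + of_real (r1 * of_int b + r2 * of_int d)"
  have j0: "j \<noteq> 0" unfolding j_def using aut_nonzero[OF det \<tau>] .
  have detc: "of_int a * of_int d - of_int b * of_int c = (1 :: complex)"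
    using det by (metis of_int_1 of_int_diff of_int_mult)
  have zj: "of_real r1 * ((of_int a * \<tau> + of_int b) / j) + of_real r2 = z / j"
    using j0 by (simp add: z_def field_simps) (simp add: j_def algebra_simps)
  have "of_real r1 + of_int c * z
      = of_real (r1 * of_int a + r2 * of_int c) * j + of_real r1 * (1 - (of_int a * of_int d - of_int b * of_int c))"
    by (simp add: z_def j_def algebra_simps)
  then have rz: "of_real r1 + of_int c * z = of_real (r1 * of_int a + r2 * of_int c) * j"
    unfolding detc by simp
  have "of_real r1 * (z / j) / 2 + of_int c * z\<^sup>2 / (2 * j) = (of_real r1 + of_int c * z) * z / (2 * j)"
    using j0 by (simp add: field_simps power2_eq_square)
  also have "\<dots> = of_real (r1 * of_int a + r2 * of_int c) * z / 2"
    unfolding rz using j0 by simp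
  finally have ex: "of_real r1 * (z / j) / 2 + of_int c * z\<^sup>2 / (2 * j) = of_real (r1 * of_int a + r2 * of_int c) * z / 2" .
  have "kl r1 r2 ((of_int a * \<tau> + of_int b) / j) = ee (of_real r1 * (z / j) / 2) * phi (z / j) ((of_int a * \<tau> + of_int b) / j)"
    by (simp only: kl_def zj)
  also have "\<dots> = ee (of_real r1 * (z / j) / 2 + of_int c * z\<^sup>2 / (2 * j)) * phi z \<tau> / j"
    unfolding phi_modular[OF det \<tau>, folded j_def] ee_add by simp
  also have "\<dots> = kl (r1 * of_int a + r2 * of_int c) (r1 * of_int b + r2 * of_int d) \<tau> / j"
    unfolding ex by (simp only: kl_def z_def)
  finally show ?thesis by (simp only: j_def)
qed

lemma kl_shift:
  assumes "Im \<tau> > 0"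
  shows "kl (r1 + of_int m) (r2 + of_int n) \<tau> =
    ee (of_real ((of_int (m + n + m * n) + of_int n * r1 - of_int m * r2) / 2)) * kl r1 r2 \<tau>"
proof -
  define z where "z = of_real r1 * \<tau> + of_real r2"
  have 1: "of_real (r1 + of_int m) * \<tau> + of_real (r2 + of_int n) = z + of_int m * \<tau> + of_int n"
    by (simp add: z_def algebra_simps)
  have ex: "of_real (r1 + of_int m) * (z + of_int m * \<tau> + of_int n) / 2 + ((of_int m + of_int n) / 2 - of_int m ^ 2 * \<tau> / 2 - of_int m * z)
     = of_real ((of_int (m + n + m * n) + of_int n * r1 - of_int m * r2) / 2) + of_real r1 * z / 2"
    by (simp add: z_def field_simps power2_eq_square)
  show ?thesis
    unfolding kl_def 1 phi_shift[OF assms] mult.assoc[symmetric] ee_add[symmetric] ex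
    by (simp only: z_def)
qed

lemma norm_ee_of_real [simp]: "norm (ee (of_real x)) = 1"
  by (simp add: norm_ee)

section \<open>Order at infinity\<close>

text \<open>\<open>has_order f e\<close>: up to positive constants, \<open>\<bar>f\<bar>\<close> agrees with \<open>\<bar>q\<^sup>e\<bar>\<close> once \<open>Im \<tau>\<close> is large, uniformly in
  \<open>Re \<tau>\<close>. This is all that is needed of \<open>q\<close>-expansions at the cusps.\<close>

definition has_order :: "(complex \<Rightarrow> complex) \<Rightarrow> real \<Rightarrow> bool" where
  "has_order f e \<longleftrightarrow> (\<exists>c>0. \<exists>C>0. \<exists>B>0. \<forall>\<tau>. Im \<tau> \<ge> B \<longrightarrow>
     c * exp (- 2 * pi * e * Im \<tau>) \<le> norm (f \<tau>) \<and> norm (f \<tau>) \<le> C * exp (- 2 * pi * e * Im \<tau>))"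

lemma has_orderI:
  assumes "c > 0" "C > 0" "B > 0"
    "\<And>\<tau>. Im \<tau> \<ge> B \<Longrightarrow> c * exp (- 2 * pi * e * Im \<tau>) \<le> norm (f \<tau>)"
    "\<And>\<tau>. Im \<tau> \<ge> B \<Longrightarrow> norm (f \<tau>) \<le> C * exp (- 2 * pi * e * Im \<tau>)"
  shows "has_order f e"
  unfolding has_order_def using assms by blast

lemma has_orderE:
  assumes "has_order f e"
  obtains c C B where "c > 0" "C > 0" "B > 0"
    "\<And>\<tau>. Im \<tau> \<ge> B \<Longrightarrow> c * exp (- 2 * pi * e * Im \<tau>) \<le> norm (f \<tau>)"
    "\<And>\<tau>. Im \<tau> \<ge> B \<Longrightarrow> norm (f \<tau>) \<le> C * exp (- 2 * pi * e * Im \<tau>)"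
  using assms unfolding has_order_def by blast

lemma has_order_transform:
  assumes "has_order f e" "\<And>\<tau>. Im \<tau> > 0 \<Longrightarrow> norm (f \<tau>) = norm (g \<tau>)"
  shows "has_order g e"
proof -
  from assms(1) obtain c C B where *: "c > 0" "C > 0" "B > 0"
    "\<And>\<tau>. Im \<tau> \<ge> B \<Longrightarrow> c * exp (- 2 * pi * e * Im \<tau>) \<le> norm (f \<tau>)"
    "\<And>\<tau>. Im \<tau> \<ge> B \<Longrightarrow> norm (f \<tau>) \<le> C * exp (- 2 * pi * e * Im \<tau>)" by (rule has_orderE) blast
  show ?thesis
    by (rule has_orderI[OF *(1-3)]) (use * assms(2) in \<open>metis less_le_trans\<close>)+
qed

lemma has_order_const: "k \<noteq> 0 \<Longrightarrow> has_order (\<lambda>_. k) 0"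
  by (rule has_orderI[of "norm k" "norm k" 1]) auto

lemma has_order_mult:
  assumes "has_order f e" "has_order g d"
  shows "has_order (\<lambda>\<tau>. f \<tau> * g \<tau>) (e + d)"
proof -
  from assms(1) obtain c C B where f: "c > 0" "C > 0" "B > 0"
    "\<And>\<tau>. Im \<tau> \<ge> B \<Longrightarrow> c * exp (- 2 * pi * e * Im \<tau>) \<le> norm (f \<tau>)"
    "\<And>\<tau>. Im \<tau> \<ge> B \<Longrightarrow> norm (f \<tau>) \<le> C * exp (- 2 * pi * e * Im \<tau>)" by (rule has_orderE) blast
  from assms(2) obtain c' C' B' where g: "c' > 0" "C' > 0" "B' > 0"
    "\<And>\<tau>. Im \<tau> \<ge> B' \<Longrightarrow> c' * exp (- 2 * pi * d * Im \<tau>) \<le> norm (g \<tau>)"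
    "\<And>\<tau>. Im \<tau> \<ge> B' \<Longrightarrow> norm (g \<tau>) \<le> C' * exp (- 2 * pi * d * Im \<tau>)" by (rule has_orderE) blast
  have ex: "x * y * exp (- 2 * pi * (e + d) * t) = (x * exp (- 2 * pi * e * t)) * (y * exp (- 2 * pi * d * t))" for x y t :: real
    by (simp add: exp_add[symmetric] algebra_simps)
  show ?thesis
  proof (rule has_orderI[of "c * c'" "C * C'" "max B B'"])
    fix \<tau> assume "max B B' \<le> Im \<tau>"
    then have "B \<le> Im \<tau>" "B' \<le> Im \<tau>" by auto
    then show "c * c' * exp (- 2 * pi * (e + d) * Im \<tau>) \<le> norm (f \<tau> * g \<tau>)"
      "norm (f \<tau> * g \<tau>) \<le> C * C' * exp (- 2 * pi * (e + d) * Im \<tau>)"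
      unfolding ex norm_mult using f g by (auto intro!: mult_mono)
  qed (use f g in auto)
qed

lemma has_order_inverse:
  assumes "has_order f e"
  shows "has_order (\<lambda>\<tau>. inverse (f \<tau>)) (- e)"
proof -
  from assms(1) obtain c C B where f: "c > 0" "C > 0" "B > 0"
    "\<And>\<tau>. Im \<tau> \<ge> B \<Longrightarrow> c * exp (- 2 * pi * e * Im \<tau>) \<le> norm (f \<tau>)"
    "\<And>\<tau>. Im \<tau> \<ge> B \<Longrightarrow> norm (f \<tau>) \<le> C * exp (- 2 * pi * e * Im \<tau>)" by (rule has_orderE) blast
  show ?thesis
  proof (rule has_orderI[of "inverse C" "inverse c" B])
    fix \<tau> assume \<tau>: "B \<le> Im \<tau>"
    have ex: "inverse x * exp (- 2 * pi * (- e) * Im \<tau>) = inverse (x * exp (- 2 * pi * e * Im \<tau>))" for x :: real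
      by (simp add: exp_minus)
    have p: "0 < c * exp (- 2 * pi * e * Im \<tau>)" using f by simp
    from less_le_trans[OF p f(4)[OF \<tau>]] have "0 < norm (f \<tau>)" .
    show "inverse C * exp (- 2 * pi * (- e) * Im \<tau>) \<le> norm (inverse (f \<tau>))"
      unfolding ex norm_inverse using f(5)[OF \<tau>] \<open>0 < norm (f \<tau>)\<close> by (rule le_imp_inverse_le)
    show "norm (inverse (f \<tau>)) \<le> inverse c * exp (- 2 * pi * (- e) * Im \<tau>)"
      unfolding ex norm_inverse using f(4)[OF \<tau>] p by (rule le_imp_inverse_le)
  qed (use f in auto)
qed

lemma has_order_power:
  assumes "has_order f e"
  shows "has_order (\<lambda>\<tau>. f \<tau> ^ n) (of_nat n * e)"
proof (induction n)
  case 0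
  show ?case using has_order_const[of 1] by simp
next
  case (Suc n)
  show ?case using has_order_mult[OF assms Suc] by (simp add: algebra_simps)
qed

lemma has_order_power_int:
  assumes "has_order f e"
  shows "has_order (\<lambda>\<tau>. f \<tau> powi n) (of_int n * e)"
proof (cases "n \<ge> 0")
  case True
  then show ?thesis using has_order_power[OF assms, of "nat n"] by (simp add: power_int_def)
next
  case False
  then show ?thesis using has_order_power[OF has_order_inverse[OF assms], of "nat (- n)"]
    by (simp add: power_int_def)
qed

lemma has_order_prod:
  assumes "\<And>i. i \<in> A \<Longrightarrow> has_order (f i) (e i)"
  shows "has_order (\<lambda>\<tau>. \<Prod>i\<in>A. f i \<tau>) (\<Sum>i\<in>A. e i)"
  using assms
proof (induction A rule: infinite_finite_induct)
  case (insert i A)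
  then show ?case using has_order_mult[of "f i" "e i"] by simp
qed (use has_order_const[of 1] in auto)

lemma has_order_affine:
  assumes f: "has_order f e" and g: "g > 0"
  shows "has_order (\<lambda>\<tau>. f (of_real g * \<tau> + of_real h)) (g * e)"
proof -
  from assms(1) obtain c C B where f: "c > 0" "C > 0" "B > 0"
    "\<And>\<tau>. Im \<tau> \<ge> B \<Longrightarrow> c * exp (- 2 * pi * e * Im \<tau>) \<le> norm (f \<tau>)"
    "\<And>\<tau>. Im \<tau> \<ge> B \<Longrightarrow> norm (f \<tau>) \<le> C * exp (- 2 * pi * e * Im \<tau>)" by (rule has_orderE) blast
  show ?thesis
  proof (rule has_orderI[of c C "B / g"])
    fix \<tau> assume "B / g \<le> Im \<tau>"
    then have "B \<le> Im (of_real g * \<tau> + of_real h)"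
      using g by (simp add: field_simps)
    from f(4,5)[OF this]
    show "c * exp (- 2 * pi * (g * e) * Im \<tau>) \<le> norm (f (of_real g * \<tau> + of_real h))"
      "norm (f (of_real g * \<tau> + of_real h)) \<le> C * exp (- 2 * pi * (g * e) * Im \<tau>)"
      by (simp_all add: mult_ac)
  qed (use f g in auto)
qed

lemma has_order_ee: "has_order (\<lambda>\<tau>. ee (of_real u * \<tau> + of_real v)) u"
  by (rule has_orderI[of 1 1 1]) (auto simp: norm_ee algebra_simps)

lemma has_order_qinf:
  assumes "u > 0"
  shows "has_order (\<lambda>\<tau>. qinf (ee (of_real u * \<tau> + of_real v)) (ee \<tau>)) 0"
proof -
  obtain c C where c: "0 < c" "0 < C"
    "\<And>x q. norm x \<le> 1/2 \<Longrightarrow> norm q \<le> 1/2 \<Longrightarrow> c \<le> norm (qinf x q) \<and> norm (qinf x q) \<le> C"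
    using qinf_bounds by metis
  have small: "exp (- 2 * pi * (w * t)) \<le> 1/2" if "w > 0" "t \<ge> 1 / w" for w t :: real
  proof -
    have "1 \<le> w * t" using that by (simp add: field_simps)
    then have "2 * 1 \<le> 2 * pi * (w * t)" using pi_gt3 by (intro mult_mono) auto
    then have "exp (- 2 * pi * (w * t)) \<le> exp (- ln 2)" using ln_2_less_1 by simp
    then show ?thesis by (simp add: exp_minus)
  qed
  show ?thesis
  proof (rule has_orderI[of c C "max 1 (1 / u)"])
    fix \<tau> assume \<tau>: "max 1 (1 / u) \<le> Im \<tau>"
    have "norm (ee (of_real u * \<tau> + of_real v)) \<le> 1/2" "norm (ee \<tau>) \<le> 1/2"
      using small[of u "Im \<tau>"] small[of 1 "Im \<tau>"] \<tau> assms by (simp_all add: norm_ee)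
    from c(3)[OF this]
    show "c * exp (- 2 * pi * 0 * Im \<tau>) \<le> norm (qinf (ee (of_real u * \<tau> + of_real v)) (ee \<tau>))"
      "norm (qinf (ee (of_real u * \<tau> + of_real v)) (ee \<tau>)) \<le> C * exp (- 2 * pi * 0 * Im \<tau>)" by auto
  qed (use c in auto)
qed

lemma has_order_eta: "has_order (\<lambda>\<tau>. qinf (ee \<tau>) (ee \<tau>)) 0"
  using has_order_qinf[of 1 0] by simp

lemma has_order_kl_aux:
  assumes "0 \<le> r1" "r1 < 1" "\<not> (r1 \<in> \<int> \<and> r2 \<in> \<int>)"
  shows "has_order (kl r1 r2) (- (r1 * (1 - r1) / 2))"
proof -
  have \<zeta>: "has_order (\<lambda>\<tau>. qinf (ee (of_real r1 * \<tau> + of_real r2)) (ee \<tau>)) 0"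
  proof (cases "r1 = 0")
    case False
    then show ?thesis using assms by (intro has_order_qinf) auto
  next
    case True
    \<comment> \<open>the factor \<open>1 - \<zeta>\<close> is constant here, and nonzero since \<open>r2\<close> is no integer\<close>
    have "of_real r2 \<notin> (\<int> :: complex set)" using assms True by (simp add: of_real_in_Ints_iff)
    then have nz: "1 - ee (of_real r2) \<noteq> 0" using ee_eq_1_iff[of "of_real r2"] by auto
    have "has_order (\<lambda>\<tau>. (1 - ee (of_real r2)) * qinf (ee (of_real 1 * \<tau> + of_real r2)) (ee \<tau>)) (0 + 0)"
      by (intro has_order_mult has_order_const nz has_order_qinf) auto
    then have "has_order (\<lambda>\<tau>. (1 - ee (of_real r2)) * qinf (ee (of_real 1 * \<tau> + of_real r2)) (ee \<tau>)) 0"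
      by simp
    then show ?thesis
    proof (rule has_order_transform)
      fix \<tau> assume \<tau>: "Im \<tau> > 0"
      show "norm ((1 - ee (of_real r2)) * qinf (ee (of_real 1 * \<tau> + of_real r2)) (ee \<tau>)) =
         norm (qinf (ee (of_real r1 * \<tau> + of_real r2)) (ee \<tau>))"
        using qinf_rec[OF norm_ee_less_1[OF \<tau>], of "ee (of_real r2)"] True
        by (simp add: ee_add mult.commute)
    qed
  qed
  have "has_order (\<lambda>\<tau>. ee (of_real (r1 * r1 / 2) * \<tau> + of_real (r1 * r2 / 2)) *
     (ee (of_real (- r1 / 2) * \<tau> + of_real (- r2 / 2)) * qinf (ee (of_real r1 * \<tau> + of_real r2)) (ee \<tau>) *
       qinf (ee (of_real (1 - r1) * \<tau> + of_real (- r2))) (ee \<tau>) * inverse (qinf (ee \<tau>) (ee \<tau>)) ^ 2))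
     (r1 * r1 / 2 + (- r1 / 2 + 0 + 0 + of_nat 2 * - 0))"
    using assms(2) by (intro has_order_mult has_order_ee \<zeta> has_order_qinf has_order_power has_order_inverse has_order_eta) auto
  moreover have "r1 * r1 / 2 + (- r1 / 2 + 0 + 0 + of_nat 2 * - 0) = - (r1 * (1 - r1) / 2)"
    by (simp add: field_simps)
  ultimately have "has_order (\<lambda>\<tau>. ee (of_real (r1 * r1 / 2) * \<tau> + of_real (r1 * r2 / 2)) *
     (ee (of_real (- r1 / 2) * \<tau> + of_real (- r2 / 2)) * qinf (ee (of_real r1 * \<tau> + of_real r2)) (ee \<tau>) *
       qinf (ee (of_real (1 - r1) * \<tau> + of_real (- r2))) (ee \<tau>) * inverse (qinf (ee \<tau>) (ee \<tau>)) ^ 2)) (- (r1 * (1 - r1) / 2))"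
    by simp
  then show ?thesis
  proof (rule has_order_transform)
    fix \<tau> :: complex
    have 1: "of_real (r1 * r1 / 2) * \<tau> + of_real (r1 * r2 / 2) = of_real r1 * (of_real r1 * \<tau> + of_real r2) / 2"
      by (simp add: field_simps)
    have 2: "of_real (- r1 / 2) * \<tau> + of_real (- r2 / 2) = - (of_real r1 * \<tau> + of_real r2) / 2"
      by (simp add: field_simps)
    have 30: "of_real (1 - r1) * \<tau> + of_real (- r2) = \<tau> + - (of_real r1 * \<tau> + of_real r2)"
      by (simp add: algebra_simps)
    have 3: "ee (of_real (1 - r1) * \<tau> + of_real (- r2)) = ee \<tau> / ee (of_real r1 * \<tau> + of_real r2)"
      unfolding 30 ee_add[of \<tau>] ee_minus divide_inverse[of "ee \<tau>"] ..
    have 4: "x * inverse y ^ 2 = x / y ^ 2" for x y :: complex by (simp add: field_simps)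
    show "norm (ee (of_real (r1 * r1 / 2) * \<tau> + of_real (r1 * r2 / 2)) *
     (ee (of_real (- r1 / 2) * \<tau> + of_real (- r2 / 2)) * qinf (ee (of_real r1 * \<tau> + of_real r2)) (ee \<tau>) *
       qinf (ee (of_real (1 - r1) * \<tau> + of_real (- r2))) (ee \<tau>) * inverse (qinf (ee \<tau>) (ee \<tau>)) ^ 2)) = norm (kl r1 r2 \<tau>)"
      unfolding kl_def phi_def 1 2 3 4 ..
  qed
qed

text \<open>The order of a Klein form is \<open>B\<^sub>2({r\<^sub>1}) / 2 - 1 / 12\<close> with \<open>B\<^sub>2(x) = x\<^sup>2 - x + 1 / 6\<close>.\<close>

lemma has_order_kl:
  assumes "\<not> (r1 \<in> \<int> \<and> r2 \<in> \<int>)"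
  shows "has_order (kl r1 r2) (- (frac r1 * (1 - frac r1) / 2))"
proof -
  have "\<not> (frac r1 \<in> \<int> \<and> r2 \<in> \<int>)" using assms by (metis Ints_add Ints_of_int frac_def add_diff_cancel diff_add_cancel)
  then have "has_order (kl (frac r1) r2) (- (frac r1 * (1 - frac r1) / 2))"
    by (intro has_order_kl_aux) (auto simp: frac_ge_0 frac_lt_1)
  then show ?thesis
  proof (rule has_order_transform)
    fix \<tau> assume \<tau>: "Im \<tau> > 0"
    show "norm (kl (frac r1) r2 \<tau>) = norm (kl r1 r2 \<tau>)"
      using arg_cong[OF kl_shift[OF \<tau>, of "frac r1" "\<lfloor>r1\<rfloor>" r2 0], of norm]
      unfolding norm_mult norm_ee_of_real by (simp add: frac_def)
  qed
qed


section \<open>The eta function and the discriminant\<close>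

text \<open>\<open>eta2\<close> is the square of Dedekind's eta function.\<close>

definition eta2 :: "complex \<Rightarrow> complex" where
  "eta2 \<tau> = ee (\<tau> / 12) * qinf (ee \<tau>) (ee \<tau>) ^ 2"

lemma eta2_nonzero: "Im \<tau> > 0 \<Longrightarrow> eta2 \<tau> \<noteq> 0"
  by (simp add: eta2_def qinf_self_nonzero norm_ee_less_1)

lemma holomorphic_eta2:
  assumes "open A" "g holomorphic_on A" "\<And>z. z \<in> A \<Longrightarrow> Im (g z) > 0"
  shows "(\<lambda>z. eta2 (g z)) holomorphic_on A"
  unfolding eta2_def using assms by (intro holomorphic_intros holomorphic_qinf) (auto simp: norm_ee_less_1)

lemma has_order_eta2: "has_order eta2 (1/12)"
proof -
  have "has_order (\<lambda>\<tau>. ee (of_real (1/12) * \<tau> + of_real 0) * qinf (ee \<tau>) (ee \<tau>) ^ 2) (1/12 + of_nat 2 * 0)"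
    by (intro has_order_mult has_order_ee has_order_power has_order_eta)
  then show ?thesis by (simp add: eta2_def[abs_def])
qed

lemma eta2_shift: "eta2 (\<tau> + 1) = ee (1/12) * eta2 \<tau>" "eta2 (\<tau> - 1) = ee (- 1/12) * eta2 \<tau>"
  unfolding eta2_def diff_conv_add_uminus[of \<tau>] ee_add add_divide_distrib by (simp_all add: ee_minus)

lemma qinf_even_odd:
  assumes "norm q < 1"
  shows "qinf x (q^2) * qinf (x * q) (q^2) = qinf x q"
proof -
  have q2: "norm (q^2) < 1" using assms by (simp add: norm_power power_less_one_iff)
  have "(\<lambda>N. (\<Prod>n<N. 1 - x * (q^2) ^ n) * (\<Prod>n<N. 1 - (x * q) * (q^2) ^ n)) \<longlonglongrightarrow> qinf x (q^2) * qinf (x * q) (q^2)"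
    by (intro tendsto_mult qinf_LIMSEQ q2)
  moreover have "(\<Prod>n<N. 1 - x * (q^2) ^ n) * (\<Prod>n<N. 1 - (x * q) * (q^2) ^ n) = (\<Prod>n<2*N. 1 - x * q ^ n)" for N
  proof (induction N)
    case (Suc N)
    have step: "(1 - x * (q^2) ^ N) * (1 - (x * q) * (q^2) ^ N) = (1 - x * q ^ (2 * N)) * (1 - x * q ^ Suc (2 * N))"
      by (simp only: power_mult[symmetric] power_Suc mult_ac)
    have two: "2 * Suc N = Suc (Suc (2 * N))" by simp
    have swap: "(a * b) * (a' * b') = (a * a') * (b * b')" for a b a' b' :: complex by (simp add: mult_ac)
    show ?case
      unfolding two prod.lessThan_Suc by (subst swap, subst Suc.IH, subst step) (simp only: mult.assoc)
  qed simp
  moreover have "(\<lambda>N. \<Prod>n<2*N. 1 - x * q ^ n) \<longlonglongrightarrow> qinf x q"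
    by (rule filterlim_compose[OF qinf_LIMSEQ[OF assms] mult_nat_left_at_top]) simp
  ultimately show ?thesis using LIMSEQ_unique by auto
qed

lemma qinf_minus_mult:
  assumes "norm q < 1"
  shows "qinf x q * qinf (- x) q = qinf (x^2) (q^2)"
proof -
  have q2: "norm (q^2) < 1" using assms by (simp add: norm_power power_less_one_iff)
  have "(\<lambda>N. (\<Prod>n<N. 1 - x * q ^ n) * (\<Prod>n<N. 1 - (- x) * q ^ n)) \<longlonglongrightarrow> qinf x q * qinf (- x) q"
    by (intro tendsto_mult qinf_LIMSEQ assms)
  moreover have "(\<Prod>n<N. 1 - x * q ^ n) * (\<Prod>n<N. 1 - (- x) * q ^ n) = (\<Prod>n<N. 1 - x^2 * (q^2) ^ n)" for N
    unfolding prod.distrib[symmetric]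
    by (rule prod.cong) (simp_all add: algebra_simps power2_eq_square power_mult_distrib)
  ultimately show ?thesis using qinf_LIMSEQ[OF q2, of "x^2"] LIMSEQ_unique by auto
qed

text \<open>Euler's identity \<open>(-q; q)\<^sub>\<infinity> (q; q\<^sup>2)\<^sub>\<infinity> = 1\<close> with \<open>q = h\<^sup>2\<close> and the second factor split.\<close>

lemma euler_product:
  assumes "norm h < 1"
  shows "qinf h (h^2) * qinf (- h) (h^2) * qinf (- (h^2)) (h^2) = 1"
proof -
  define q where "q = h^2"
  have q: "norm q < 1" using assms by (simp add: q_def norm_power power_less_one_iff)
  have "qinf h q * qinf (- h) q * qinf (- q) q * qinf q q = qinf q (q^2) * qinf (q * q) (q^2)"
    using qinf_minus_mult[OF q, of h] qinf_minus_mult[OF q, of q] by (simp add: q_def power2_eq_square mult_ac)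
  also have "\<dots> = qinf q q" by (rule qinf_even_odd[OF q])
  finally show ?thesis using qinf_self_nonzero[OF q] by (simp add: q_def)
qed

text \<open>The product of the three Klein forms of level \<open>2\<close>, raised to the fourth power, is
  \<open>-16 / \<Delta>\<close>, where \<open>\<Delta> = \<eta>\<^sup>2\<^sup>4\<close>. The modular group permutes the three up to fourth roots of unity, which
  gives the modularity of \<open>\<Delta>\<close>.\<close>

lemma kl_level_2_product:
  assumes \<tau>: "Im \<tau> > 0"
  shows "(kl (1/2) 0 \<tau> * kl 0 (1/2) \<tau> * kl (1/2) (1/2) \<tau>) ^ 4 * eta2 \<tau> ^ 12 = -16"
proof -
  define h where "h = ee (\<tau> / 2)"
  define P where "P = qinf (h^2) (h^2)"
  have hq: "ee \<tau> = h^2" by (simp add: h_def ee_power)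
  have h: "norm h < 1" using norm_ee_less_1[of "\<tau>/2"] \<tau> by (simp add: h_def)
  have h2: "norm (h^2) < 1" using h by (simp add: norm_power power_less_one_iff)
  have h0: "h \<noteq> 0" by (simp add: h_def)
  have P0: "P \<noteq> 0" unfolding P_def by (rule qinf_self_nonzero[OF h2])
  have k1: "kl (1/2) 0 \<tau> = ee (- \<tau> / 8) * qinf h (h^2) ^ 2 / P ^ 2"
  proof -
    have "kl (1/2) 0 \<tau> = (ee (\<tau> / 8) * ee (- \<tau> / 4)) * qinf h (h^2) * qinf (h^2 / h) (h^2) / P ^ 2"
      by (simp add: kl_def phi_def hq P_def h_def[symmetric])
    also have "ee (\<tau> / 8) * ee (- \<tau> / 4) = ee (- \<tau> / 8)" by (simp flip: ee_add)
    finally show ?thesis using h0 by (simp add: power2_eq_square)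
  qed
  have k2: "kl 0 (1/2) \<tau> = ee (- 1/4) * 2 * qinf (- (h^2)) (h^2) ^ 2 / P ^ 2"
    using qinf_rec[OF h2, of "-1"]
    by (simp add: kl_def phi_def hq P_def ee_half power2_eq_square)
  have k3: "kl (1/2) (1/2) \<tau> = ee (- 1/8) * ee (- \<tau> / 8) * qinf (- h) (h^2) ^ 2 / P ^ 2"
  proof -
    have m: "ee (\<tau> / 2 + 1/2) = - h" unfolding ee_add ee_half h_def by simp
    have "kl (1/2) (1/2) \<tau> = (ee ((\<tau> / 2 + 1/2) / 4) * ee (- (\<tau> / 2 + 1/2) / 2)) * qinf (- h) (h^2) * qinf (h^2 / (- h)) (h^2) / P ^ 2"
      by (simp add: kl_def phi_def hq P_def m)
    also have "ee ((\<tau> / 2 + 1/2) / 4) * ee (- (\<tau> / 2 + 1/2) / 2) = ee (- 1/8) * ee (- \<tau> / 8)"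
      unfolding ee_add[symmetric] by (rule arg_cong[of _ _ ee]) (simp add: field_simps)
    finally show ?thesis using h0 by (simp add: power2_eq_square)
  qed
  have E: "eta2 \<tau> ^ 12 = ee \<tau> * P ^ 24"
    by (simp add: eta2_def hq P_def power_mult_distrib ee_power flip: power_mult)
  have "kl (1/2) 0 \<tau> * kl 0 (1/2) \<tau> * kl (1/2) (1/2) \<tau> =
     2 * (ee (- \<tau> / 8) * ee (- 1/4) * (ee (- 1/8) * ee (- \<tau> / 8))) * (qinf h (h^2) * qinf (- h) (h^2) * qinf (- (h^2)) (h^2)) ^ 2 / P ^ 6"
    unfolding k1 k2 k3 using P0 by (simp add: field_simps power_mult_distrib)
  also have "\<dots> = 2 * (ee (- \<tau> / 8) * ee (- 1/4) * (ee (- 1/8) * ee (- \<tau> / 8))) / P ^ 6"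
    unfolding euler_product[OF h] by simp
  also have "ee (- \<tau> / 8) * ee (- 1/4) * (ee (- 1/8) * ee (- \<tau> / 8)) = ee (- \<tau> / 4 - 3/8)"
    unfolding ee_add[symmetric] by (rule arg_cong[of _ _ ee]) (simp add: field_simps)
  finally have "(kl (1/2) 0 \<tau> * kl 0 (1/2) \<tau> * kl (1/2) (1/2) \<tau>) ^ 4 = 16 * ee (- \<tau> / 4 - 3/8) ^ 4 / P ^ 24"
    by (simp add: power_mult_distrib power_divide flip: power_mult)
  also have "ee (- \<tau> / 4 - 3/8) ^ 4 = ee (- 3/2) * ee (- \<tau>)"
    unfolding ee_power ee_add[symmetric] by (rule arg_cong[of _ _ ee]) (simp add: field_simps)
  also have "ee (- 3/2) = ee (1/2 + of_int (-2))" by simp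
  also have "\<dots> = -1" unfolding ee_add ee_of_int ee_half by simp
  finally show ?thesis unfolding E using P0 by (simp add: ee_minus)
qed

lemma kl_half_shift:
  assumes \<tau>: "Im \<tau> > 0" and "even (x - x')" "even (y - y')"
  shows "kl (of_int x / 2) (of_int y / 2) \<tau> ^ 4 = kl (of_int x' / 2) (of_int y' / 2) \<tau> ^ 4"
proof -
  obtain m n where m: "x = x' + 2 * m" "y = y' + 2 * n"
    using assms(2,3) by (metis diff_add_cancel add.commute evenE)
  have *: "kl (of_int x / 2) (of_int y / 2) \<tau> = ee (of_real ((of_int (m + n + m * n) + of_int n * (of_int x' / 2) - of_int m * (of_int y' / 2)) / 2))
      * kl (of_int x' / 2) (of_int y' / 2) \<tau>"
    using kl_shift[OF \<tau>, of "of_int x' / 2" m "of_int y' / 2" n] by (simp add: m add_divide_distrib)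
  have "ee (of_real ((of_int (m + n + m * n) + of_int n * (of_int x' / 2) - of_int m * (of_int y' / 2)) / 2)) ^ 4
     = ee (of_int (2 * (m + n + m * n) + n * x' - m * y'))"
    unfolding ee_power by (rule arg_cong[of _ _ ee]) (simp add: field_simps)
  then show ?thesis unfolding * power_mult_distrib by (simp del: of_int_add of_int_diff of_int_mult)
qed

theorem Delta_modular:
  fixes a b c d :: int
  assumes det: "a * d - b * c = 1" and \<tau>: "Im \<tau> > 0"
  shows "eta2 ((of_int a * \<tau> + of_int b) / (of_int c * \<tau> + of_int d)) ^ 12 = (of_int c * \<tau> + of_int d) ^ 12 * eta2 \<tau> ^ 12"
proof -
  define j where "j = of_int c * \<tau> + of_int d"
  define \<tau>' where "\<tau>' = (of_int a * \<tau> + of_int b) / j"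
  have j0: "j \<noteq> 0" unfolding j_def using aut_nonzero[OF det \<tau>] .
  have \<tau>': "Im \<tau>' > 0"
    unfolding \<tau>'_def j_def Im_moebius[OF det] using \<tau> j0 by (simp add: j_def)
  define k4 where "k4 x y t = kl (of_int x / 2) (of_int y / 2) t ^ 4" for x y t
  have k4eq: "k4 x y \<tau> = k4 x' y' \<tau>" if "even (x - x')" "even (y - y')" for x y x' y'
    unfolding k4_def using kl_half_shift[OF \<tau> that] .
  have tr: "k4 x y \<tau>' = k4 (x * a + y * c) (x * b + y * d) \<tau> / j ^ 4" for x y
    unfolding k4_def \<tau>'_def j_def kl_modular[OF det \<tau>] power_divide
    by (simp add: add_divide_distrib)
  have T: "k4 1 0 t * k4 0 1 t * k4 1 1 t * eta2 t ^ 12 = -16" if "Im t > 0" for t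
    using kl_level_2_product[OF that] by (simp add: k4_def power_mult_distrib)
  have parity: "odd (a * d - b * c)" unfolding det by simp
  have perm: "k4 a b \<tau> * k4 c d \<tau> * k4 (a + c) (b + d) \<tau> = k4 1 0 \<tau> * k4 0 1 \<tau> * k4 1 1 \<tau>"
  proof -
    have sh: "k4 x y \<tau> = k4 (x mod 2) (y mod 2) \<tau>" for x y by (rule k4eq) auto
    have "(a mod 2 = 0 \<or> a mod 2 = 1) \<and> (b mod 2 = 0 \<or> b mod 2 = 1) \<and> (c mod 2 = 0 \<or> c mod 2 = 1) \<and> (d mod 2 = 0 \<or> d mod 2 = 1)"
      by presburger
    moreover have "\<not> (even a \<and> even b)" "\<not> (even c \<and> even d)" "\<not> (even a \<and> even c)" "\<not> (even b \<and> even d)"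
        "\<not> (odd a \<and> odd b \<and> odd c \<and> odd d)"
      using parity by (simp_all only: even_diff even_add even_mult_iff) blast+
    then have "\<not> (a mod 2 = 0 \<and> b mod 2 = 0)" "\<not> (c mod 2 = 0 \<and> d mod 2 = 0)" "\<not> (a mod 2 = 0 \<and> c mod 2 = 0)"
        "\<not> (b mod 2 = 0 \<and> d mod 2 = 0)" "\<not> (a mod 2 = 1 \<and> b mod 2 = 1 \<and> c mod 2 = 1 \<and> d mod 2 = 1)"
      by presburger+
    moreover have "(a + c) mod 2 = (a mod 2 + c mod 2) mod 2" "(b + d) mod 2 = (b mod 2 + d mod 2) mod 2"
      by presburger+
    ultimately show ?thesis
      unfolding sh[of a b] sh[of c d] sh[of "a + c" "b + d"]
      by (elim conjE disjE) (simp_all only: simp_thms one_neq_zero add_0 add_0_right one_add_one mod_self mod_0 one_mod_two_eq_one zero_neq_one mult_ac)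
  qed
  have "-16 = k4 1 0 \<tau>' * k4 0 1 \<tau>' * k4 1 1 \<tau>' * eta2 \<tau>' ^ 12" using T[OF \<tau>'] by simp
  also have "\<dots> = (k4 a b \<tau> * k4 c d \<tau> * k4 (a + c) (b + d) \<tau>) / j ^ 12 * eta2 \<tau>' ^ 12"
    unfolding tr by (simp add: field_simps flip: power_add)
  finally have "- 16 = (k4 1 0 \<tau> * k4 0 1 \<tau> * k4 1 1 \<tau>) * (eta2 \<tau>' ^ 12 / j ^ 12)"
    unfolding perm by simp
  moreover have "-16 = (k4 1 0 \<tau> * k4 0 1 \<tau> * k4 1 1 \<tau>) * eta2 \<tau> ^ 12" using T[OF \<tau>] by simp
  ultimately have "eta2 \<tau>' ^ 12 / j ^ 12 = eta2 \<tau> ^ 12"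
    by (metis mult_cancel_left mult_zero_left neg_equal_0_iff_equal zero_neq_numeral)
  then show ?thesis using j0 unfolding \<tau>'_def j_def by (simp add: field_simps)
qed

text \<open>The constant exists because the twelfth power of the quotient of the two sides is \<open>1\<close>.\<close>

lemma eta2_inversion:
  obtains k where "k^2 = -1" "\<And>\<tau>. Im \<tau> > 0 \<Longrightarrow> eta2 (- 1 / \<tau>) = k * \<tau> * eta2 \<tau>"
proof -
  let ?H = "{\<tau>. Im \<tau> > 0}"
  define r where "r \<tau> = eta2 (- 1 / \<tau>) / (\<tau> * eta2 \<tau>)" for \<tau>
  have im: "Im (- 1 / \<tau>) > 0" if "Im \<tau> > 0" for \<tau>
    using that Im_moebius[of 0 0 "-1" 1 \<tau>] by (auto intro!: divide_pos_pos)
  have nz: "\<tau> \<noteq> 0" if "Im \<tau> > 0" for \<tau> :: complex using that by auto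
  have op: "open ?H" by (rule open_halfspace_Im_gt)
  have r12: "r \<tau> ^ 12 = 1" if \<tau>: "Im \<tau> > 0" for \<tau>
    using Delta_modular[of 0 0 "-1" 1 \<tau>] \<tau> nz[OF \<tau>] eta2_nonzero[OF \<tau>]
    by (simp add: r_def power_divide power_mult_distrib)
  have 1: "(\<lambda>\<tau>. eta2 (- 1 / \<tau>)) holomorphic_on ?H"
    using nz im by (intro holomorphic_eta2[OF op] holomorphic_intros) auto
  have 2: "(\<lambda>\<tau>. eta2 \<tau>) holomorphic_on ?H"
    by (intro holomorphic_eta2[OF op] holomorphic_intros) auto
  have "r holomorphic_on ?H"
    unfolding r_def by (intro holomorphic_intros 1 2) (use nz eta2_nonzero in auto)
  moreover have "finite (r ` ?H)"
    by (rule finite_subset[OF _ finite_roots_unity[of 12]]) (auto simp: r12)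
  moreover have "connected ?H"
    by (intro convex_connected convex_halfspace_Im_gt)
  ultimately have "r constant_on ?H"
    using continuous_finite_range_constant holomorphic_on_imp_continuous_on by blast
  then obtain k where k: "\<And>\<tau>. Im \<tau> > 0 \<Longrightarrow> r \<tau> = k" by (auto simp: constant_on_def)
  have eq: "eta2 (- 1 / \<tau>) = k * \<tau> * eta2 \<tau>" if "Im \<tau> > 0" for \<tau>
    using k[OF that] nz[OF that] eta2_nonzero[OF that] by (simp add: r_def field_simps)
  \<comment> \<open>the fixed point \<open>\<i>\<close> of the inversion determines \<open>k\<close>\<close>
  have "eta2 \<i> = k * \<i> * eta2 \<i>"
    using eq[of \<i>] by simp
  then have "k * \<i> = 1" using eta2_nonzero[of \<i>] by simp
  from arg_cong[OF this, of "\<lambda>z. z^2"] have "k^2 = -1"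
    by (simp add: power_mult_distrib minus_equation_iff)
  with eq show ?thesis using that by blast
qed

text \<open>The multiplier \<open>e\<^sup>-\<^sup>2\<^sup>\<pi>\<^sup>i\<^sup>/\<^sup>1\<^sup>2\<close> is what forces \<open>12\<close> to divide \<open>k + \<Sum>a\<^sub>j\<close> later on.\<close>

lemma eta2_lower_unipotent:
  assumes \<tau>: "Im \<tau> > 0"
  shows "eta2 (\<tau> / (\<tau> + 1)) = ee (- 1/12) * (\<tau> + 1) * eta2 \<tau>"
proof -
  obtain k where k: "k^2 = -1" "\<And>\<tau>. Im \<tau> > 0 \<Longrightarrow> eta2 (- 1 / \<tau>) = k * \<tau> * eta2 \<tau>"
    by (rule eta2_inversion) blast
  define w where "w = - 1 / \<tau> - 1"
  have \<tau>0: "\<tau> \<noteq> 0" "\<tau> + 1 \<noteq> 0" using \<tau> by (auto simp: complex_eq_iff)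
  have w: "Im w > 0" using Im_moebius[of 0 0 "-1" 1 \<tau>] \<tau> \<tau>0 by (simp add: w_def)
  have w': "w = - ((\<tau> + 1) / \<tau>)" using \<tau>0 by (simp add: w_def field_simps)
  have "eta2 (\<tau> / (\<tau> + 1)) = eta2 (- 1 / w)"
    by (simp add: w')
  also have "\<dots> = k * w * eta2 w" by (rule k(2)[OF w])
  also have "eta2 w = ee (- 1/12) * (k * \<tau> * eta2 \<tau>)"
    unfolding w_def eta2_shift(2) k(2)[OF \<tau>] ..
  also have "k * w * (ee (- 1/12) * (k * \<tau> * eta2 \<tau>)) = k^2 * (w * \<tau>) * ee (- 1/12) * eta2 \<tau>"
    by (simp add: power2_eq_square mult_ac)
  also have "w * \<tau> = - (\<tau> + 1)" using \<tau>0 by (simp add: w')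
  finally show ?thesis unfolding k(1) by (simp add: algebra_simps)
qed

section \<open>Products of Klein forms\<close>

lemma ee_sum: "ee (\<Sum>i\<in>A. f i) = (\<Prod>i\<in>A. ee (f i))"
  by (induction A rule: infinite_finite_induct) (auto simp: ee_add)

lemma prod_power_int_const:
  fixes z :: complex
  assumes "z \<noteq> 0"
  shows "(\<Prod>i\<in>A. z powi f i) = z powi (\<Sum>i\<in>A. f i)"
  by (induction A rule: infinite_finite_induct) (auto simp: power_int_add assms)

text \<open>Products of \<open>\<eta>(N\<tau>)\<^sup>2\<^sup>M\<close> and Klein forms with characteristics \<open>(j/N, 0)\<close> at \<open>N\<tau>\<close>, of weight
  \<open>M - \<Sum>e\<^sub>j\<close>. The index set \<open>J\<close> must avoid the multiples of \<open>N\<close>, where the Klein form vanishes.\<close>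

definition klein_prod :: "nat \<Rightarrow> int \<Rightarrow> nat set \<Rightarrow> (nat \<Rightarrow> int) \<Rightarrow> complex \<Rightarrow> complex" where
  "klein_prod N M J a \<tau> = eta2 (of_nat N * \<tau>) powi M *
     (\<Prod>j\<in>J. kl (real j / real N) 0 (of_nat N * \<tau>) powi a j)"

lemma real_div_in_Ints_iff:
  assumes "N > 0" shows "real j / real N \<in> \<int> \<longleftrightarrow> N dvd j"
proof
  assume "real j / real N \<in> \<int>"
  then obtain m :: int where "real j / real N = of_int m" by (auto elim: Ints_cases)
  then have "of_int (int j) = (of_int (m * int N) :: real)" using assms by (simp add: field_simps)
  then have "int j = m * int N" unfolding of_int_eq_iff .
  then show "N dvd j" by (metis dvd_triv_right int_dvd_int_iff)
qed (use assms in \<open>auto elim!: dvdE\<close>)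

context
  fixes N :: nat and J :: "nat set"
  assumes N: "N > 0" and J: "finite J" "\<And>j. j \<in> J \<Longrightarrow> \<not> N dvd j"
begin

lemma Im_level: "Im \<tau> > 0 \<Longrightarrow> Im (of_nat N * \<tau>) > 0"
  using N by simp

lemma kl_level_nonzero:
  assumes "j \<in> J" "Im \<tau> > 0" shows "kl (real j / real N) 0 (of_nat N * \<tau>) \<noteq> 0"
  using assms J(2)[OF assms(1)] real_div_in_Ints_iff[OF N] by (intro kl_nonzero Im_level) auto

lemma klein_prod_nonzero: "Im \<tau> > 0 \<Longrightarrow> klein_prod N M J a \<tau> \<noteq> 0"
  using J(1) kl_level_nonzero eta2_nonzero[OF Im_level] by (simp add: klein_prod_def)

lemma holomorphic_klein_prod: "klein_prod N M J a holomorphic_on {\<tau>. Im \<tau> > 0}"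
proof -
  have op: "open {\<tau>. Im \<tau> > 0}" by (rule open_halfspace_Im_gt)
  have 1: "(\<lambda>\<tau>. eta2 (of_nat N * \<tau>)) holomorphic_on {\<tau>. Im \<tau> > 0}"
    using N by (intro holomorphic_eta2[OF op] holomorphic_intros) auto
  have 2: "(\<lambda>\<tau>. kl r1 r2 (of_nat N * \<tau>)) holomorphic_on {\<tau>. Im \<tau> > 0}" for r1 r2
    using N by (intro holomorphic_kl[OF op] holomorphic_intros) auto
  show ?thesis
    unfolding klein_prod_def[abs_def]
    by (intro holomorphic_intros 1 2) (use kl_level_nonzero eta2_nonzero[OF Im_level] in auto)
qed

lemma kl_level_Gamma1:
  fixes a b c d a' c' :: int
  assumes det: "a * d - b * c = 1" and a: "a = 1 + int N * a'" and c: "c = int N * c'" and \<tau>: "Im \<tau> > 0"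
  defines "i \<equiv> of_int c * \<tau> + of_int d"
  shows "kl (real j / real N) 0 (of_nat N * ((of_int a * \<tau> + of_int b) / i)) =
    ee (of_real ((of_int (int j * (a' + b) + (int j)\<^sup>2 * (a' * b)) + of_int b * (real j)\<^sup>2 / real N) / 2)) *
      kl (real j / real N) 0 (of_nat N * \<tau>) / i"
proof -
  have det': "a * d - (b * int N) * c' = 1" using det by (simp add: c mult_ac)
  have i: "i = of_int c' * (of_nat N * \<tau>) + of_int d" by (simp add: i_def c mult_ac)
  have eq: "of_nat N * ((of_int a * \<tau> + of_int b) / i) =
      (of_int a * (of_nat N * \<tau>) + of_int (b * int N)) / (of_int c' * (of_nat N * \<tau>) + of_int d)"
    unfolding i by (simp add: algebra_simps)
  have r: "real j / real N * of_int a + 0 * of_int c' = real j / real N + of_int (int j * a')"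
    "real j / real N * of_int (b * int N) + 0 * of_int d = 0 + of_int (int j * b)"
    using N by (simp_all add: a field_simps)
  have e: "(of_int (int j * a' + int j * b + int j * a' * (int j * b)) + of_int (int j * b) * (real j / real N) - of_int (int j * a') * 0) / 2
     = (of_int (int j * (a' + b) + (int j)\<^sup>2 * (a' * b)) + of_int b * (real j)\<^sup>2 / real N) / 2"
    by (simp add: algebra_simps power2_eq_square)
  have "kl (real j / real N) 0 (of_nat N * ((of_int a * \<tau> + of_int b) / i)) =
      kl (real j / real N + of_int (int j * a')) (0 + of_int (int j * b)) (of_nat N * \<tau>) / i"
    using kl_modular[OF det' Im_level[OF \<tau>], of "real j / real N" 0, unfolded eq[symmetric], unfolded i[symmetric]]
    unfolding r .
  then show ?thesis
    unfolding kl_shift[OF Im_level[OF \<tau>]] e .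
qed

lemma prod_kl_Gamma1:
  fixes a b c d a' c' :: int
  assumes det: "a * d - b * c = 1" and a: "a = 1 + int N * a'" and c: "c = int N * c'" and \<tau>: "Im \<tau> > 0"
  defines "i \<equiv> of_int c * \<tau> + of_int d"
  shows "(\<Prod>j\<in>J. kl (real j / real N) 0 (of_nat N * ((of_int a * \<tau> + of_int b) / i)) powi e j) =
    ee (of_real ((of_int ((a' + b) * (\<Sum>j\<in>J. int j * e j) + a' * b * (\<Sum>j\<in>J. (int j)\<^sup>2 * e j)) +
        of_int (b * (\<Sum>j\<in>J. (int j)\<^sup>2 * e j)) / real N) / 2)) *
      (\<Prod>j\<in>J. kl (real j / real N) 0 (of_nat N * \<tau>) powi e j) / i powi (\<Sum>j\<in>J. e j)"
proof -
  have i0: "i \<noteq> 0" unfolding i_def using aut_nonzero[OF det \<tau>] .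
  define x where "x j = (of_int (int j * (a' + b) + (int j)\<^sup>2 * (a' * b)) + of_int b * (real j)\<^sup>2 / real N) / 2" for j
  have "(\<Prod>j\<in>J. kl (real j / real N) 0 (of_nat N * ((of_int a * \<tau> + of_int b) / i)) powi e j) =
     (\<Prod>j\<in>J. ee (of_real (x j)) powi e j * kl (real j / real N) 0 (of_nat N * \<tau>) powi e j / i powi e j)"
    unfolding i_def kl_level_Gamma1[OF det a c \<tau>] x_def[symmetric] power_int_divide_distrib power_int_mult_distrib ..
  also have "\<dots> = ee (\<Sum>j\<in>J. of_int (e j) * of_real (x j)) * (\<Prod>j\<in>J. kl (real j / real N) 0 (of_nat N * \<tau>) powi e j) / i powi (\<Sum>j\<in>J. e j)"
    by (simp add: prod_dividef prod.distrib prod_power_int_const[OF i0] ee_power_int ee_sum)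
  also have "(\<Sum>j\<in>J. of_int (e j) * of_real (x j)) = (of_real (\<Sum>j\<in>J. of_int (e j) * x j) :: complex)" by simp
  also have "(\<Sum>j\<in>J. of_int (e j) * x j) = (of_int ((a' + b) * (\<Sum>j\<in>J. int j * e j) + a' * b * (\<Sum>j\<in>J. (int j)\<^sup>2 * e j)) +
        of_int (b * (\<Sum>j\<in>J. (int j)\<^sup>2 * e j)) / real N) / 2"
    by (simp add: x_def sum_distrib_left sum_divide_distrib sum.distrib algebra_simps add_divide_distrib)
  finally show ?thesis .
qed

text \<open>The parity argument behind the invariance: the condition for invariance under \<open>\<tau> \<mapsto> \<tau> + 1\<close> already
  forces the multiplier to be trivial on all of \<open>\<Gamma>\<^sub>1(N)\<close>.\<close>

lemma multiplier_trivial: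
  fixes a b c d a' c' A B :: int
  assumes det: "a * d - b * c = 1" and a: "a = 1 + int N * a'"
    and B: "(\<Sum>j\<in>J. (int j)\<^sup>2 * e j) = int N * B" and AB: "even ((\<Sum>j\<in>J. int j * e j) + B)"
  shows "ee (of_real ((of_int ((a' + b) * (\<Sum>j\<in>J. int j * e j) + a' * b * (\<Sum>j\<in>J. (int j)\<^sup>2 * e j)) +
        of_int (b * (\<Sum>j\<in>J. (int j)\<^sup>2 * e j)) / real N) / 2)) = 1"
proof -
  define A where "A = (\<Sum>j\<in>J. int j * e j)"
  have "even ((\<Sum>j\<in>J. (int j)\<^sup>2 * e j) - A)"
    unfolding A_def sum_subtractf[symmetric] by (intro dvd_sum) simp
  then have NB: "even (int N * B - A)" unfolding B .
  have "\<not> (even a \<and> even b)"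
  proof
    assume "even a \<and> even b"
    then have "even (a * d - b * c)" by simp
    then show False unfolding det by simp
  qed
  then have ev: "even ((a' + b) * A + a' * b * (int N * B) + b * B)"
    using NB AB unfolding a A_def[symmetric] by (simp only: even_add even_diff even_mult_iff odd_one) blast
  then obtain l where l: "(a' + b) * A + a' * b * (int N * B) + b * B = 2 * l" by (rule evenE)
  have "(of_int ((a' + b) * A + a' * b * (int N * B)) + of_int (b * (int N * B)) / real N) / 2
      = (of_int ((a' + b) * A + a' * b * (int N * B) + b * B) / 2 :: real)"
    using N by simp
  also have "\<dots> = of_int l" unfolding l by simp
  finally show ?thesis unfolding B A_def[symmetric] by (metis ee_of_int of_real_of_int_eq)
qed

lemma eta2_level_Gamma0:
  fixes a b c d c' :: int
  assumes det: "a * d - b * c = 1" and c: "c = int N * c'" and \<tau>: "Im \<tau> > 0"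
  defines "i \<equiv> of_int c * \<tau> + of_int d"
  shows "eta2 (of_nat N * ((of_int a * \<tau> + of_int b) / i)) powi (12 * s) = i powi (12 * s) * eta2 (of_nat N * \<tau>) powi (12 * s)"
proof -
  have det': "a * d - (b * int N) * c' = 1" using det by (simp add: c mult_ac)
  have i: "i = of_int c' * (of_nat N * \<tau>) + of_int d" by (simp add: i_def c mult_ac)
  have eq: "of_nat N * ((of_int a * \<tau> + of_int b) / i) =
      (of_int a * (of_nat N * \<tau>) + of_int (b * int N)) / (of_int c' * (of_nat N * \<tau>) + of_int d)"
    unfolding i by (simp add: algebra_simps)
  have p: "z powi (12 * s) = (z ^ 12) powi s" for z :: complex
    by (simp add: power_int_mult)
  show ?thesis
    unfolding p Delta_modular[OF det' Im_level[OF \<tau>], unfolded eq[symmetric], unfolded i[symmetric]] power_int_mult_distrib ..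
qed

lemma klein_prod_Gamma1:
  fixes a b c d a' c' A B :: int
  assumes det: "a * d - b * c = 1" and a: "a = 1 + int N * a'" and c: "c = int N * c'" and \<tau>: "Im \<tau> > 0"
    and B: "(\<Sum>j\<in>J. (int j)\<^sup>2 * e j) = int N * B" and AB: "even ((\<Sum>j\<in>J. int j * e j) + B)"
  defines "i \<equiv> of_int c * \<tau> + of_int d"
  shows "klein_prod N (12 * s) J e ((of_int a * \<tau> + of_int b) / i) =
    i powi (12 * s - (\<Sum>j\<in>J. e j)) * klein_prod N (12 * s) J e \<tau>"
proof -
  have i0: "i \<noteq> 0" unfolding i_def using aut_nonzero[OF det \<tau>] .
  show ?thesis
    unfolding klein_prod_def i_def prod_kl_Gamma1[OF det a c \<tau>] multiplier_trivial[OF det a B AB]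
      eta2_level_Gamma0[OF det c \<tau>]
    using i0 by (simp add: i_def power_int_diff)
qed


lemma klein_prod_translation:
  assumes \<tau>: "Im \<tau> > 0"
  shows "klein_prod N (12 * s) J e (\<tau> + 1) =
    ee (of_real ((of_int (\<Sum>j\<in>J. int j * e j) + of_int (\<Sum>j\<in>J. (int j)\<^sup>2 * e j) / real N) / 2)) * klein_prod N (12 * s) J e \<tau>"
  unfolding klein_prod_def
  using prod_kl_Gamma1[of 1 1 1 0 0 0 \<tau> e] eta2_level_Gamma0[of 1 1 1 0 0 \<tau> s] \<tau> by simp

lemma klein_prod_lower_unipotent:
  assumes \<tau>: "Im \<tau> > 0"
  shows "klein_prod N M J e (\<tau> / (of_nat N * \<tau> + 1)) =
    ee (- of_int M / 12) * (of_nat N * \<tau> + 1) powi (M - (\<Sum>j\<in>J. e j)) * klein_prod N M J e \<tau>"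
proof -
  have i0: "of_nat N * \<tau> + 1 \<noteq> 0" using aut_nonzero[of 1 1 0 "int N" \<tau>] \<tau> by simp
  have eq: "of_nat N * (\<tau> / (of_nat N * \<tau> + 1)) = (of_nat N * \<tau>) / (of_nat N * \<tau> + 1)" by simp
  have "eta2 (of_nat N * (\<tau> / (of_nat N * \<tau> + 1))) powi M =
     ee (- 1 / 12) powi M * (of_nat N * \<tau> + 1) powi M * eta2 (of_nat N * \<tau>) powi M"
    unfolding eq eta2_lower_unipotent[OF Im_level[OF \<tau>]] power_int_mult_distrib ..
  moreover have "ee (- 1 / 12) powi M = ee (- of_int M / 12)"
    unfolding ee_power_int by (rule arg_cong[of _ _ ee]) simp
  moreover have "(\<Prod>j\<in>J. kl (real j / real N) 0 (of_nat N * (\<tau> / (of_nat N * \<tau> + 1))) powi e j) =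
      (\<Prod>j\<in>J. kl (real j / real N) 0 (of_nat N * \<tau>) powi e j) / (of_nat N * \<tau> + 1) powi (\<Sum>j\<in>J. e j)"
    using prod_kl_Gamma1[of 1 1 0 "int N" 0 1 \<tau> e] \<tau> by simp
  ultimately show ?thesis
    unfolding klein_prod_def using i0 by (simp add: power_int_diff)
qed

end

text \<open>Divided by \<open>2N\<close>, this is the order, in powers of \<open>q\<close>, of \<open>klein_prod N (12 s) J e\<close> at a cusp \<open>A / C\<close> with
  \<open>gcd C N = g\<close>. Divided by \<open>2g\<close>, it is the order in the local parameter there.\<close>

definition cusp_ord :: "int \<Rightarrow> nat set \<Rightarrow> (nat \<Rightarrow> int) \<Rightarrow> int \<Rightarrow> int \<Rightarrow> int" where
  "cusp_ord s J e g A = 2 * g\<^sup>2 * s - (\<Sum>j\<in>J. e j * ((int j * A mod g) * (g - int j * A mod g)))"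

lemma frac_of_int_divide:
  assumes "g > 0"
  shows "frac (of_int x / of_int g :: real) = of_int (x mod g) / of_int g"
  unfolding frac_unique_iff
proof (intro conjI)
  have "(of_int x :: real) = of_int (x div g) * of_int g + of_int (x mod g)"
    by (metis div_mult_mod_eq of_int_add of_int_mult)
  then have "of_int x / of_int g - of_int (x mod g) / of_int g = (of_int (x div g) :: real)"
    using assms by (simp add: field_simps)
  then show "of_int x / of_int g - of_int (x mod g) / of_int g \<in> (\<int> :: real set)" by simp
qed (use assms in auto)

text \<open>With \<open>g = gcd c N\<close> and \<open>n = N / g\<close>, write \<open>diag(N, 1)\<close> times the given matrix as a matrix of determinant \<open>1\<close>
  with rows \<open>(n a, y)\<close> and \<open>(c / g, x)\<close>, times the upper triangular matrix with rows \<open>(g, h)\<close> and \<open>(0, n)\<close>.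
  The modularity of the Klein forms and of \<open>\<Delta>\<close> then reduces the behaviour at the cusp to that at \<open>\<infinity>\<close>.\<close>

lemma klein_prod_cusp:
  fixes a b c d :: int
  assumes N: "N > 0" and J: "finite J" "\<And>j. j \<in> J \<Longrightarrow> \<not> N dvd j"
    and det: "a * d - b * c = 1" and wt: "12 * s - (\<Sum>j\<in>J. e j) = int k"
  shows "has_order (\<lambda>\<tau>. klein_prod N (12 * s) J e ((of_int a * \<tau> + of_int b) / (of_int c * \<tau> + of_int d)) /
      (of_int c * \<tau> + of_int d) ^ k) (of_int (cusp_ord s J e (gcd c (int N)) a) / (2 * real N))"
proof -
  define g where "g = gcd c (int N)"
  have g: "g > 0" using N by (simp add: g_def)
  obtain c1 n where c1: "c = g * c1" and n: "int N = g * n"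
    unfolding g_def by (metis dvdE gcd_dvd1 gcd_dvd2)
  have "g * n > 0" using N n[symmetric] by simp
  then have npos: "n > 0" using g by (simp add: zero_less_mult_iff)
  have Nr: "real N = of_int g * of_int n"
    using arg_cong[OF n, of real_of_int] by simp
  have cop1: "coprime n c1"
  proof -
    have "gcd (g * c1) (g * n) = g"
      unfolding c1[symmetric] n[symmetric] by (rule g_def[symmetric])
    then have "g * gcd c1 n = g * 1" using g by (simp add: gcd_mult_left)
    then have "gcd c1 n = 1" using g by simp
    then show ?thesis by (simp add: coprime_iff_gcd_eq_1 gcd.commute)
  qed
  have copac: "coprime a c"
  proof (rule coprimeI)
    fix l assume "l dvd a" "l dvd c"
    then have "l dvd a * d - b * c" by simp
    then show "is_unit l" unfolding det .
  qed
  then have copag: "coprime a g" using copac unfolding c1 by simp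
  have "coprime (n * a) c1" using cop1 copac unfolding c1 by simp
  then obtain x y where xy: "n * a * x - c1 * y = 1"
  proof -
    from \<open>coprime (n * a) c1\<close> obtain u v where "u * (n * a) + v * c1 = 1"
      using bezout_int[of "n * a" c1] by auto
    then have "n * a * u - c1 * (- v) = 1" by (simp add: algebra_simps)
    then show ?thesis using that by blast
  qed
  have xyc: "of_int n * of_int a * of_int x - of_int c1 * of_int y = (1 :: complex)"
    using xy by (metis of_int_1 of_int_diff of_int_mult)
  have copny: "coprime n y"
  proof (rule coprimeI)
    fix l assume "l dvd n" "l dvd y"
    then have "l dvd n * a * x - c1 * y" by simp
    then show "is_unit l" unfolding xy .
  qed
  define h where "h = x * int N * b - y * d"
  have h1: "a * h + y = g * b"
  proof -
    have "a * h + y = (n * a * x) * (g * b) - y * (a * d - 1)" by (simp add: h_def n algebra_simps)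
    also have "a * d - 1 = b * (g * c1)" using det c1 by simp
    also have "(n * a * x) * (g * b) - y * (b * (g * c1)) = g * b * (n * a * x - c1 * y)" by (simp add: algebra_simps)
    finally show ?thesis unfolding xy by simp
  qed
  have h2: "c1 * h + x * n = d"
  proof -
    have "c1 * h + x * n = (c1 * g) * b * n * x - (c1 * y) * d + x * n" by (simp add: h_def n algebra_simps)
    also have "c1 * y = n * a * x - 1" using xy by simp
    also have "(c1 * g) * b * n * x - (n * a * x - 1) * d + x * n = n * x * (1 - (a * d - b * c)) + d"
      by (simp add: c1 algebra_simps)
    finally show ?thesis unfolding det by simp
  qed
  define G where "G t = eta2 t powi (12 * s) * (\<Prod>j\<in>J. kl (real j / real N * of_int (n * a) + 0 * of_int c1)
      (real j / real N * of_int y + 0 * of_int x) t powi e j)" for t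
  define v where "v = (of_int h / of_int n :: real)"
  define u where "u = (of_int g / of_int n :: real)"
  have u: "u > 0" using g npos by (simp add: u_def)
  have rj: "real j / real N * of_int (n * a) + 0 * of_int c1 = of_int (int j * a) / of_int g" for j
  proof -
    show ?thesis using npos g by (simp add: Nr field_simps)
  qed
  have ord_kl: "has_order (kl (real j / real N * of_int (n * a) + 0 * of_int c1) (real j / real N * of_int y + 0 * of_int x))
      (- (of_int ((int j * a mod g) * (g - int j * a mod g)) / (2 * of_int (g\<^sup>2))))" if j: "j \<in> J" for j
  proof -
    have "\<not> (real j / real N * of_int (n * a) + 0 * of_int c1 \<in> \<int> \<and> real j / real N * of_int y + 0 * of_int x \<in> \<int>)"
    proof
      assume *: "real j / real N * of_int (n * a) + 0 * of_int c1 \<in> \<int> \<and> real j / real N * of_int y + 0 * of_int x \<in> \<int>"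
      then obtain m m' :: int where m: "of_int (int j * a) / of_int g = (of_int m :: real)"
        and m': "real j / real N * of_int y = of_int m'" unfolding rj by (auto elim!: Ints_cases)
      have "(of_int (int j * a) :: real) = of_int (m * g)" using m g by (simp add: field_simps)
      then have "int j * a = m * g" unfolding of_int_eq_iff .
      then have "g dvd int j" using copag by (metis coprime_commute coprime_dvd_mult_left_iff dvd_triv_right)
      then obtain j' where j': "int j = g * j'" by (rule dvdE)
      have "(of_int (int j * y) :: real) = of_int (m' * int N)" using m' N by (simp add: field_simps)
      then have "int j * y = m' * int N" unfolding of_int_eq_iff .
      then have "j' * y = m' * n" using g unfolding j' n by (simp add: mult_ac)
      then have "n dvd j'" using copny by (metis coprime_dvd_mult_left_iff dvd_triv_right)
      then have "int N dvd int j" unfolding j' n by simp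
      with J(2)[OF j] show False by simp
    qed
    from has_order_kl[OF this] show ?thesis
      unfolding rj frac_of_int_divide[OF g] using g by (simp add: field_simps power2_eq_square)
  qed
  have "has_order G (of_int (12 * s) * (1/12) + (\<Sum>j\<in>J. of_int (e j) * (- (of_int ((int j * a mod g) * (g - int j * a mod g)) / (2 * of_int (g\<^sup>2))))))"
    unfolding G_def by (intro has_order_mult has_order_power_int has_order_prod has_order_eta2 ord_kl)
  from has_order_affine[OF this u, of v]
  have "has_order (\<lambda>\<tau>. G (of_real u * \<tau> + of_real v)) (u * (of_int (12 * s) * (1/12) + (\<Sum>j\<in>J. of_int (e j) * (- (of_int ((int j * a mod g) * (g - int j * a mod g)) / (2 * of_int (g\<^sup>2)))))))" .
  also have "u * (of_int (12 * s) * (1/12) + (\<Sum>j\<in>J. of_int (e j) * (- (of_int ((int j * a mod g) * (g - int j * a mod g)) / (2 * of_int (g\<^sup>2))))))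
     = of_int (cusp_ord s J e g a) / (2 * real N)"
  proof -
    define S where "S = (\<Sum>j\<in>J. e j * ((int j * a mod g) * (g - int j * a mod g)))"
    have S: "(\<Sum>j\<in>J. of_int (e j) * (- (of_int ((int j * a mod g) * (g - int j * a mod g)) / (2 * of_int (g\<^sup>2)))) :: real)
       = - (of_int S / (2 * of_int (g\<^sup>2)))"
      by (simp add: S_def sum_negf sum_divide_distrib)
    show ?thesis
      unfolding S cusp_ord_def S_def[symmetric] u_def Nr using g npos
      by (simp add: field_simps power2_eq_square)
  qed
  finally have "has_order (\<lambda>\<tau>. of_real (1 / of_int n ^ k) * G (of_real u * \<tau> + of_real v)) (0 + of_int (cusp_ord s J e g a) / (2 * real N))"
    using npos by (intro has_order_mult has_order_const) auto
  then have "has_order (\<lambda>\<tau>. of_real (1 / of_int n ^ k) * G (of_real u * \<tau> + of_real v)) (of_int (cusp_ord s J e g a) / (2 * real N))"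
    by simp
  then show ?thesis unfolding g_def[symmetric]
  proof (rule has_order_transform)
    fix \<tau> assume \<tau>: "Im \<tau> > 0"
    define i where "i = of_int c * \<tau> + of_int d"
    define t where "t = of_real u * \<tau> + of_real v"
    have i0: "i \<noteq> 0" unfolding i_def using aut_nonzero[OF det \<tau>] .
    have nz: "of_int n \<noteq> (0 :: complex)" using npos by simp
    have t: "Im t > 0" using \<tau> u by (simp add: t_def)
    have tn: "t * of_int n = of_int g * \<tau> + of_int h" using npos by (simp add: t_def u_def v_def field_simps)
    have dn: "of_int c1 * t + of_int x = i / of_int n"
    proof -
      have "(of_int c1 * t + of_int x) * of_int n = of_int c1 * (t * of_int n) + of_int (x * n)" by (simp add: algebra_simps)
      also have "\<dots> = of_int (g * c1) * \<tau> + of_int (c1 * h + x * n)" unfolding tn by (simp add: algebra_simps)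
      finally have "(of_int c1 * t + of_int x) * of_int n = i" unfolding h2 c1[symmetric] i_def .
      then show ?thesis using nz by (simp add: field_simps)
    qed
    have nu: "of_int (n * a) * t + of_int y = of_int g * (of_int a * \<tau> + of_int b)"
    proof -
      have "of_int (n * a) * t + of_int y = of_int a * (t * of_int n) + of_int y" by (simp add: algebra_simps)
      also have "\<dots> = of_int (g * a) * \<tau> + of_int (a * h + y)" unfolding tn by (simp add: algebra_simps)
      finally show ?thesis unfolding h1 by (simp add: algebra_simps)
    qed
    have Nn: "of_nat N = (of_int g * of_int n :: complex)"
      using arg_cong[OF n, of complex_of_int] by simp
    have arg: "(of_int (n * a) * t + of_int y) / (of_int c1 * t + of_int x) = of_nat N * ((of_int a * \<tau> + of_int b) / i)"
      unfolding dn nu Nn using i0 nz by (simp add: field_simps)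
    have dt: "n * a * x - y * c1 = 1" using xy by (simp add: mult_ac)
    have K: "kl r1 r2 (of_nat N * ((of_int a * \<tau> + of_int b) / i)) =
       kl (r1 * of_int (n * a) + r2 * of_int c1) (r1 * of_int y + r2 * of_int x) t / (i / of_int n)" for r1 r2
      using kl_modular[OF dt t, of r1 r2, unfolded arg, unfolded dn] .
    have p: "z powi (12 * s) = (z ^ 12) powi s" for z :: complex
      by (simp add: power_int_mult)
    have D: "eta2 (of_nat N * ((of_int a * \<tau> + of_int b) / i)) powi (12 * s) = (i / of_int n) powi (12 * s) * eta2 t powi (12 * s)"
      unfolding p Delta_modular[OF dt t, unfolded arg, unfolded dn] power_int_mult_distrib ..
    have in0: "i / of_int n \<noteq> 0" using i0 nz by simp
    have "klein_prod N (12 * s) J e ((of_int a * \<tau> + of_int b) / i) =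
       (i / of_int n) powi (12 * s - (\<Sum>j\<in>J. e j)) * G t"
      unfolding klein_prod_def G_def K D power_int_divide_distrib[of "kl _ _ _"] prod_dividef prod_power_int_const[OF in0]
      using in0 by (simp add: power_int_diff)
    also have "(i / of_int n) powi (12 * s - (\<Sum>j\<in>J. e j)) = i ^ k / of_int n ^ k"
      unfolding wt by (simp add: power_divide)
    finally have "klein_prod N (12 * s) J e ((of_int a * \<tau> + of_int b) / i) / i ^ k = of_real (1 / of_int n ^ k) * G t"
      using i0 by simp
    then show "norm (of_real (1 / of_int n ^ k) * G (of_real u * \<tau> + of_real v)) =
        norm (klein_prod N (12 * s) J e ((of_int a * \<tau> + of_int b) / (of_int c * \<tau> + of_int d)) / (of_int c * \<tau> + of_int d) ^ k)"
      unfolding i_def t_def by simp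
  qed
qed

no_notation fps_nth (infixl "$" 75)

section \<open>The slash action\<close>

lemma SL2Z_det: "\<gamma> \<in> SL2Z \<Longrightarrow> \<gamma>$1$1 * \<gamma>$2$2 - \<gamma>$1$2 * \<gamma>$2$1 = 1"
  by (simp add: SL2Z_def det_2)

text \<open>The matrix with rows \<open>(a, b)\<close> and \<open>(c, d)\<close>.\<close>

definition mat2 :: "int \<Rightarrow> int \<Rightarrow> int \<Rightarrow> int \<Rightarrow> int^2^2" where
  "mat2 a b c d = vector [vector [a, b], vector [c, d]]"

lemma mat2_nth [simp]: "mat2 a b c d $ 1 $ 1 = a" "mat2 a b c d $ 1 $ 2 = b"
    "mat2 a b c d $ 2 $ 1 = c" "mat2 a b c d $ 2 $ 2 = d"
  by (simp_all add: mat2_def)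

lemma mat2_SL2Z [simp]: "mat2 a b c d \<in> SL2Z \<longleftrightarrow> a * d - b * c = 1"
  by (simp add: SL2Z_def det_2)

lemma mat2_Gamma1: "mat2 a b c d \<in> Gamma1 N \<longleftrightarrow>
    a * d - b * c = 1 \<and> a mod int N = 1 mod int N \<and> d mod int N = 1 mod int N \<and> int N dvd c"
  by (auto simp: Gamma1_def)

lemma Gamma1_SL2Z: "\<gamma> \<in> Gamma1 N \<Longrightarrow> \<gamma> \<in> SL2Z"
  by (simp add: Gamma1_def)

lemma Gamma1_entries:
  assumes "\<gamma> \<in> Gamma1 N"
  obtains a' c' where "\<gamma>$1$1 = 1 + int N * a'" "\<gamma>$2$1 = int N * c'"
proof -
  from assms have "int N dvd \<gamma>$1$1 - 1" "int N dvd \<gamma>$2$1"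
    by (auto simp: Gamma1_def mod_eq_dvd_iff)
  then obtain a' c' where "\<gamma>$1$1 - 1 = int N * a'" "\<gamma>$2$1 = int N * c'" by (auto elim!: dvdE)
  then show ?thesis using that[of a' c'] by simp
qed

lemma SL2Z_coprime_gcd:
  assumes \<gamma>: "\<gamma> \<in> SL2Z"
  shows "coprime (\<gamma>$1$1) (gcd (\<gamma>$2$1) n)"
proof -
  have "coprime (\<gamma>$1$1) (\<gamma>$2$1)"
  proof (rule coprimeI)
    fix l assume "l dvd \<gamma>$1$1" "l dvd \<gamma>$2$1"
    then have "l dvd \<gamma>$1$1 * \<gamma>$2$2 - \<gamma>$1$2 * \<gamma>$2$1" by simp
    then show "is_unit l" unfolding SL2Z_det[OF \<gamma>] .
  qed
  then show ?thesis by (meson coprime_divisors dvd_refl gcd_dvd1)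
qed

lemma aut_factor_nonzero: "\<gamma> \<in> SL2Z \<Longrightarrow> Im \<tau> > 0 \<Longrightarrow> aut_factor \<gamma> \<tau> \<noteq> 0"
  unfolding aut_factor_def using aut_nonzero[OF SL2Z_det] .

lemma Im_moebius_act: "\<gamma> \<in> SL2Z \<Longrightarrow> Im (moebius_act \<gamma> \<tau>) = Im \<tau> / (norm (aut_factor \<gamma> \<tau>))\<^sup>2"
  unfolding aut_factor_def moebius_act_def using Im_moebius[OF SL2Z_det] .

lemma Im_moebius_act_pos: "\<gamma> \<in> SL2Z \<Longrightarrow> Im \<tau> > 0 \<Longrightarrow> Im (moebius_act \<gamma> \<tau>) > 0"
  using aut_factor_nonzero[of \<gamma> \<tau>] by (simp add: Im_moebius_act)

text \<open>The condition for triviality of the multiplier of a product of Klein forms on \<open>\<Gamma>\<^sub>1(N)\<close>: writing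
  \<open>A = \<Sum> j e\<^sub>j\<close>, the number \<open>(A + \<Sum> j\<^sup>2 e\<^sub>j / N) / 2\<close> is an integer.\<close>

definition trivial_multiplier :: "nat \<Rightarrow> nat set \<Rightarrow> (nat \<Rightarrow> int) \<Rightarrow> bool" where
  "trivial_multiplier N J e \<longleftrightarrow> (\<exists>B. (\<Sum>j\<in>J. (int j)\<^sup>2 * e j) = int N * B \<and> even ((\<Sum>j\<in>J. int j * e j) + B))"

lemma slash_klein_prod_Gamma1:
  assumes N: "N > 0" and J: "finite J" "\<And>j. j \<in> J \<Longrightarrow> \<not> N dvd j"
    and wt: "12 * s - (\<Sum>j\<in>J. e j) = int k" and tm: "trivial_multiplier N J e"
    and \<gamma>: "\<gamma> \<in> Gamma1 N" and \<tau>: "Im \<tau> > 0"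
  shows "slash k \<gamma> (klein_prod N (12 * s) J e) \<tau> = klein_prod N (12 * s) J e \<tau>"
proof -
  obtain a' c' where ac: "\<gamma>$1$1 = 1 + int N * a'" "\<gamma>$2$1 = int N * c'" using \<gamma> by (rule Gamma1_entries)
  obtain B where B: "(\<Sum>j\<in>J. (int j)\<^sup>2 * e j) = int N * B" "even ((\<Sum>j\<in>J. int j * e j) + B)"
    using tm by (auto simp: trivial_multiplier_def)
  show ?thesis
    using klein_prod_Gamma1[OF N J SL2Z_det[OF Gamma1_SL2Z[OF \<gamma>]] ac \<tau> B, of s]
      aut_factor_nonzero[OF Gamma1_SL2Z[OF \<gamma>] \<tau>]
    unfolding wt by (simp add: slash_def moebius_act_def aut_factor_def)
qed

lemma has_order_slash_klein_prod:
  assumes N: "N > 0" and J: "finite J" "\<And>j. j \<in> J \<Longrightarrow> \<not> N dvd j"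
    and wt: "12 * s - (\<Sum>j\<in>J. e j) = int k" and \<gamma>: "\<gamma> \<in> SL2Z"
  shows "has_order (slash k \<gamma> (klein_prod N (12 * s) J e))
    (of_int (cusp_ord s J e (gcd (\<gamma>$2$1) (int N)) (\<gamma>$1$1)) / (2 * real N))"
  using klein_prod_cusp[OF N J SL2Z_det[OF \<gamma>] wt]
  by (simp add: slash_def[abs_def] moebius_act_def aut_factor_def)

lemma has_order_bounded:
  assumes "has_order f e" "e \<ge> 0"
  obtains B C where "\<And>\<tau>. Im \<tau> \<ge> B \<Longrightarrow> norm (f \<tau>) \<le> C"
proof -
  from assms(1) obtain c C B where *: "c > 0" "C > 0" "B > 0"
    "\<And>\<tau>. Im \<tau> \<ge> B \<Longrightarrow> c * exp (- 2 * pi * e * Im \<tau>) \<le> norm (f \<tau>)"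
    "\<And>\<tau>. Im \<tau> \<ge> B \<Longrightarrow> norm (f \<tau>) \<le> C * exp (- 2 * pi * e * Im \<tau>)" by (rule has_orderE) blast
  have "norm (f \<tau>) \<le> C" if "Im \<tau> \<ge> B" for \<tau>
  proof -
    have "C * exp (- 2 * pi * e * Im \<tau>) \<le> C * 1"
      using * that assms(2) by (intro mult_left_mono) auto
    then show ?thesis using *(5)[OF that] by simp
  qed
  then show ?thesis by (rule that)
qed

lemma bounded_has_order:
  assumes "has_order f e" and bd: "\<And>\<tau>. Im \<tau> > 0 \<Longrightarrow> Im \<tau> \<ge> B \<Longrightarrow> norm (f \<tau>) \<le> C"
  shows "e \<ge> 0"
proof (rule ccontr)
  assume "\<not> e \<ge> 0"
  from assms(1) obtain c C' B' where "c > 0" "C' > 0" "B' > 0"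
    "\<And>\<tau>. Im \<tau> \<ge> B' \<Longrightarrow> c * exp (- 2 * pi * e * Im \<tau>) \<le> norm (f \<tau>)"
    "\<And>\<tau>. Im \<tau> \<ge> B' \<Longrightarrow> norm (f \<tau>) \<le> C' * exp (- 2 * pi * e * Im \<tau>)" by (rule has_orderE) blast
  note * = this(1,3,4)
  define w where "w = - 2 * pi * e"
  have w: "w > 0" unfolding w_def using \<open>\<not> e \<ge> 0\<close> by (simp add: mult_less_0_iff zero_less_mult_iff not_le)
  define y where "y = max (max B B') (C / (c * w))"
  have y: "y \<ge> B" "y \<ge> B'" "y \<ge> C / (c * w)" "y > 0" using *(2) by (auto simp: y_def)
  have "C \<le> c * (w * y)" using y(3) *(1) w by (simp add: field_simps)
  also have "c * (w * y) < c * exp (w * y)"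
    using *(1) exp_ge_add_one_self[of "w * y"] by (intro mult_strict_left_mono) linarith+
  also have "\<dots> \<le> norm (f (\<i> * of_real y))" using *(3)[of "\<i> * of_real y"] y by (simp add: w_def)
  also have "\<dots> \<le> C" using bd[of "\<i> * of_real y"] y by simp
  finally show False by simp
qed

section \<open>Generalised eta quotients as products of Klein forms\<close>

lemma qpow_eq_ee: "qpow \<tau> r = ee (\<tau> * of_real r)"
  by (simp add: qpow_def ee_def mult_ac)

lemma qpoch_eq_kl:
  assumes N: "N > 0" and j: "j \<le> N" and \<tau>: "Im \<tau> > 0"
  shows "qpoch [qpow \<tau> (real j), qpow \<tau> (real (N - j))] (qpow \<tau> (real N)) =
    ee (of_int (int j * int (N - j)) * (\<tau> / (2 * of_nat N))) * kl (real j / real N) 0 (of_nat N * \<tau>) *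
      qinf (ee (of_nat N * \<tau>)) (ee (of_nat N * \<tau>)) ^ 2"
proof -
  define P where "P = qinf (ee (of_nat N * \<tau>)) (ee (of_nat N * \<tau>))"
  have P: "P \<noteq> 0" unfolding P_def using \<tau> N by (intro qinf_self_nonzero norm_ee_less_1) simp
  have z: "of_real (real j / real N) * (of_nat N * \<tau>) + of_real 0 = of_nat j * \<tau>" using N by simp
  have e: "ee (\<tau> * of_real (real (N - j))) = ee (of_nat N * \<tau>) / ee (of_nat j * \<tau>)"
  proof -
    have "\<tau> * of_real (real (N - j)) = of_nat N * \<tau> + - (of_nat j * \<tau>)"
      using j by (simp add: of_nat_diff algebra_simps)
    then show ?thesis by (simp only: ee_add ee_minus divide_inverse)
  qed
  have ex: "ee (of_int (int j * int (N - j)) * (\<tau> / (2 * of_nat N))) *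
      ee (of_real (real j / real N) * (of_nat j * \<tau>) / 2) * ee (- (of_nat j * \<tau>) / 2) = ee 0"
    unfolding ee_add[symmetric] by (rule arg_cong[of _ _ ee]) (use N j in \<open>simp add: of_nat_diff field_simps\<close>)
  have "ee (of_int (int j * int (N - j)) * (\<tau> / (2 * of_nat N))) * kl (real j / real N) 0 (of_nat N * \<tau>) * P ^ 2 =
      (ee (of_int (int j * int (N - j)) * (\<tau> / (2 * of_nat N))) *
      ee (of_real (real j / real N) * (of_nat j * \<tau>) / 2) * ee (- (of_nat j * \<tau>) / 2)) *
      (qinf (ee (of_nat j * \<tau>)) (ee (of_nat N * \<tau>)) * qinf (ee (of_nat N * \<tau>) / ee (of_nat j * \<tau>)) (ee (of_nat N * \<tau>)))"
    unfolding kl_def z phi_def P_def[symmetric] using P by (simp add: mult_ac)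
  also have "\<dots> = qinf (ee (of_nat j * \<tau>)) (ee (of_nat N * \<tau>)) * qinf (ee (of_nat N * \<tau>) / ee (of_nat j * \<tau>)) (ee (of_nat N * \<tau>))"
    unfolding ex by simp
  also have "\<dots> = qpoch [qpow \<tau> (real j), qpow \<tau> (real (N - j))] (qpow \<tau> (real N))"
    unfolding qpow_eq_ee e qpoch_def by (simp add: qinf_def mult.commute[of \<tau>])
  finally show ?thesis by (simp add: P_def)
qed

lemma fprod_eq_klein_prod:
  assumes N: "N > 0" and \<tau>: "Im \<tau> > 0"
  shows "fprod N (2 * k) a \<tau> = klein_prod N (int k + (\<Sum>j = 1..N div 2. a j)) {1..N div 2} a \<tau>"
proof -
  define P where "P = qinf (ee (of_nat N * \<tau>)) (ee (of_nat N * \<tau>))"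
  have P: "P ^ 2 \<noteq> 0" unfolding P_def using \<tau> N qinf_self_nonzero[OF norm_ee_less_1] by simp
  define M where "M = int k + (\<Sum>j = 1..N div 2. a j)"
  have q1: "qpoch [qpow \<tau> (real N)] (qpow \<tau> (real N)) ^ (2 * k) = (P ^ 2) powi int k"
  proof -
    have "qpoch [qpow \<tau> (real N)] (qpow \<tau> (real N)) = P"
      by (simp add: qpoch_def qpow_eq_ee P_def qinf_def mult.commute[of \<tau>])
    then show ?thesis by (simp only: power_mult power_int_of_nat)
  qed
  have "(\<Prod>j = 1..N div 2. qpoch [qpow \<tau> (real j), qpow \<tau> (real (N - j))] (qpow \<tau> (real N)) powi a j) =
      (\<Prod>j = 1..N div 2. ee (of_int (a j) * (of_int (int j * int (N - j)) * (\<tau> / (2 * of_nat N)))) *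
         kl (real j / real N) 0 (of_nat N * \<tau>) powi a j * (P ^ 2) powi a j)"
  proof (rule prod.cong[OF refl])
    fix j assume "j \<in> {1..N div 2}"
    then have j: "j \<le> N" by auto
    show "qpoch [qpow \<tau> (real j), qpow \<tau> (real (N - j))] (qpow \<tau> (real N)) powi a j =
      ee (of_int (a j) * (of_int (int j * int (N - j)) * (\<tau> / (2 * of_nat N)))) *
         kl (real j / real N) 0 (of_nat N * \<tau>) powi a j * (P ^ 2) powi a j"
      unfolding qpoch_eq_kl[OF N j \<tau>] power_int_mult_distrib ee_power_int P_def ..
  qed
  also have "\<dots> = ee (\<Sum>j = 1..N div 2. of_int (a j) * (of_int (int j * int (N - j)) * (\<tau> / (2 * of_nat N)))) *
      (\<Prod>j = 1..N div 2. kl (real j / real N) 0 (of_nat N * \<tau>) powi a j) * (P ^ 2) powi (\<Sum>j = 1..N div 2. a j)"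
    by (simp only: prod.distrib ee_sum prod_power_int_const[OF P])
  also have "(\<Sum>j = 1..N div 2. of_int (a j) * (of_int (int j * int (N - j)) * (\<tau> / (2 * of_nat N)))) = of_int (S2 N a) * (\<tau> / (2 * of_nat N))"
    by (simp add: S2_def sum_distrib_left sum_distrib_right sum_divide_distrib mult_ac)
  finally have q2: "(\<Prod>j = 1..N div 2. qpoch [qpow \<tau> (real j), qpow \<tau> (real (N - j))] (qpow \<tau> (real N)) powi a j) =
    ee (of_int (S2 N a) * (\<tau> / (2 * of_nat N))) *
      (\<Prod>j = 1..N div 2. kl (real j / real N) 0 (of_nat N * \<tau>) powi a j) * (P ^ 2) powi (\<Sum>j = 1..N div 2. a j)" .
  have ex: "ee (\<tau> * of_real (real N / 24 * of_int (S1 N (2 * k) a) - 1 / (2 * real N) * of_int (S2 N a))) * ee (of_int (S2 N a) * (\<tau> / (2 * of_nat N)))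
     = ee (of_int M * (of_nat N * \<tau> / 12))"
    unfolding ee_add[symmetric] M_def S1_def by (rule arg_cong[of _ _ ee]) (use N in \<open>simp add: field_simps\<close>)
  have "fprod N (2 * k) a \<tau> = (ee (\<tau> * of_real (real N / 24 * of_int (S1 N (2 * k) a) - 1 / (2 * real N) * of_int (S2 N a))) * ee (of_int (S2 N a) * (\<tau> / (2 * of_nat N))))
      * ((P ^ 2) powi int k * (P ^ 2) powi (\<Sum>j = 1..N div 2. a j)) * (\<Prod>j = 1..N div 2. kl (real j / real N) 0 (of_nat N * \<tau>) powi a j)"
    unfolding fprod_def q1 q2 qpow_eq_ee[of \<tau> "_ - _"] by (simp only: mult_ac)
  also have "\<dots> = ee (of_int M * (of_nat N * \<tau> / 12)) * (P ^ 2) powi M * (\<Prod>j = 1..N div 2. kl (real j / real N) 0 (of_nat N * \<tau>) powi a j)"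
    unfolding ex M_def using P by (simp add: power_int_add)
  also have "\<dots> = klein_prod N M {1..N div 2} a \<tau>"
    by (simp only: klein_prod_def eta2_def power_int_mult_distrib ee_power_int P_def)
  finally show ?thesis by (simp only: M_def)
qed

section \<open>Characterisation of modularity\<close>

lemma cusp_ord_mod: "cusp_ord s J e g (A mod g) = cusp_ord s J e g A"
  by (simp add: cusp_ord_def mod_mult_right_eq)

lemma S2_eq: "S2 N a = int N * (\<Sum>j = 1..N div 2. int j * a j) - (\<Sum>j = 1..N div 2. (int j)\<^sup>2 * a j)"
  unfolding S2_def sum_distrib_left sum_subtractf[symmetric]
  by (rule sum.cong) (auto simp: of_nat_diff algebra_simps power2_eq_square)

lemma trivial_multiplier_iff_S2:
  assumes "N > 0"
  shows "trivial_multiplier N {1..N div 2} a \<longleftrightarrow> 2 * int N dvd S2 N a"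
proof
  assume "trivial_multiplier N {1..N div 2} a"
  then obtain B where B: "(\<Sum>j = 1..N div 2. (int j)\<^sup>2 * a j) = int N * B" "even ((\<Sum>j = 1..N div 2. int j * a j) + B)"
    by (auto simp: trivial_multiplier_def)
  have "S2 N a = int N * ((\<Sum>j = 1..N div 2. int j * a j) + B - 2 * B)"
    unfolding S2_eq B(1) by (simp add: algebra_simps)
  moreover have "2 dvd (\<Sum>j = 1..N div 2. int j * a j) + B - 2 * B" using B(2) by simp
  ultimately show "2 * int N dvd S2 N a" by (auto elim!: dvdE)
next
  assume "2 * int N dvd S2 N a"
  then obtain t where t: "S2 N a = 2 * int N * t" by (rule dvdE)
  define A where "A = (\<Sum>j = 1..N div 2. int j * a j)"
  have "(\<Sum>j = 1..N div 2. (int j)\<^sup>2 * a j) = int N * (A - 2 * t)"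
    using t unfolding S2_eq A_def[symmetric] by (simp add: algebra_simps)
  moreover have "even (A + (A - 2 * t))" by simp
  ultimately show "trivial_multiplier N {1..N div 2} a"
    unfolding trivial_multiplier_def A_def by blast
qed

lemma uhp_iff [simp]: "\<tau> \<in> upper_half_plane \<longleftrightarrow> Im \<tau> > 0"
  by (simp add: upper_half_plane_def)

lemma not_dvd_half: "N > 0 \<Longrightarrow> j \<in> {1..N div 2} \<Longrightarrow> \<not> N dvd (j :: nat)"
  by (auto dest!: dvd_imp_le)

lemma slash_cong:
  assumes "\<And>\<tau>. Im \<tau> > 0 \<Longrightarrow> f \<tau> = g \<tau>" "\<gamma> \<in> SL2Z" "Im \<tau> > 0"
  shows "slash k \<gamma> f \<tau> = slash k \<gamma> g \<tau>"
  using assms Im_moebius_act_pos by (simp add: slash_def)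

lemma modular_forms_cong:
  assumes "\<And>\<tau>. Im \<tau> > 0 \<Longrightarrow> f \<tau> = g \<tau>" and G: "G \<subseteq> SL2Z" and f: "f \<in> modular_forms k G"
  shows "g \<in> modular_forms k G"
proof -
  have sl: "slash k \<gamma> f \<tau> = slash k \<gamma> g \<tau>" if "\<gamma> \<in> SL2Z" "\<tau> \<in> upper_half_plane" for \<gamma> \<tau>
    using slash_cong[of f g \<gamma> \<tau> k] assms(1) that by simp
  have "g holomorphic_on upper_half_plane"
    by (rule holomorphic_transform[of f]) (use f assms(1) in \<open>auto simp: modular_forms_def\<close>)
  moreover have "\<forall>\<gamma>\<in>G. \<forall>\<tau>\<in>upper_half_plane. slash k \<gamma> g \<tau> = g \<tau>"
    using f G sl assms(1) by (force simp: modular_forms_def)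
  moreover have "\<forall>\<gamma>\<in>SL2Z. \<exists>B C. \<forall>\<tau>\<in>upper_half_plane. Im \<tau> \<ge> B \<longrightarrow> norm (slash k \<gamma> g \<tau>) \<le> C"
    using f sl by (simp add: modular_forms_def)
  ultimately show ?thesis by (simp add: modular_forms_def)
qed

text \<open>Invariance under the matrix with rows \<open>(1, 0)\<close>, \<open>(N, 1)\<close> gives the condition modulo \<open>12\<close>, invariance under
  translation the one on \<open>S\<^sub>2\<close>; together they are sufficient for invariance. Holomorphy at the cusps
  amounts to nonnegative orders, and every pair \<open>(g, A)\<close> occurs as a cusp \<open>A / g\<close>.\<close>

theorem klein_prod_modular_iff:
  assumes N: "N > 0"
  shows "klein_prod N (int k + (\<Sum>j = 1..N div 2. a j)) {1..N div 2} a \<in> modular_forms k (Gamma1 N) \<longleftrightarrow>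
    (\<exists>s. int k + (\<Sum>j = 1..N div 2. a j) = 12 * s \<and> 2 * int N dvd S2 N a \<and>
      (\<forall>g A. g > 0 \<longrightarrow> g dvd int N \<longrightarrow> coprime A g \<longrightarrow> cusp_ord s {1..N div 2} a g A \<ge> 0))"
    (is "?f \<in> _ \<longleftrightarrow> ?R")
proof
  let ?J = "{1..N div 2}"
  note J = finite_atLeastAtMost[of 1 "N div 2"] not_dvd_half[OF N]
  assume f: "?f \<in> modular_forms k (Gamma1 N)"
  have inv: "slash k \<gamma> ?f \<i> = ?f \<i>" if "\<gamma> \<in> Gamma1 N" for \<gamma>
    using f that by (simp add: modular_forms_def)
  have nz: "?f \<i> \<noteq> 0" using klein_prod_nonzero[OF N J] by simp
  define M where "M = int k + sum a ?J"
  have i0: "of_nat N * \<i> + 1 \<noteq> (0 :: complex)" by (simp add: complex_eq_iff)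
  have "slash k (mat2 1 0 (int N) 1) ?f \<i> = ee (- of_int M / 12) * ?f \<i>"
    using klein_prod_lower_unipotent[OF N J, of \<i> M a] i0
    by (simp add: slash_def moebius_act_def aut_factor_def M_def)
  moreover have "slash k (mat2 1 0 (int N) 1) ?f \<i> = ?f \<i>"
    by (rule inv) (simp add: mat2_Gamma1)
  ultimately have "ee (- of_int M / 12) = 1" using nz by simp
  then obtain s' where "- of_int M / 12 = (of_int s' :: complex)" unfolding ee_eq_1_iff by (rule Ints_cases)
  then have "of_int (- M) = (of_int (12 * s') :: complex)" by (simp add: field_simps)
  then have "- M = 12 * s'" unfolding of_int_eq_iff .
  then have "M = 12 * (- s')" by simp
  then obtain s where s: "M = 12 * s" by blast
  have f': "?f = klein_prod N (12 * s) ?J a" using s by (simp add: M_def)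
  have wt: "12 * s - sum a ?J = int k" using s by (simp add: M_def)
  define A B where "A = (\<Sum>j\<in>?J. int j * a j)" and "B = (\<Sum>j\<in>?J. (int j)\<^sup>2 * a j)"
  have "slash k (mat2 1 1 0 1) ?f \<i> = ee (of_real ((of_int A + of_int B / real N) / 2)) * ?f \<i>"
    unfolding f' using klein_prod_translation[OF N J, of \<i> s a]
    by (simp add: slash_def moebius_act_def aut_factor_def A_def B_def)
  moreover have "slash k (mat2 1 1 0 1) ?f \<i> = ?f \<i>"
    by (rule inv) (simp add: mat2_Gamma1)
  ultimately have "ee (of_real ((of_int A + of_int B / real N) / 2)) = 1" using nz by simp
  then have "(of_int A + of_int B / real N) / 2 \<in> \<int>" unfolding ee_eq_1_iff of_real_in_Ints_iff .
  then obtain l where "(of_int A + of_int B / real N) / 2 = of_int l" by (rule Ints_cases)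
  then have "(of_int B :: real) = of_int (int N * (2 * l - A))" using N by (simp add: field_simps)
  then have B: "B = int N * (2 * l - A)" unfolding of_int_eq_iff .
  have tm: "trivial_multiplier N ?J a"
    unfolding trivial_multiplier_def by (rule exI[of _ "2 * l - A"]) (use B in \<open>simp add: A_def B_def\<close>)
  have "cusp_ord s ?J a g A \<ge> 0" if g: "g > 0" "g dvd int N" "coprime A g" for g A
  proof -
    obtain u v where "u * A + v * g = 1" using bezout_int[of A g] g(3) by auto
    then have \<gamma>: "mat2 A (- v) g u \<in> SL2Z" by (simp add: mult_ac)
    obtain B C where "\<And>\<tau>. Im \<tau> > 0 \<Longrightarrow> Im \<tau> \<ge> B \<Longrightarrow> norm (slash k (mat2 A (- v) g u) ?f \<tau>) \<le> C"
      using f \<gamma> unfolding modular_forms_def by (fastforce simp del: mat2_SL2Z)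
    from bounded_has_order[OF has_order_slash_klein_prod[OF N J wt \<gamma>, folded f'] this]
    have "of_int (cusp_ord s ?J a (gcd g (int N)) A) / (2 * real N) \<ge> 0" by simp
    moreover have "gcd g (int N) = g" using g(1,2) by (simp add: gcd_proj1_iff)
    ultimately show ?thesis using N by (simp add: zero_le_divide_iff)
  qed
  then show ?R using s tm trivial_multiplier_iff_S2[OF N] unfolding M_def by blast
next
  let ?J = "{1..N div 2}"
  note J = finite_atLeastAtMost[of 1 "N div 2"] not_dvd_half[OF N]
  assume ?R
  then obtain s where s: "int k + sum a ?J = 12 * s" and S2: "2 * int N dvd S2 N a"
    and ord: "\<And>g A. g > 0 \<Longrightarrow> g dvd int N \<Longrightarrow> coprime A g \<Longrightarrow> cusp_ord s ?J a g A \<ge> 0" by blast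
  have tm: "trivial_multiplier N ?J a" using S2 trivial_multiplier_iff_S2[OF N] by simp
  have wt: "12 * s - sum a ?J = int k" using s by simp
  have hol: "klein_prod N (12 * s) ?J a holomorphic_on upper_half_plane"
    using holomorphic_klein_prod[OF N J] by (simp add: upper_half_plane_def)
  have bd: "\<exists>B C. \<forall>\<tau>\<in>upper_half_plane. Im \<tau> \<ge> B \<longrightarrow> norm (slash k \<gamma> (klein_prod N (12 * s) ?J a) \<tau>) \<le> C"
    if \<gamma>: "\<gamma> \<in> SL2Z" for \<gamma>
  proof -
    have "coprime (\<gamma>$1$1) (gcd (\<gamma>$2$1) (int N))" by (rule SL2Z_coprime_gcd[OF \<gamma>])
    then have "cusp_ord s ?J a (gcd (\<gamma>$2$1) (int N)) (\<gamma>$1$1) \<ge> 0"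
      using N by (intro ord) auto
    then have "of_int (cusp_ord s ?J a (gcd (\<gamma>$2$1) (int N)) (\<gamma>$1$1)) / (2 * real N) \<ge> 0" by simp
    from has_order_bounded[OF has_order_slash_klein_prod[OF N J wt \<gamma>] this]
    obtain B C where "\<And>\<tau>. Im \<tau> \<ge> B \<Longrightarrow> norm (slash k \<gamma> (klein_prod N (12 * s) ?J a) \<tau>) \<le> C" by blast
    then show ?thesis by blast
  qed
  show "?f \<in> modular_forms k (Gamma1 N)"
    unfolding s modular_forms_def
    using hol bd slash_klein_prod_Gamma1[OF N J wt tm] by auto
qed

theorem L_characterisation:
  assumes N: "N > 0"
  shows "a \<in> L N k \<longleftrightarrow> a \<in> {1..N div 2} \<rightarrow>\<^sub>E UNIV \<and>
    (\<exists>s. int k + (\<Sum>j = 1..N div 2. a j) = 12 * s \<and> 2 * int N dvd S2 N a \<and>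
      (\<forall>g A. g > 0 \<longrightarrow> g dvd int N \<longrightarrow> coprime A g \<longrightarrow> cusp_ord s {1..N div 2} a g A \<ge> 0))"
proof -
  have "fprod N (2 * k) a \<in> modular_forms k (Gamma1 N) \<longleftrightarrow>
     klein_prod N (int k + (\<Sum>j = 1..N div 2. a j)) {1..N div 2} a \<in> modular_forms k (Gamma1 N)"
    using fprod_eq_klein_prod[OF N] Gamma1_SL2Z modular_forms_cong[of _ _ "Gamma1 N" k]
    by (metis (no_types, lifting) subsetI)
  then show ?thesis
    unfolding L_def using klein_prod_modular_iff[OF N] by simp
qed

section \<open>The modular group acting on the upper half-plane\<close>

lemma matrix_mult_2_nth:
  fixes A B :: "int^2^2"
  shows "(A ** B)$1$1 = A$1$1 * B$1$1 + A$1$2 * B$2$1" "(A ** B)$1$2 = A$1$1 * B$1$2 + A$1$2 * B$2$2"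
    "(A ** B)$2$1 = A$2$1 * B$1$1 + A$2$2 * B$2$1" "(A ** B)$2$2 = A$2$1 * B$1$2 + A$2$2 * B$2$2"
  by (simp_all add: matrix_matrix_mult_def sum_2)

lemma mat_2_eqI:
  fixes A B :: "int^2^2"
  assumes "A$1$1 = B$1$1" "A$1$2 = B$1$2" "A$2$1 = B$2$1" "A$2$2 = B$2$2"
  shows "A = B"
  using assms by (simp add: vec_eq_iff forall_2)

lemma SL2Z_mult: "\<gamma> \<in> SL2Z \<Longrightarrow> \<delta> \<in> SL2Z \<Longrightarrow> \<gamma> ** \<delta> \<in> SL2Z"
  by (simp add: SL2Z_def det_mul)

lemma aut_factor_mult:
  assumes "\<delta> \<in> SL2Z" "Im \<tau> > 0"
  shows "aut_factor (\<gamma> ** \<delta>) \<tau> = aut_factor \<gamma> (moebius_act \<delta> \<tau>) * aut_factor \<delta> \<tau>"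
  using aut_factor_nonzero[OF assms]
  by (simp add: aut_factor_def[of \<gamma>] aut_factor_def[of "\<gamma> ** \<delta>"] moebius_act_def matrix_mult_2_nth field_simps)
     (simp add: aut_factor_def algebra_simps)

lemma moebius_act_mult:
  assumes "\<gamma> \<in> SL2Z" "\<delta> \<in> SL2Z" "Im \<tau> > 0"
  shows "moebius_act (\<gamma> ** \<delta>) \<tau> = moebius_act \<gamma> (moebius_act \<delta> \<tau>)"
proof -
  define m where "m = moebius_act \<delta> \<tau>"
  define j where "j = aut_factor \<delta> \<tau>"
  have j: "j \<noteq> 0" unfolding j_def using aut_factor_nonzero[OF assms(2,3)] .
  have mj: "m * j = of_int (\<delta>$1$1) * \<tau> + of_int (\<delta>$1$2)" using j by (simp add: m_def moebius_act_def j_def)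
  have "of_int ((\<gamma> ** \<delta>)$1$1) * \<tau> + of_int ((\<gamma> ** \<delta>)$1$2) = of_int (\<gamma>$1$1) * (m * j) + of_int (\<gamma>$1$2) * j"
    unfolding mj by (simp add: matrix_mult_2_nth j_def aut_factor_def algebra_simps)
  also have "\<dots> = (of_int (\<gamma>$1$1) * m + of_int (\<gamma>$1$2)) * j" by (simp add: algebra_simps)
  finally show ?thesis
    unfolding moebius_act_def[of "\<gamma> ** \<delta>"] aut_factor_mult[OF assms(2,3)] moebius_act_def[of \<gamma>]
    using j by (simp add: m_def j_def)
qed

lemma SL2Z_inverse:
  assumes "\<gamma> \<in> SL2Z"
  obtains \<delta> where "\<delta> \<in> SL2Z" "\<gamma> ** \<delta> = mat2 1 0 0 1" "\<delta> ** \<gamma> = mat2 1 0 0 1"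
    "\<delta> = mat2 (\<gamma>$2$2) (- \<gamma>$1$2) (- \<gamma>$2$1) (\<gamma>$1$1)"
proof -
  note d = SL2Z_det[OF assms]
  show ?thesis
    by (rule that[of "mat2 (\<gamma>$2$2) (- \<gamma>$1$2) (- \<gamma>$2$1) (\<gamma>$1$1)"])
       (use d in \<open>auto intro!: mat_2_eqI simp: matrix_mult_2_nth algebra_simps\<close>)
qed

lemma moebius_act_one [simp]: "moebius_act (mat2 1 0 0 1) \<tau> = \<tau>"
  by (simp add: moebius_act_def aut_factor_def)

lemma moebius_act_surj:
  assumes "\<gamma> \<in> SL2Z" "Im \<tau> > 0"
  obtains \<tau>' where "Im \<tau>' > 0" "moebius_act \<gamma> \<tau>' = \<tau>"
proof -
  obtain \<delta> where \<delta>: "\<delta> \<in> SL2Z" "\<gamma> ** \<delta> = mat2 1 0 0 1" using SL2Z_inverse[OF assms(1)] by metis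
  show ?thesis
    using that[of "moebius_act \<delta> \<tau>"] moebius_act_mult[OF assms(1) \<delta>(1) assms(2)] \<delta> Im_moebius_act_pos[OF \<delta>(1) assms(2)]
    by simp
qed

lemma holomorphic_moebius_act:
  assumes "\<gamma> \<in> SL2Z" shows "moebius_act \<gamma> holomorphic_on {\<tau>. Im \<tau> > 0}"
  unfolding moebius_act_def[abs_def] aut_factor_def
  using aut_factor_nonzero[OF assms] by (intro holomorphic_intros) (auto simp: aut_factor_def)

lemma deriv_moebius_act:
  assumes "\<gamma> \<in> SL2Z" "Im \<tau> > 0"
  shows "deriv (moebius_act \<gamma>) \<tau> = 1 / aut_factor \<gamma> \<tau> ^ 2"
proof (rule DERIV_imp_deriv)
  note nz = aut_factor_nonzero[OF assms, unfolded aut_factor_def]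
  have detc: "of_int (\<gamma>$1$1) * of_int (\<gamma>$2$2) - of_int (\<gamma>$1$2) * of_int (\<gamma>$2$1) = (1 :: complex)"
    using SL2Z_det[OF assms(1)] by (metis of_int_1 of_int_diff of_int_mult)
  have "((\<lambda>\<tau>. (of_int (\<gamma>$1$1) * \<tau> + of_int (\<gamma>$1$2)) / (of_int (\<gamma>$2$1) * \<tau> + of_int (\<gamma>$2$2))) has_field_derivative
     (of_int (\<gamma>$1$1) * (of_int (\<gamma>$2$1) * \<tau> + of_int (\<gamma>$2$2)) - (of_int (\<gamma>$1$1) * \<tau> + of_int (\<gamma>$1$2)) * of_int (\<gamma>$2$1))
       / ((of_int (\<gamma>$2$1) * \<tau> + of_int (\<gamma>$2$2)) * (of_int (\<gamma>$2$1) * \<tau> + of_int (\<gamma>$2$2)))) (at \<tau>)"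
    using nz by (auto intro!: derivative_eq_intros)
  also have "of_int (\<gamma>$1$1) * (of_int (\<gamma>$2$1) * \<tau> + of_int (\<gamma>$2$2)) - (of_int (\<gamma>$1$1) * \<tau> + of_int (\<gamma>$1$2)) * of_int (\<gamma>$2$1)
     = of_int (\<gamma>$1$1) * of_int (\<gamma>$2$2) - of_int (\<gamma>$1$2) * (of_int (\<gamma>$2$1) :: complex)"
    by (simp add: algebra_simps)
  finally show "(moebius_act \<gamma> has_field_derivative 1 / aut_factor \<gamma> \<tau> ^ 2) (at \<tau>)"
    unfolding detc by (simp add: moebius_act_def[abs_def] aut_factor_def power2_eq_square)
qed

lemma slash_2_eq:
  assumes "\<gamma> \<in> SL2Z" "Im \<tau> > 0"
  shows "f (moebius_act \<gamma> \<tau>) * deriv (moebius_act \<gamma>) \<tau> = slash 2 \<gamma> f \<tau>"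
  by (simp add: deriv_moebius_act[OF assms] slash_def)

text \<open>Reduction theory: choosing \<open>(c, d)\<close> with \<open>\<bar>c\<tau> + d\<bar>\<close> minimal moves \<open>\<tau>\<close> into a
  neighbourhood of the standard fundamental domain.\<close>

lemma reduction:
  assumes \<tau>: "Im \<tau> > 0"
  obtains \<gamma> where "\<gamma> \<in> SL2Z" "Im (moebius_act \<gamma> \<tau>) \<ge> 1/2" "\<bar>Re (moebius_act \<gamma> \<tau>)\<bar> \<le> 1/2"
proof -
  define S where "S = {(c, d). coprime c d \<and> norm (of_int c * \<tau> + of_int d) \<le> 1}"
  have "S \<subseteq> {- \<lceil>1 / Im \<tau>\<rceil>..\<lceil>1 / Im \<tau>\<rceil>} \<times> {- \<lceil>1 + norm \<tau> / Im \<tau>\<rceil>..\<lceil>1 + norm \<tau> / Im \<tau>\<rceil>}"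
  proof (clarsimp simp: S_def)
    fix c d :: int assume *: "norm (of_int c * \<tau> + of_int d) \<le> 1"
    have "\<bar>Im (of_int c * \<tau> + of_int d)\<bar> \<le> 1" using abs_Im_le_cmod * order_trans by blast
    then have c: "\<bar>of_int c\<bar> \<le> 1 / Im \<tau>" using \<tau> by (simp add: abs_mult field_simps)
    have "norm (of_int d :: complex) \<le> norm (of_int c * \<tau> + of_int d) + norm (of_int c * \<tau>)"
      by (metis add_diff_cancel_left' norm_triangle_ineq4)
    also have "\<dots> \<le> 1 + 1 / Im \<tau> * norm \<tau>"
      using * mult_right_mono[OF c norm_ge_zero[of \<tau>]] by (intro add_mono) (auto simp: norm_mult)
    finally have d: "\<bar>of_int d\<bar> \<le> 1 + norm \<tau> / Im \<tau>" by simp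
    show "- \<lceil>1 / Im \<tau>\<rceil> \<le> c \<and> c \<le> \<lceil>1 / Im \<tau>\<rceil> \<and> - \<lceil>1 + norm \<tau> / Im \<tau>\<rceil> \<le> d \<and> d \<le> \<lceil>1 + norm \<tau> / Im \<tau>\<rceil>"
      using c d by linarith
  qed
  then have fin: "finite S" by (rule finite_subset) auto
  have "(0, 1) \<in> S" by (simp add: S_def)
  then obtain c d where cd: "(c, d) \<in> S"
    and min: "\<And>x. x \<in> S \<Longrightarrow> norm (of_int c * \<tau> + of_int d) \<le> norm (of_int (fst x) * \<tau> + of_int (snd x))"
    using ex_min_if_finite[of "(\<lambda>x. norm (of_int (fst x) * \<tau> + of_int (snd x))) ` S"] fin
    by (force simp: not_less)
  have cop: "coprime c d" and le1: "norm (of_int c * \<tau> + of_int d) \<le> 1" using cd by (auto simp: S_def)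
  obtain u v where uv: "u * c + v * d = 1" using bezout_int[of c d] cop by auto
  define n where "n = - round (Re (moebius_act (mat2 v (- u) c d) \<tau>))"
  define \<gamma> where "\<gamma> = mat2 (v + n * c) (- u + n * d) c d"
  have g0: "mat2 v (- u) c d \<in> SL2Z" using uv by (simp add: mult_ac)
  have \<gamma>: "\<gamma> \<in> SL2Z" using uv by (simp add: \<gamma>_def algebra_simps)
  define j where "j = of_int c * \<tau> + of_int d"
  have j0: "j \<noteq> 0" using aut_factor_nonzero[OF \<gamma> \<tau>] by (simp add: aut_factor_def \<gamma>_def j_def)
  have "moebius_act \<gamma> \<tau> = moebius_act (mat2 v (- u) c d) \<tau> + of_int n"
    using j0 by (simp add: moebius_act_def aut_factor_def \<gamma>_def j_def field_simps)
  then have re: "\<bar>Re (moebius_act \<gamma> \<tau>)\<bar> \<le> 1/2"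
    using of_int_round_abs_le[of "Re (moebius_act (mat2 v (- u) c d) \<tau>)"] by (simp add: n_def abs_minus_commute)
  have "Im (moebius_act \<gamma> \<tau>) \<ge> 1/2"
  proof (rule ccontr)
    define w where "w = moebius_act \<gamma> \<tau>"
    assume "\<not> Im (moebius_act \<gamma> \<tau>) \<ge> 1/2"
    then have im: "Im w < 1/2" "Im w > 0" using Im_moebius_act_pos[OF \<gamma> \<tau>] by (auto simp: w_def)
    have "(norm w)\<^sup>2 = (Re w)\<^sup>2 + (Im w)\<^sup>2" by (rule cmod_power2)
    also have "(Re w)\<^sup>2 \<le> (1/2)\<^sup>2" using re power_mono[of "\<bar>Re w\<bar>" "1/2" 2] by (simp add: w_def)
    also have "(Im w)\<^sup>2 \<le> (1/2)\<^sup>2" using im by (intro power_mono) auto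
    finally have "(norm w)\<^sup>2 < 1\<^sup>2" by (simp add: power2_eq_square)
    then have w1: "norm w < 1" by (rule power_less_imp_less_base) simp
    \<comment> \<open>applying the inversion would give a lower row shorter than \<open>(c, d)\<close>\<close>
    have wj: "w * j = of_int (v + n * c) * \<tau> + of_int (- u + n * d)"
      using j0 by (simp add: w_def moebius_act_def aut_factor_def \<gamma>_def j_def)
    have lt: "norm (w * j) < norm j" using w1 j0 by (simp add: norm_mult)
    have "coprime (v + n * c) (- u + n * d)"
    proof (rule coprimeI)
      fix l assume "l dvd v + n * c" "l dvd - u + n * d"
      then have "l dvd (v + n * c) * d - (- u + n * d) * c" by simp
      also have "(v + n * c) * d - (- u + n * d) * c = 1" using uv by (simp add: algebra_simps)
      finally show "is_unit l" .
    qed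
    moreover have "norm (of_int (v + n * c) * \<tau> + of_int (- u + n * d)) \<le> 1"
      using lt le1 unfolding wj[symmetric] j_def by linarith
    ultimately have "(v + n * c, - u + n * d) \<in> S"
      unfolding S_def by (simp only: mem_Collect_eq case_prod_conv simp_thms)
    from min[OF this] have "norm j \<le> norm (w * j)" unfolding wj by (simp add: j_def)
    with lt show False by simp
  qed
  with \<gamma> re show ?thesis using that by blast
qed

section \<open>Functions invariant under the full modular group\<close>

text \<open>Convergence to \<open>0\<close>, and boundedness, as \<open>Im \<tau>\<close> tends to infinity, uniformly in \<open>Re \<tau>\<close>.\<close>

definition vanishes_at_ii_inf :: "(complex \<Rightarrow> complex) \<Rightarrow> bool" where
  "vanishes_at_ii_inf f \<longleftrightarrow> (\<forall>\<epsilon>>0. \<exists>B. \<forall>\<tau>. Im \<tau> > 0 \<longrightarrow> Im \<tau> \<ge> B \<longrightarrow> norm (f \<tau>) < \<epsilon>)"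

definition bounded_at_ii_inf :: "(complex \<Rightarrow> complex) \<Rightarrow> bool" where
  "bounded_at_ii_inf f \<longleftrightarrow> (\<exists>B C. \<forall>\<tau>. Im \<tau> > 0 \<longrightarrow> Im \<tau> \<ge> B \<longrightarrow> norm (f \<tau>) \<le> C)"

lemma vanishes_at_ii_infI:
  assumes r: "r > 0" and K: "K > 0"
    and decay: "\<And>t. Im t > 0 \<Longrightarrow> Im t \<ge> B \<Longrightarrow> norm (f t) \<le> K * exp (- r * Im t)"
  shows "vanishes_at_ii_inf f"
  unfolding vanishes_at_ii_inf_def
proof (intro allI impI)
  fix \<epsilon> :: real assume \<epsilon>: "\<epsilon> > 0"
  have "norm (f t) < \<epsilon>" if t: "Im t > 0" "max B (K / (\<epsilon> * r)) \<le> Im t" for t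
  proof -
    have "K / (\<epsilon> * r) \<le> Im t" using t by simp
    then have "K \<le> \<epsilon> * (r * Im t)" using \<epsilon> r by (simp add: field_simps)
    also have "\<dots> < \<epsilon> * exp (r * Im t)"
      using \<epsilon> exp_ge_add_one_self[of "r * Im t"] by (intro mult_strict_left_mono) linarith+
    finally have "K * exp (- (r * Im t)) < \<epsilon>" by (simp add: exp_minus field_simps)
    then show ?thesis using decay[of t] t by simp
  qed
  then show "\<exists>B. \<forall>\<tau>. Im \<tau> > 0 \<longrightarrow> Im \<tau> \<ge> B \<longrightarrow> norm (f \<tau>) < \<epsilon>" by blast
qed

lemma bounded_at_ii_inf_mult:
  assumes "bounded_at_ii_inf f" "bounded_at_ii_inf g"
  shows "bounded_at_ii_inf (\<lambda>\<tau>. f \<tau> * g \<tau>)"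
proof -
  obtain B C where f: "\<And>\<tau>. Im \<tau> > 0 \<Longrightarrow> Im \<tau> \<ge> B \<Longrightarrow> norm (f \<tau>) \<le> C"
    using assms(1) unfolding bounded_at_ii_inf_def by blast
  obtain B' C' where g: "\<And>\<tau>. Im \<tau> > 0 \<Longrightarrow> Im \<tau> \<ge> B' \<Longrightarrow> norm (g \<tau>) \<le> C'"
    using assms(2) unfolding bounded_at_ii_inf_def by blast
  show ?thesis
    unfolding bounded_at_ii_inf_def
  proof (intro exI allI impI)
    fix \<tau> :: complex assume "Im \<tau> > 0" "max B B' \<le> Im \<tau>"
    then have "norm (f \<tau>) \<le> C" "norm (g \<tau>) \<le> C'" using f g by auto
    then show "norm (f \<tau> * g \<tau>) \<le> C * C'"
      unfolding norm_mult by (meson mult_mono norm_ge_zero order_trans)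
  qed
qed

lemma bounded_at_ii_inf_prod:
  assumes "\<And>w. w \<in> W \<Longrightarrow> bounded_at_ii_inf (f w)"
  shows "bounded_at_ii_inf (\<lambda>\<tau>. \<Prod>w\<in>W. f w \<tau>)"
proof -
  have one: "bounded_at_ii_inf (\<lambda>_. 1)"
    unfolding bounded_at_ii_inf_def by (intro exI[of _ 0] exI[of _ 1]) auto
  show ?thesis
    using assms by (induction W rule: infinite_finite_induct) (auto intro: bounded_at_ii_inf_mult one)
qed

lemma vanishes_mult_bounded:
  assumes "vanishes_at_ii_inf f" "bounded_at_ii_inf g"
  shows "vanishes_at_ii_inf (\<lambda>\<tau>. f \<tau> * g \<tau>)"
proof -
  obtain B' C' where g: "\<And>\<tau>. Im \<tau> > 0 \<Longrightarrow> Im \<tau> \<ge> B' \<Longrightarrow> norm (g \<tau>) \<le> C'"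
    using assms(2) unfolding bounded_at_ii_inf_def by blast
  define C where "C = \<bar>C'\<bar> + 1"
  have C: "C > 0" by (simp add: C_def)
  show ?thesis
    unfolding vanishes_at_ii_inf_def
  proof (intro allI impI)
    fix \<epsilon> :: real assume "\<epsilon> > 0"
    then obtain B where f: "\<And>\<tau>. Im \<tau> > 0 \<Longrightarrow> Im \<tau> \<ge> B \<Longrightarrow> norm (f \<tau>) < \<epsilon> / C"
      using assms(1) C unfolding vanishes_at_ii_inf_def by (meson divide_pos_pos)
    have "norm (f \<tau> * g \<tau>) < \<epsilon>" if "Im \<tau> > 0" "max B B' \<le> Im \<tau>" for \<tau>
    proof -
      have "norm (f \<tau>) < \<epsilon> / C" "norm (g \<tau>) \<le> C" using f g[of \<tau>] that by (auto simp: C_def)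
      then have "norm (f \<tau>) * norm (g \<tau>) \<le> norm (f \<tau>) * C" "norm (f \<tau>) * C < \<epsilon>"
        using C mult_left_mono[of "norm (g \<tau>)" C "norm (f \<tau>)"] by (auto simp: field_simps)
      then show ?thesis unfolding norm_mult by linarith
    qed
    then show "\<exists>B. \<forall>\<tau>. Im \<tau> > 0 \<longrightarrow> Im \<tau> \<ge> B \<longrightarrow> norm (f \<tau> * g \<tau>) < \<epsilon>" by blast
  qed
qed

lemma uhp_open: "open {\<tau>. Im \<tau> > 0}" by (rule open_halfspace_Im_gt)

lemma uhp_connected: "connected {\<tau>. Im \<tau> > 0}"
  by (intro convex_connected convex_halfspace_Im_gt)

text \<open>A holomorphic function of level one and weight \<open>0\<close> that vanishes at the cusp is zero, by the
  maximum modulus principle.\<close>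

lemma level_one_zero:
  assumes hol: "v holomorphic_on {\<tau>. Im \<tau> > 0}"
    and inv: "\<And>\<gamma> \<tau>. \<gamma> \<in> SL2Z \<Longrightarrow> Im \<tau> > 0 \<Longrightarrow> v (moebius_act \<gamma> \<tau>) = v \<tau>"
    and van: "vanishes_at_ii_inf v" and \<tau>: "Im \<tau> > 0"
  shows "v \<tau> = 0"
proof (rule ccontr)
  assume nz: "v \<tau> \<noteq> 0"
  obtain B where B: "\<And>t. Im t > 0 \<Longrightarrow> Im t \<ge> B \<Longrightarrow> norm (v t) < norm (v \<tau>)"
    using van nz unfolding vanishes_at_ii_inf_def by (meson zero_less_norm_iff)
  define K where "K = cbox (Complex (-1/2) (1/2)) (Complex (1/2) (max B 1))"
  have K: "z \<in> K \<longleftrightarrow> \<bar>Re z\<bar> \<le> 1/2 \<and> 1/2 \<le> Im z \<and> Im z \<le> max B 1" for z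
    by (auto simp: K_def in_cbox_complex_iff)
  have red: "\<exists>z\<in>K. norm (v t) \<le> norm (v z)" if t: "Im t > 0" "norm (v t) \<ge> norm (v \<tau>)" for t
  proof -
    obtain \<gamma> where \<gamma>: "\<gamma> \<in> SL2Z" "Im (moebius_act \<gamma> t) \<ge> 1/2" "\<bar>Re (moebius_act \<gamma> t)\<bar> \<le> 1/2"
      using reduction[OF t(1)] by blast
    have "norm (v (moebius_act \<gamma> t)) = norm (v t)" using inv[OF \<gamma>(1) t(1)] by simp
    with B[of "moebius_act \<gamma> t"] \<gamma>(2) t(2) have "\<not> B \<le> Im (moebius_act \<gamma> t)" by auto
    then have "Im (moebius_act \<gamma> t) \<le> B" by simp
    then have "moebius_act \<gamma> t \<in> K" using \<gamma> by (auto simp: K)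
    then show ?thesis using inv[OF \<gamma>(1) t(1)] by (intro bexI[of _ "moebius_act \<gamma> t"]) auto
  qed
  have cont: "continuous_on K (\<lambda>z. norm (v z))"
    by (intro continuous_intros continuous_on_subset[OF holomorphic_on_imp_continuous_on[OF hol]]) (auto simp: K)
  have "compact K" by (simp add: K_def)
  moreover have "K \<noteq> {}" using red[OF \<tau>] by auto
  ultimately obtain z0 where z0: "z0 \<in> K" "\<And>z. z \<in> K \<Longrightarrow> norm (v z) \<le> norm (v z0)"
    using continuous_attains_sup[OF _ _ cont] by blast
  have z0i: "Im z0 > 0" using z0(1) by (auto simp: K)
  have max: "norm (v t) \<le> norm (v z0)" if "Im t > 0" for t
  proof (cases "norm (v t) \<ge> norm (v \<tau>)")
    case True
    then show ?thesis using red[OF that] z0(2) by force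
  next
    case False
    then show ?thesis using red[OF \<tau>] z0(2) by force
  qed
  have "v constant_on {\<tau>. Im \<tau> > 0}"
    by (rule maximum_modulus_principle[OF hol uhp_open uhp_connected uhp_open subset_refl, of z0]) (use max z0i in auto)
  then obtain k where k: "\<And>t. Im t > 0 \<Longrightarrow> v t = k" by (auto simp: constant_on_def)
  have "norm (v (\<i> * of_real (max B 1))) < norm (v \<tau>)" by (rule B) auto
  then show False using k[OF \<tau>] k[of "\<i> * of_real (max B 1)"] by simp
qed

lemma holomorphic_prod_eq_0:
  assumes "finite W" "open S" "connected S" "S \<noteq> {}" "\<And>w. w \<in> W \<Longrightarrow> f w holomorphic_on S"
    and "\<And>z. z \<in> S \<Longrightarrow> (\<Prod>w\<in>W. f w z) = 0"
  shows "\<exists>w\<in>W. \<forall>z\<in>S. f w z = (0 :: complex)"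
  using assms(1,5,6)
proof (induction W rule: finite_induct)
  case empty
  then show ?case using assms(4) by auto
next
  case (insert w W)
  show ?case
  proof (cases "\<forall>z\<in>S. f w z = 0")
    case False
    then obtain z0 where z0: "z0 \<in> S" "f w z0 \<noteq> 0" by blast
    have hw: "f w holomorphic_on S" using insert by simp
    have "open {z \<in> S. f w z \<noteq> 0}"
      using continuous_open_preimage[OF holomorphic_on_imp_continuous_on[OF hw] assms(2), of "- {0}"]
      by (simp add: vimage_def Int_def open_Compl)
    moreover have "(\<Prod>w\<in>W. f w z) = 0" if "z \<in> {z \<in> S. f w z \<noteq> 0}" for z
      using insert(5)[of z] that insert(1,2) by simp
    moreover have "(\<lambda>z. \<Prod>w\<in>W. f w z) holomorphic_on S"
      using insert by (intro holomorphic_intros) auto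
    ultimately have "(\<Prod>w\<in>W. f w z) = 0" if "z \<in> S" for z
      using analytic_continuation_open[of "{z \<in> S. f w z \<noteq> 0}" S "\<lambda>z. \<Prod>w\<in>W. f w z" "\<lambda>_. 0" z]
        z0 that assms(2,3) by (auto intro!: holomorphic_intros)
    then show ?thesis using insert by auto
  qed auto
qed

text \<open>A bounded \<open>\<Gamma>\<^sub>1(N)\<close>-invariant function vanishing at one cusp is zero: the product of its finitely
  many translates under the modular group is of level one and vanishes at the cusp. The translate by
  \<open>\<gamma>\<close> depends only on the lower row of \<open>\<gamma>\<close> modulo \<open>N\<close>.\<close>

theorem Gamma1_invariant_zero:
  assumes N: "N > 0" and hol: "u holomorphic_on {\<tau>. Im \<tau> > 0}"
    and inv: "\<And>\<gamma> \<tau>. \<gamma> \<in> Gamma1 N \<Longrightarrow> Im \<tau> > 0 \<Longrightarrow> u (moebius_act \<gamma> \<tau>) = u \<tau>"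
    and bd: "\<And>\<gamma>. \<gamma> \<in> SL2Z \<Longrightarrow> bounded_at_ii_inf (\<lambda>\<tau>. u (moebius_act \<gamma> \<tau>))"
    and van: "\<gamma>0 \<in> SL2Z" "vanishes_at_ii_inf (\<lambda>\<tau>. u (moebius_act \<gamma>0 \<tau>))" and \<tau>: "Im \<tau> > 0"
  shows "u \<tau> = 0"
proof -
  define tr where "tr \<gamma> = (\<lambda>\<tau>. if Im \<tau> > 0 then u (moebius_act \<gamma> \<tau>) else 0)" for \<gamma>
  define W where "W = tr ` SL2Z"
  have same: "tr \<gamma> = tr \<delta>" if \<gamma>: "\<gamma> \<in> SL2Z" and \<delta>: "\<delta> \<in> SL2Z"
    and eq: "\<gamma>$2$1 mod int N = \<delta>$2$1 mod int N" "\<gamma>$2$2 mod int N = \<delta>$2$2 mod int N" for \<gamma> \<delta>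
  proof -
    obtain \<gamma>' where \<gamma>': "\<gamma>' \<in> SL2Z" "\<gamma>' ** \<gamma> = mat2 1 0 0 1" "\<gamma>' = mat2 (\<gamma>$2$2) (- \<gamma>$1$2) (- \<gamma>$2$1) (\<gamma>$1$1)"
      using SL2Z_inverse[OF \<gamma>] by metis
    define \<rho> where "\<rho> = \<delta> ** \<gamma>'"
    have \<rho>SL: "\<rho> \<in> SL2Z" using SL2Z_mult[OF \<delta> \<gamma>'(1)] by (simp add: \<rho>_def)
    have "\<rho> ** \<gamma> = \<delta> ** mat2 1 0 0 1" by (simp add: \<rho>_def matrix_mul_assoc[symmetric] \<gamma>'(2))
    also have "\<dots> = \<delta>" by (rule mat_2_eqI) (simp_all add: matrix_mult_2_nth)
    finally have \<rho>\<gamma>: "\<rho> ** \<gamma> = \<delta>" .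
    obtain k l where kl: "\<delta>$2$1 = \<gamma>$2$1 + int N * k" "\<delta>$2$2 = \<gamma>$2$2 + int N * l"
    proof -
      have "int N dvd \<delta>$2$1 - \<gamma>$2$1" "int N dvd \<delta>$2$2 - \<gamma>$2$2"
        using eq by (metis mod_eq_dvd_iff)+
      then obtain k l where "\<delta>$2$1 - \<gamma>$2$1 = int N * k" "\<delta>$2$2 - \<gamma>$2$2 = int N * l" by (auto elim!: dvdE)
      then show ?thesis using that[of k l] by (simp add: algebra_simps)
    qed
    have r21: "\<rho>$2$1 = int N * (k * \<gamma>$2$2 - l * \<gamma>$2$1)"
      by (simp add: \<rho>_def \<gamma>'(3) matrix_mult_2_nth kl algebra_simps)
    have "\<rho>$2$2 = (\<gamma>$1$1 * \<gamma>$2$2 - \<gamma>$1$2 * \<gamma>$2$1) + int N * (l * \<gamma>$1$1 - k * \<gamma>$1$2)"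
      by (simp add: \<rho>_def \<gamma>'(3) matrix_mult_2_nth kl algebra_simps)
    then have r22: "\<rho>$2$2 = 1 + int N * (l * \<gamma>$1$1 - k * \<gamma>$1$2)" unfolding SL2Z_det[OF \<gamma>] .
    define x y where "x = k * \<gamma>$2$2 - l * \<gamma>$2$1" and "y = l * \<gamma>$1$1 - k * \<gamma>$1$2"
    have "\<rho>$1$1 * (1 + int N * y) - \<rho>$1$2 * (int N * x) = 1"
      using SL2Z_det[OF \<rho>SL] unfolding r21 r22 x_def y_def .
    then have "\<rho>$1$1 - 1 = int N * (\<rho>$1$2 * x - \<rho>$1$1 * y)" by (simp add: algebra_simps)
    then have "\<rho> \<in> Gamma1 N"
      using \<rho>SL r21 r22 unfolding Gamma1_def by (auto simp: mod_eq_dvd_iff)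
    then have "u (moebius_act \<delta> t) = u (moebius_act \<gamma> t)" if "Im t > 0" for t
      using inv[of \<rho> "moebius_act \<gamma> t"] moebius_act_mult[OF \<rho>SL \<gamma> that] \<rho>\<gamma> Im_moebius_act_pos[OF \<gamma> that] by simp
    then show ?thesis by (auto simp: tr_def fun_eq_iff)
  qed
  have "finite W"
  proof -
    define b where "b \<gamma> = (\<gamma>$2$1 mod int N, \<gamma>$2$2 mod int N)" for \<gamma> :: "int^2^2"
    have "b ` SL2Z \<subseteq> {0..<int N} \<times> {0..<int N}" using N by (auto simp: b_def)
    then have "finite (b ` SL2Z)" by (rule finite_subset) auto
    moreover have "W \<subseteq> (\<lambda>p. tr (SOME \<gamma>. \<gamma> \<in> SL2Z \<and> b \<gamma> = p)) ` (b ` SL2Z)"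
    proof
      fix w assume "w \<in> W"
      then obtain \<gamma> where \<gamma>: "\<gamma> \<in> SL2Z" "w = tr \<gamma>" by (auto simp: W_def)
      define \<delta> where "\<delta> = (SOME \<delta>. \<delta> \<in> SL2Z \<and> b \<delta> = b \<gamma>)"
      have "\<delta> \<in> SL2Z \<and> b \<delta> = b \<gamma>" unfolding \<delta>_def by (rule someI[of _ \<gamma>]) (use \<gamma> in auto)
      then have "w = tr \<delta>" using same[OF \<gamma>(1), of \<delta>] \<gamma>(2) by (auto simp: b_def)
      then show "w \<in> (\<lambda>p. tr (SOME \<gamma>. \<gamma> \<in> SL2Z \<and> b \<gamma> = p)) ` (b ` SL2Z)"
        using \<gamma>(1) unfolding \<delta>_def by blast
    qed
    ultimately show ?thesis using finite_subset by blast
  qed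
  define v where "v t = (\<Prod>w\<in>W. w t)" for t
  have holw: "w holomorphic_on {\<tau>. Im \<tau> > 0}" if w: "w \<in> W" for w
  proof -
    obtain \<gamma> where \<gamma>: "\<gamma> \<in> SL2Z" "w = tr \<gamma>" using w unfolding W_def by blast
    have "(u \<circ> moebius_act \<gamma>) holomorphic_on {\<tau>. Im \<tau> > 0}"
      by (rule holomorphic_on_compose_gen[OF holomorphic_moebius_act[OF \<gamma>(1)] hol]) (use Im_moebius_act_pos[OF \<gamma>(1)] in auto)
    then show ?thesis by (rule holomorphic_transform) (auto simp: \<gamma> tr_def)
  qed
  have holv: "v holomorphic_on {\<tau>. Im \<tau> > 0}"
    unfolding v_def[abs_def] using holw by (intro holomorphic_intros)
  have invv: "v (moebius_act \<delta> t) = v t" if \<delta>: "\<delta> \<in> SL2Z" and t: "Im t > 0" for \<delta> t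
  proof -
    define h where "h w = (\<lambda>t. if Im t > 0 then w (moebius_act \<delta> t) else 0)" for w :: "complex \<Rightarrow> complex"
    have htr: "h (tr \<gamma>) = tr (\<gamma> ** \<delta>)" if "\<gamma> \<in> SL2Z" for \<gamma>
      using moebius_act_mult[OF that \<delta>] Im_moebius_act_pos[OF \<delta>] by (auto simp: h_def tr_def fun_eq_iff)
    have sub: "h ` W \<subseteq> W" using htr SL2Z_mult[OF _ \<delta>] by (auto simp: W_def)
    have inj: "inj_on h W"
    proof (rule inj_onI)
      fix w w' assume w: "w \<in> W" "w' \<in> W" and eq: "h w = h w'"
      have "w t = w' t" for t
      proof (cases "Im t > 0")
        case True
        then obtain t' where "Im t' > 0" "moebius_act \<delta> t' = t" using moebius_act_surj[OF \<delta>] by metis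
        then show ?thesis using fun_cong[OF eq, of t'] by (simp add: h_def)
      next
        case False
        then show ?thesis using w by (auto simp: W_def tr_def)
      qed
      then show "w = w'" by auto
    qed
    have "v t = (\<Prod>w\<in>h ` W. w t)"
      unfolding v_def using endo_inj_surj[OF \<open>finite W\<close> sub inj] by simp
    also have "\<dots> = (\<Prod>w\<in>W. h w t)" by (simp add: prod.reindex[OF inj])
    also have "\<dots> = v (moebius_act \<delta> t)" using t by (simp add: h_def v_def)
    finally show ?thesis ..
  qed
  have bdtr: "bounded_at_ii_inf w" if "w \<in> W" for w
    using that bd unfolding W_def bounded_at_ii_inf_def by (auto simp: tr_def)
  have "vanishes_at_ii_inf (tr \<gamma>0)"
    using van(2) unfolding vanishes_at_ii_inf_def tr_def by auto
  then have "vanishes_at_ii_inf (\<lambda>t. tr \<gamma>0 t * (\<Prod>w\<in>W - {tr \<gamma>0}. w t))"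
    by (rule vanishes_mult_bounded) (rule bounded_at_ii_inf_prod, use bdtr in auto)
  moreover have "(\<lambda>t. tr \<gamma>0 t * (\<Prod>w\<in>W - {tr \<gamma>0}. w t)) = v"
  proof
    have "tr \<gamma>0 \<in> W" using van(1) by (simp add: W_def)
    then show "tr \<gamma>0 t * (\<Prod>w\<in>W - {tr \<gamma>0}. w t) = v t" for t
      unfolding v_def using prod.remove[OF \<open>finite W\<close>, of "tr \<gamma>0" "\<lambda>w. w t"] by simp
  qed
  ultimately have "vanishes_at_ii_inf v" by simp
  then have "v t = 0" if "Im t > 0" for t
    using level_one_zero[OF holv invv _ that] by blast
  then have "\<exists>w\<in>W. \<forall>z\<in>{\<tau>. Im \<tau> > 0}. w z = 0"
    using holomorphic_prod_eq_0[OF \<open>finite W\<close> uhp_open uhp_connected, of "\<lambda>w. w"] holw \<tau>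
    by (auto simp: v_def)
  then obtain \<gamma> where \<gamma>: "\<gamma> \<in> SL2Z" "\<And>t. Im t > 0 \<Longrightarrow> u (moebius_act \<gamma> t) = 0"
    by (auto simp: W_def tr_def)
  obtain t where "Im t > 0" "moebius_act \<gamma> t = \<tau>" using moebius_act_surj[OF \<gamma>(1) \<tau>] .
  then show ?thesis using \<gamma>(2) by auto
qed

section \<open>Cusp widths and differentials\<close>

lemma translation_eq: "translation h = mat2 1 (int h) 0 1"
  by (rule mat_2_eqI) (simp_all add: translation_def)

text \<open>The conjugate \<open>\<gamma> T\<^sup>h \<gamma>\<^sup>-\<^sup>1\<close> has diagonal \<open>1 \<mp> ach\<close> and lower left entry \<open>-c\<^sup>2h\<close>.\<close>

lemma cusp_width_witness:
  assumes \<gamma>: "\<gamma> \<in> SL2Z" and h: "int N dvd \<gamma>$2$1 * int h"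
  shows "\<exists>\<delta>\<in>Gamma1 N. \<gamma> ** translation h = \<delta> ** \<gamma>"
proof -
  define a b c d where "a = \<gamma>$1$1" and "b = \<gamma>$1$2" and "c = \<gamma>$2$1" and "d = \<gamma>$2$2"
  have det: "a * d - b * c = 1" using SL2Z_det[OF \<gamma>] by (simp add: a_def b_def c_def d_def)
  define \<delta> where "\<delta> = mat2 (1 - a * (c * int h)) (a * a * int h) (- (c * (c * int h))) (1 + a * (c * int h))"
  have 1: "(1 - a * (c * int h)) * (1 + a * (c * int h)) - (a * a * int h) * (- (c * (c * int h))) = 1"
    by (simp add: algebra_simps)
  have 2: "int N dvd a * (c * int h)" "int N dvd c * (c * int h)"
    using h unfolding c_def by simp_all
  have \<delta>: "\<delta> \<in> Gamma1 N"
    unfolding \<delta>_def mat2_Gamma1 using 1 2 by (simp add: mod_eq_dvd_iff)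
  have "\<delta> ** \<gamma> = \<gamma> ** translation h"
  proof (rule mat_2_eqI)
    show "(\<delta> ** \<gamma>)$1$1 = (\<gamma> ** translation h)$1$1" "(\<delta> ** \<gamma>)$2$1 = (\<gamma> ** translation h)$2$1"
      by (simp_all add: translation_eq matrix_mult_2_nth \<delta>_def a_def c_def algebra_simps)
    have "(\<delta> ** \<gamma>)$1$2 = b + a * int h * (a * d - b * c)"
      by (simp add: matrix_mult_2_nth \<delta>_def b_def d_def algebra_simps)
    then show "(\<delta> ** \<gamma>)$1$2 = (\<gamma> ** translation h)$1$2"
      unfolding det by (simp add: translation_eq matrix_mult_2_nth a_def b_def)
    have "(\<delta> ** \<gamma>)$2$2 = d + c * int h * (a * d - b * c)"
      by (simp add: matrix_mult_2_nth \<delta>_def b_def d_def algebra_simps)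
    then show "(\<delta> ** \<gamma>)$2$2 = (\<gamma> ** translation h)$2$2"
      unfolding det by (simp add: translation_eq matrix_mult_2_nth c_def d_def)
  qed
  with \<delta> show ?thesis by metis
qed

lemma cusp_width_le:
  assumes \<gamma>: "\<gamma> \<in> SL2Z" and h: "int N dvd \<gamma>$2$1 * int h" "h > 0"
  shows "cusp_width (Gamma1 N) \<gamma> \<le> h"
  unfolding cusp_width_def using cusp_width_witness[OF \<gamma> h(1)] h(2) by (intro Least_le) blast

lemma cusp_width:
  assumes N: "N > 0" and \<gamma>: "\<gamma> \<in> SL2Z"
  defines "w \<equiv> cusp_width (Gamma1 N) \<gamma>"
  obtains \<delta> where "w > 0" "\<delta> \<in> Gamma1 N" "\<gamma> ** translation w = \<delta> ** \<gamma> \<or> \<gamma> ** translation w = - (\<delta> ** \<gamma>)"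
proof -
  have "\<exists>\<delta>\<in>Gamma1 N. \<gamma> ** translation N = \<delta> ** \<gamma>" by (rule cusp_width_witness[OF \<gamma>]) simp
  then have "N > 0 \<and> (\<exists>\<delta>\<in>Gamma1 N. \<gamma> ** translation N = \<delta> ** \<gamma> \<or> \<gamma> ** translation N = - (\<delta> ** \<gamma>))"
    using N by blast
  from LeastI[of "\<lambda>h. h > 0 \<and> (\<exists>\<delta>\<in>Gamma1 N. \<gamma> ** translation h = \<delta> ** \<gamma> \<or> \<gamma> ** translation h = - (\<delta> ** \<gamma>))", OF this]
  show ?thesis using that unfolding w_def cusp_width_def by blast
qed

lemma DERIV_cusp_chart:
  "(cusp_chart h has_field_derivative cusp_chart h \<tau> * (2 * of_real pi * \<i> / of_nat h)) (at \<tau>)"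
  unfolding cusp_chart_def[abs_def] divide_inverse by (auto intro!: derivative_eq_intros)

lemma deriv_cusp_chart: "deriv (cusp_chart h) \<tau> = cusp_chart h \<tau> * (2 * of_real pi * \<i> / of_nat h)"
  by (rule DERIV_imp_deriv[OF DERIV_cusp_chart])

lemma norm_cusp_chart: "norm (cusp_chart h \<tau>) = exp (- 2 * pi * Im \<tau> / real h)"
  by (simp add: cusp_chart_def norm_exp_eq_Re Re_divide_of_nat)

text \<open>Differentials vanish at every cusp at least to the order of the local parameter.\<close>

lemma X1_differential_decay:
  assumes N: "N > 0" and f: "f \<in> X1_differentials N" and \<gamma>: "\<gamma> \<in> SL2Z"
  defines "w \<equiv> cusp_width (Gamma1 N) \<gamma>"
  obtains B C where "B > 0" "C > 0"
    "\<And>\<tau>. Im \<tau> \<ge> B \<Longrightarrow> norm (slash 2 \<gamma> f \<tau>) \<le> C * exp (- 2 * pi * Im \<tau> / real w)"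
proof -
  have w: "w > 0" using cusp_width[OF N \<gamma>] unfolding w_def by blast
  obtain g where g: "g holomorphic_on ball 0 1"
    "\<And>\<tau>. Im \<tau> > 0 \<Longrightarrow> slash 2 \<gamma> f \<tau> = g (cusp_chart w \<tau>) * deriv (cusp_chart w) \<tau>"
    using f \<gamma> slash_2_eq[OF \<gamma>] unfolding X1_differentials_def w_def by auto
  have "continuous_on (cball 0 (1/2)) g"
    by (rule continuous_on_subset[OF holomorphic_on_imp_continuous_on[OF g(1)]]) auto
  then have "bounded (g ` cball 0 (1/2))"
    using compact_continuous_image compact_imp_bounded compact_cball by blast
  then obtain C where C: "C > 0" "\<And>z. z \<in> cball 0 (1/2) \<Longrightarrow> norm (g z) \<le> C"
    by (auto simp: bounded_pos)
  have "norm (slash 2 \<gamma> f \<tau>) \<le> (C * (2 * pi / real w)) * exp (- 2 * pi * Im \<tau> / real w)" if \<tau>: "Im \<tau> \<ge> real w" for \<tau>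
  proof -
    have pos: "Im \<tau> > 0" using \<tau> w by linarith
    have "1 \<le> Im \<tau> / real w" using \<tau> w by (simp add: field_simps)
    then have "2 * 1 \<le> 2 * pi * (Im \<tau> / real w)" using pi_gt3 by (intro mult_mono) auto
    then have "exp (- 2 * pi * Im \<tau> / real w) \<le> exp (- ln 2)" using ln_2_less_1 by simp
    then have "cusp_chart w \<tau> \<in> cball 0 (1/2)" by (simp add: norm_cusp_chart exp_minus)
    then have "norm (g (cusp_chart w \<tau>)) \<le> C" by (rule C)
    then have "norm (g (cusp_chart w \<tau>)) * (exp (- 2 * pi * Im \<tau> / real w) * (2 * pi / real w)) \<le> C * (exp (- 2 * pi * Im \<tau> / real w) * (2 * pi / real w))"
      by (rule mult_right_mono) (use w in auto)
    then show ?thesis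
      unfolding g(2)[OF pos] deriv_cusp_chart norm_mult norm_divide norm_cusp_chart by (simp add: mult_ac)
  qed
  then show ?thesis using that[of "real w" "C * (2 * pi / real w)"] w C(1) by simp
qed

text \<open>Vanishing of all differentials, from a product of Klein forms of weight \<open>2\<close> whose order at each
  cusp is at most \<open>1\<close> in the local parameter, and less than \<open>1\<close> at some cusp: the quotient of a
  differential by the product is bounded and vanishes at that cusp.\<close>

theorem X1_differentials_zero:
  assumes N: "N > 0" and J: "finite J" "\<And>j. j \<in> J \<Longrightarrow> \<not> N dvd j"
    and wt: "12 * s - (\<Sum>j\<in>J. e j) = 2" and tm: "trivial_multiplier N J e"
    and ord: "\<And>g A. g > 0 \<Longrightarrow> g dvd int N \<Longrightarrow> coprime A g \<Longrightarrow> cusp_ord s J e g A \<le> 2 * g"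
    and ord0: "g0 > 0" "g0 dvd int N" "coprime A0 g0" "cusp_ord s J e g0 A0 < 2 * g0"
    and f: "f \<in> X1_differentials N" and \<tau>: "Im \<tau> > 0"
  shows "f \<tau> = 0"
proof -
  define h where "h = klein_prod N (12 * s) J e"
  have wt': "12 * s - (\<Sum>j\<in>J. e j) = int 2" using wt by simp
  have hso: "has_order (slash 2 \<gamma> h) (of_int (cusp_ord s J e (gcd (\<gamma>$2$1) (int N)) (\<gamma>$1$1)) / (2 * real N))"
    if "\<gamma> \<in> SL2Z" for \<gamma>
    unfolding h_def using J by (intro has_order_slash_klein_prod[OF N _ _ wt' that])
  have hnz: "h t \<noteq> 0" if "Im t > 0" for t unfolding h_def using klein_prod_nonzero[OF N J that] .
  define u where "u t = f t / h t" for t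
  have fhol: "f holomorphic_on {\<tau>. Im \<tau> > 0}" using f by (simp add: X1_differentials_def upper_half_plane_def)
  have uhol: "u holomorphic_on {\<tau>. Im \<tau> > 0}"
    unfolding u_def using fhol holomorphic_klein_prod[OF N J] hnz by (intro holomorphic_intros) (auto simp: h_def)
  have us: "u (moebius_act \<gamma> t) = slash 2 \<gamma> f t / slash 2 \<gamma> h t" if "\<gamma> \<in> SL2Z" "Im t > 0" for \<gamma> t
    using aut_factor_nonzero[OF that] by (simp add: u_def slash_def)
  have fs: "slash 2 \<gamma> f t = f t" if "\<gamma> \<in> Gamma1 N" "Im t > 0" for \<gamma> t
    using f that slash_2_eq[OF Gamma1_SL2Z[OF that(1)] that(2), of f] by (auto simp: X1_differentials_def)
  have uinv: "u (moebius_act \<gamma> t) = u t" if "\<gamma> \<in> Gamma1 N" "Im t > 0" for \<gamma> t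
    using us[OF Gamma1_SL2Z[OF that(1)] that(2)] fs[OF that] slash_klein_prod_Gamma1[OF N J wt' tm that]
    by (simp add: u_def h_def)
  have decay: "\<exists>B K. K > 0 \<and> (\<forall>t. Im t > 0 \<longrightarrow> Im t \<ge> B \<longrightarrow> norm (u (moebius_act \<gamma> t)) \<le>
        K * exp (- (pi / real N) * (2 * of_int g - of_int (cusp_ord s J e g (\<gamma>$1$1))) * Im t))"
    if \<gamma>: "\<gamma> \<in> SL2Z" and g: "g = gcd (\<gamma>$2$1) (int N)" for \<gamma> g
  proof -
    define w where "w = cusp_width (Gamma1 N) \<gamma>"
    have gpos: "g > 0" using N g by simp
    obtain n where n: "int N = g * n" using g by (metis dvdE gcd_dvd2)
    have "g * n > 0" using N n[symmetric] by simp
    then have npos: "n > 0" using gpos by (simp add: zero_less_mult_iff)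
    have "int N dvd \<gamma>$2$1 * int (nat n)"
      using npos unfolding n by (simp add: g mult_dvd_mono)
    \<comment> \<open>the width is at most \<open>N / g\<close>, so \<open>f\<close> decays at least like \<open>\<bar>q\<bar>\<close> to the power \<open>g / N\<close>\<close>
    from cusp_width_le[OF \<gamma> this] have "w \<le> nat n" using npos by (simp add: w_def)
    then have wn: "real w \<le> of_int n" using npos by linarith
    have wpos: "w > 0" using cusp_width[OF N \<gamma>] unfolding w_def by blast
    have Nr: "real N = of_int g * of_int n"
      using arg_cong[OF n, of real_of_int] by simp
    obtain B C where B: "B > 0" "C > 0"
      "\<And>\<tau>. Im \<tau> \<ge> B \<Longrightarrow> norm (slash 2 \<gamma> f \<tau>) \<le> C * exp (- 2 * pi * Im \<tau> / real w)"
      using X1_differential_decay[OF N f \<gamma>] unfolding w_def by blast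
    define e' where "e' = of_int (cusp_ord s J e g (\<gamma>$1$1)) / (2 * real N)"
    obtain c C' B' where h: "c > 0" "C' > 0" "B' > 0"
      "\<And>t. Im t \<ge> B' \<Longrightarrow> c * exp (- 2 * pi * e' * Im t) \<le> norm (slash 2 \<gamma> h t)"
      "\<And>t. Im t \<ge> B' \<Longrightarrow> norm (slash 2 \<gamma> h t) \<le> C' * exp (- 2 * pi * e' * Im t)"
      using hso[OF \<gamma>] unfolding g[symmetric] e'_def[symmetric] by (rule has_orderE) blast
    have "norm (u (moebius_act \<gamma> t)) \<le> (C / c) * exp (- (pi / real N) * (2 * of_int g - of_int (cusp_ord s J e g (\<gamma>$1$1))) * Im t)"
      if t: "Im t > 0" "max B B' \<le> Im t" for t
    proof -
      have "norm (slash 2 \<gamma> f t) \<le> C * exp (- 2 * pi * Im t / real w)" using B t by auto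
      also have "\<dots> \<le> C * exp (- 2 * pi * Im t / of_int n)"
        using B(2) t(1) wn wpos by (intro mult_left_mono) (auto simp: frac_le)
      finally have 1: "norm (slash 2 \<gamma> f t) \<le> C * exp (- 2 * pi * Im t / of_int n)" .
      have 2: "c * exp (- 2 * pi * e' * Im t) \<le> norm (slash 2 \<gamma> h t)" using h t by auto
      have pos: "0 < c * exp (- 2 * pi * e' * Im t)" using h(1) by simp
      have "norm (u (moebius_act \<gamma> t)) = norm (slash 2 \<gamma> f t) / norm (slash 2 \<gamma> h t)"
        by (simp add: us[OF \<gamma> t(1)] norm_divide)
      also have "\<dots> \<le> (C * exp (- 2 * pi * Im t / of_int n)) / (c * exp (- 2 * pi * e' * Im t))"
        using 1 2 pos B(2) by (intro frac_le) auto
      also have "\<dots> = (C / c) * exp (- 2 * pi * Im t / of_int n - (- 2 * pi * e' * Im t))"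
        unfolding exp_diff by simp
      also have "- 2 * pi * Im t / of_int n - (- 2 * pi * e' * Im t) = - (pi / real N) * (2 * of_int g - of_int (cusp_ord s J e g (\<gamma>$1$1))) * Im t"
        unfolding e'_def Nr using gpos npos by (simp add: field_simps)
      finally show ?thesis .
    qed
    then show ?thesis using B(2) h(1) by (intro exI[of _ "max B B'"] exI[of _ "C / c"]) simp
  qed
  note cop = SL2Z_coprime_gcd[where n = "int N"]
  have ubd: "bounded_at_ii_inf (\<lambda>t. u (moebius_act \<gamma> t))" if \<gamma>: "\<gamma> \<in> SL2Z" for \<gamma>
  proof -
    define g where "g = gcd (\<gamma>$2$1) (int N)"
    define r where "r = (pi / real N) * (2 * of_int g - of_int (cusp_ord s J e g (\<gamma>$1$1)))"
    have "cusp_ord s J e g (\<gamma>$1$1) \<le> 2 * g" using ord cop[OF \<gamma>] N by (simp add: g_def)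
    then have "of_int (cusp_ord s J e g (\<gamma>$1$1)) \<le> (of_int (2 * g) :: real)" by (simp only: of_int_le_iff)
    then have r: "r \<ge> 0" using N by (simp add: r_def)
    obtain B K where K: "K > 0" "\<And>t. Im t > 0 \<Longrightarrow> Im t \<ge> B \<Longrightarrow> norm (u (moebius_act \<gamma> t)) \<le> K * exp (- r * Im t)"
      using decay[OF \<gamma> g_def] unfolding r_def by auto
    have "norm (u (moebius_act \<gamma> t)) \<le> K" if "Im t > 0" "Im t \<ge> B" for t
    proof -
      have "K * exp (- r * Im t) \<le> K * 1" using K(1) r that by (intro mult_left_mono) auto
      then show ?thesis using K(2)[OF that] by simp
    qed
    then show ?thesis unfolding bounded_at_ii_inf_def by blast
  qed
  obtain x y where xy: "x * A0 + y * g0 = 1" using bezout_int[of A0 g0] ord0(3) by auto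
  define \<gamma>0 where "\<gamma>0 = mat2 A0 (- y) g0 x"
  have \<gamma>0: "\<gamma>0 \<in> SL2Z" using xy by (simp add: \<gamma>0_def mult_ac)
  have "vanishes_at_ii_inf (\<lambda>t. u (moebius_act \<gamma>0 t))"
  proof -
    define r where "r = (pi / real N) * (2 * of_int g0 - of_int (cusp_ord s J e g0 A0))"
    have "of_int (cusp_ord s J e g0 A0) < (of_int (2 * g0) :: real)" using ord0(4) by (simp only: of_int_less_iff)
    then have r: "r > 0" using N by (simp add: r_def)
    have "g0 = gcd (\<gamma>0$2$1) (int N)" using ord0(1,2) by (simp add: \<gamma>0_def gcd_proj1_iff)
    from decay[OF \<gamma>0 this] obtain B K where K: "K > 0" "\<And>t. Im t > 0 \<Longrightarrow> Im t \<ge> B \<Longrightarrow> norm (u (moebius_act \<gamma>0 t)) \<le> K * exp (- r * Im t)"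
      by (auto simp: r_def \<gamma>0_def)
    from vanishes_at_ii_infI[OF r K] show ?thesis .
  qed
  from Gamma1_invariant_zero[OF N uhol uinv ubd \<gamma>0 this \<tau>] have "u \<tau> = 0" .
  then show ?thesis using hnz[OF \<tau>] by (simp add: u_def)
qed

text \<open>A periodic function that vanishes at \<open>\<i>\<infinity>\<close> is a holomorphic differential on the disc.\<close>

lemma periodic_imp_differential:
  assumes w: "w > 0" and hol: "p holomorphic_on {\<tau>. Im \<tau> > 0}"
    and per: "\<And>\<tau>. Im \<tau> > 0 \<Longrightarrow> p (\<tau> + of_nat w) = p \<tau>" and van: "vanishes_at_ii_inf p"
  obtains g where "g holomorphic_on ball 0 1"
    "\<And>\<tau>. Im \<tau> > 0 \<Longrightarrow> p \<tau> = g (cusp_chart w \<tau>) * deriv (cusp_chart w) \<tau>"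
proof -
  define k where "k = 2 * of_real pi * \<i> / (of_nat w :: complex)"
  have k0: "k \<noteq> 0" using w by (simp add: k_def)
  have chart: "cusp_chart w \<tau> = exp (k * \<tau>)" for \<tau> by (simp add: cusp_chart_def k_def mult_ac)
  have Im_div: "Im (z / k) = - (real w * Re z) / (2 * pi)" for z
    using w by (simp add: k_def Im_divide power2_eq_square field_simps)
  have per_int: "p (\<tau> + of_int n * of_nat w) = p \<tau>" if "Im \<tau> > 0" for \<tau> n
  proof -
    define p' where "p' \<tau> = (if Im \<tau> > 0 then p \<tau> else 0)" for \<tau>
    have "p' (z + of_nat w) = p' z" for z using per by (simp add: p'_def)
    from periodic_of_int[of p' "of_nat w", OF this, of \<tau> n] show ?thesis using that by (simp add: p'_def)
  qed
  define G where "G z = (if z = 0 then 0 else p (Ln z / k))" for z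
  have Gchart: "G (exp (k * \<tau>)) = p \<tau>" if \<tau>: "Im \<tau> > 0" for \<tau>
  proof -
    obtain n :: int where "k * \<tau> = Ln (exp (k * \<tau>)) + of_int n * (2 * of_real pi * \<i>)"
      using exp_Ln[of "exp (k * \<tau>)"] exp_eq[of "k * \<tau>" "Ln (exp (k * \<tau>))"] by (auto simp: mult_ac)
    then have "Ln (exp (k * \<tau>)) = k * (\<tau> + of_int (- n) * of_nat w)"
      using w by (simp add: k_def field_simps)
    then have "Ln (exp (k * \<tau>)) / k = \<tau> + of_int (- n) * of_nat w" using k0 by simp
    then show ?thesis using per_int[OF \<tau>, of "- n"] by (simp add: G_def)
  qed
  have op: "open (ball 0 1 - {0 :: complex})" by auto
  have "G field_differentiable (at z0)" if z0: "z0 \<in> ball 0 1 - {0}" for z0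
  proof -
    define \<tau>0 where "\<tau>0 = Ln z0 / k"
    have z00: "z0 \<noteq> 0" using z0 by simp
    have \<tau>0: "Im \<tau>0 > 0" "exp (k * \<tau>0) = z0"
      using z0 w k0 by (auto simp: \<tau>0_def Im_div divide_less_0_iff mult_less_0_iff)
    \<comment> \<open>a branch of the inverse of the chart near \<open>z0\<close>; by periodicity \<open>G\<close> does not depend on the branch\<close>
    define l where "l z = \<tau>0 + Ln (z / z0) / k" for z
    have lz0: "l z0 = \<tau>0" using z00 by (simp add: l_def)
    have dl: "l field_differentiable (at z0)"
      unfolding l_def using z00 k0
      by (auto simp: field_differentiable_def complex_nonpos_Reals_iff intro!: derivative_eq_intros exI)
    have "p field_differentiable (at (l z0))"
      unfolding lz0 using holomorphic_on_imp_differentiable_at[OF hol uhp_open] \<tau>0 by simp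
    from field_differentiable_compose[OF dl this]
    have 1: "(p \<circ> l) field_differentiable (at z0)" .
    have "isCont l z0" using dl by (rule field_differentiable_imp_continuous_at)
    then have "((\<lambda>z. Im (l z)) \<longlongrightarrow> Im (l z0)) (at z0)" unfolding isCont_def by (rule tendsto_Im)
    then have "eventually (\<lambda>z. Im (l z) > 0) (at z0)" by (rule order_tendstoD) (use lz0 \<tau>0 in simp)
    then have "eventually (\<lambda>z. Im (l z) > 0) (nhds z0)" using lz0 \<tau>0 by (simp add: eventually_nhds_conv_at)
    moreover have "eventually (\<lambda>z. z \<noteq> 0) (nhds z0)" using z00 by (rule t1_space_nhds)
    ultimately have "eventually (\<lambda>z. (p \<circ> l) z = G z) (nhds z0)"
    proof eventually_elim
      case (elim z)
      have "exp (k * l z) = z" using elim(2) z00 k0 \<tau>0(2) by (simp add: l_def ring_distribs exp_add)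
      then show ?case using Gchart[OF elim(1)] by simp
    qed
    then show ?thesis using 1 by (metis field_differentiable_def DERIV_cong_ev)
  qed
  then have G1: "G holomorphic_on (ball 0 1 - {0})"
    by (simp add: holomorphic_on_def field_differentiable_at_within)
  have G0: "(G \<longlongrightarrow> G 0) (at 0)"
    unfolding LIM_eq
  proof (intro allI impI)
    fix \<epsilon> :: real assume "\<epsilon> > 0"
    then obtain B where B: "\<And>\<tau>. Im \<tau> > 0 \<Longrightarrow> Im \<tau> \<ge> B \<Longrightarrow> norm (p \<tau>) < \<epsilon>"
      using van unfolding vanishes_at_ii_inf_def by blast
    define \<delta> where "\<delta> = min (1/2) (exp (- (2 * pi * B / real w)))"
    have "norm (G z) < \<epsilon>" if z: "z \<noteq> 0" "norm z < \<delta>" for z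
    proof -
      have nz: "norm z > 0" using z by simp
      have "norm z < exp (- (2 * pi * B / real w))" "norm z < 1" using z by (auto simp: \<delta>_def)
      then have "ln (norm z) < - (2 * pi * B / real w)" "ln (norm z) < 0"
        using nz by (metis exp_less_cancel_iff exp_ln) (use nz \<open>norm z < 1\<close> in simp)
      then have "Im (Ln z / k) \<ge> B" "Im (Ln z / k) > 0"
        using w z(1) by (auto simp: Im_div field_simps mult_less_0_iff)
      then show ?thesis using B z(1) by (simp add: G_def)
    qed
    moreover have "\<delta> > 0" by (simp add: \<delta>_def)
    ultimately show "\<exists>s>0. \<forall>x. x \<noteq> 0 \<and> norm (x - 0) < s \<longrightarrow> norm (G x - G 0) < \<epsilon>"
      by (intro exI[of _ \<delta>]) (auto simp: G_def[of 0])
  qed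
  have Ghol: "G holomorphic_on ball 0 1"
    by (rule no_isolated_singularity'[where K = "{0}"]) (use G0 G1 in \<open>auto intro: tendsto_within_subset\<close>)
  define g where "g z = (if z = 0 then deriv G 0 else G z / z) / k" for z
  have "(\<lambda>z. if z = 0 then deriv G 0 else G z / z) holomorphic_on ball 0 1"
    by (rule pole_theorem_open_0[OF Ghol, of 0]) (auto simp: G_def)
  then have "g holomorphic_on ball 0 1" unfolding g_def using k0 by (intro holomorphic_intros) auto
  moreover have "p \<tau> = g (cusp_chart w \<tau>) * deriv (cusp_chart w) \<tau>" if "Im \<tau> > 0" for \<tau>
    using Gchart[OF that] k0 unfolding deriv_cusp_chart k_def[symmetric] by (simp add: g_def chart)
  ultimately show ?thesis using that by blast
qed

text \<open>A weight-\<open>2\<close> cusp form is a holomorphic differential. Only the invariance of \<open>f|\<gamma>\<close> under translation by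
  the cusp width is used, not the value of the width.\<close>

lemma cusp_form_imp_X1_differential:
  assumes N: "N > 0" and hol: "f holomorphic_on {\<tau>. Im \<tau> > 0}"
    and inv: "\<And>\<gamma> \<tau>. \<gamma> \<in> Gamma1 N \<Longrightarrow> Im \<tau> > 0 \<Longrightarrow> slash 2 \<gamma> f \<tau> = f \<tau>"
    and van: "\<And>\<gamma>. \<gamma> \<in> SL2Z \<Longrightarrow> vanishes_at_ii_inf (slash 2 \<gamma> f)"
  shows "f \<in> X1_differentials N"
proof -
  have "\<exists>g. g holomorphic_on ball 0 1 \<and> (\<forall>\<tau>\<in>upper_half_plane. f (moebius_act \<gamma> \<tau>) * deriv (moebius_act \<gamma>) \<tau> =
             g (cusp_chart (cusp_width (Gamma1 N) \<gamma>) \<tau>) * deriv (cusp_chart (cusp_width (Gamma1 N) \<gamma>)) \<tau>)"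
    if \<gamma>: "\<gamma> \<in> SL2Z" for \<gamma>
  proof -
    define w where "w = cusp_width (Gamma1 N) \<gamma>"
    obtain \<delta> where \<delta>: "w > 0" "\<delta> \<in> Gamma1 N" "\<gamma> ** translation w = \<delta> ** \<gamma> \<or> \<gamma> ** translation w = - (\<delta> ** \<gamma>)"
      using cusp_width[OF N \<gamma>] unfolding w_def by blast
    have tS: "translation w \<in> SL2Z" by (simp add: translation_eq)
    have per: "slash 2 \<gamma> f (\<tau> + of_nat w) = slash 2 \<gamma> f \<tau>" if \<tau>: "Im \<tau> > 0" for \<tau>
    proof -
      have T: "moebius_act (translation w) \<tau> = \<tau> + of_nat w" "aut_factor (translation w) \<tau> = 1"
        by (simp_all add: translation_eq moebius_act_def aut_factor_def)
      have neg: "moebius_act (- M) \<tau> = moebius_act M \<tau>" "aut_factor (- M) \<tau> = - aut_factor M \<tau>" for M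
      proof -
        show a: "aut_factor (- M) \<tau> = - aut_factor M \<tau>" by (simp add: aut_factor_def)
        have num: "of_int ((- M)$1$1) * \<tau> + of_int ((- M)$1$2) = - (of_int (M$1$1) * \<tau> + of_int (M$1$2))" by simp
        show "moebius_act (- M) \<tau> = moebius_act M \<tau>" unfolding moebius_act_def a num minus_divide_divide ..
      qed
      have m: "moebius_act \<gamma> (\<tau> + of_nat w) = moebius_act \<delta> (moebius_act \<gamma> \<tau>)"
        using \<delta>(3) neg(1) moebius_act_mult[OF \<gamma> tS \<tau>] moebius_act_mult[OF Gamma1_SL2Z[OF \<delta>(2)] \<gamma> \<tau>] T by auto
      have "aut_factor \<gamma> (\<tau> + of_nat w) = aut_factor (\<gamma> ** translation w) \<tau>"
        using aut_factor_mult[OF tS \<tau>, of \<gamma>] T by simp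
      also have "\<dots> ^ 2 = aut_factor (\<delta> ** \<gamma>) \<tau> ^ 2"
        using \<delta>(3) by (auto simp: neg(2))
      finally have a: "aut_factor \<gamma> (\<tau> + of_nat w) ^ 2 = (aut_factor \<delta> (moebius_act \<gamma> \<tau>) * aut_factor \<gamma> \<tau>) ^ 2"
        unfolding aut_factor_mult[OF \<gamma> \<tau>] .
      have "slash 2 \<gamma> f (\<tau> + of_nat w) = slash 2 \<delta> f (moebius_act \<gamma> \<tau>) / aut_factor \<gamma> \<tau> ^ 2"
        unfolding slash_def m a by (simp add: power_mult_distrib)
      also have "\<dots> = slash 2 \<gamma> f \<tau>"
        using inv[OF \<delta>(2) Im_moebius_act_pos[OF \<gamma> \<tau>]] by (simp add: slash_def)
      finally show ?thesis .
    qed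
    have "slash 2 \<gamma> f holomorphic_on {\<tau>. Im \<tau> > 0}"
    proof -
      have "(f \<circ> moebius_act \<gamma>) holomorphic_on {\<tau>. Im \<tau> > 0}"
        by (rule holomorphic_on_compose_gen[OF holomorphic_moebius_act[OF \<gamma>] hol]) (use Im_moebius_act_pos[OF \<gamma>] in auto)
      then have 1: "(\<lambda>\<tau>. f (moebius_act \<gamma> \<tau>)) holomorphic_on {\<tau>. Im \<tau> > 0}" by (simp add: o_def)
      show ?thesis unfolding slash_def[abs_def]
        using aut_factor_nonzero[OF \<gamma>] by (intro holomorphic_intros 1) (auto simp: aut_factor_def[abs_def] intro!: holomorphic_intros)
    qed
    from periodic_imp_differential[OF \<delta>(1) this per van[OF \<gamma>]]
    obtain g where "g holomorphic_on ball 0 1"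
      "\<And>\<tau>. Im \<tau> > 0 \<Longrightarrow> slash 2 \<gamma> f \<tau> = g (cusp_chart w \<tau>) * deriv (cusp_chart w) \<tau>" by blast
    then show ?thesis using slash_2_eq[OF \<gamma>] unfolding w_def by auto
  qed
  then show ?thesis
    unfolding X1_differentials_def
    using hol inv slash_2_eq[OF Gamma1_SL2Z] by (auto simp: upper_half_plane_def)
qed

lemma has_order_vanishes:
  assumes "has_order f e" "e > 0"
  shows "vanishes_at_ii_inf f"
proof -
  from assms(1) obtain c C B where *: "c > 0" "C > 0" "B > 0"
    "\<And>\<tau>. Im \<tau> \<ge> B \<Longrightarrow> c * exp (- 2 * pi * e * Im \<tau>) \<le> norm (f \<tau>)"
    "\<And>\<tau>. Im \<tau> \<ge> B \<Longrightarrow> norm (f \<tau>) \<le> C * exp (- 2 * pi * e * Im \<tau>)" by (rule has_orderE) blast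
  show ?thesis
    by (rule vanishes_at_ii_infI[of "2 * pi * e" C B]) (use * assms(2) in simp_all)
qed

text \<open>A product of weight \<open>2\<close> with positive orders at all cusps is a cusp form, on its own level and on all
  multiples of it.\<close>

theorem X1_differential_exists:
  assumes N: "N > 0" and J: "finite J" "\<And>j. j \<in> J \<Longrightarrow> \<not> N dvd j"
    and wt: "12 * s - (\<Sum>j\<in>J. e j) = 2" and tm: "trivial_multiplier N J e"
    and ord: "\<And>g A. g > 0 \<Longrightarrow> g dvd int N \<Longrightarrow> coprime A g \<Longrightarrow> cusp_ord s J e g A > 0"
    and M: "M > 0" "N dvd M"
  obtains f where "f \<in> X1_differentials M" "f \<i> \<noteq> 0"
proof (rule that)
  let ?f = "klein_prod N (12 * s) J e"
  have wt': "12 * s - (\<Sum>j\<in>J. e j) = int 2" using wt by simp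
  show "?f \<i> \<noteq> 0" using klein_prod_nonzero[OF N J] by simp
  have sub: "\<gamma> \<in> Gamma1 N" if "\<gamma> \<in> Gamma1 M" for \<gamma>
    using that M(2) unfolding Gamma1_def by (auto simp: mod_eq_dvd_iff intro: dvd_trans[of "int N" "int M"])
  show "?f \<in> X1_differentials M"
  proof (rule cusp_form_imp_X1_differential[OF M(1) holomorphic_klein_prod[OF N J]])
    show "slash 2 \<gamma> ?f \<tau> = ?f \<tau>" if "\<gamma> \<in> Gamma1 M" "Im \<tau> > 0" for \<gamma> \<tau>
      using slash_klein_prod_Gamma1[OF N J wt' tm sub[OF that(1)] that(2)] .
    fix \<gamma> assume \<gamma>: "\<gamma> \<in> SL2Z"
    have "coprime (\<gamma>$1$1) (gcd (\<gamma>$2$1) (int N))" by (rule SL2Z_coprime_gcd[OF \<gamma>])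
    then have "cusp_ord s J e (gcd (\<gamma>$2$1) (int N)) (\<gamma>$1$1) > 0" using N by (intro ord) auto
    then have "of_int (cusp_ord s J e (gcd (\<gamma>$2$1) (int N)) (\<gamma>$1$1)) / (2 * real N) > 0" using N by simp
    then show "vanishes_at_ii_inf (slash 2 \<gamma> ?f)"
      using J by (intro has_order_vanishes[OF has_order_slash_klein_prod[OF N _ _ wt' \<gamma>]])
  qed
qed

lemma X1_genus_eq_0_iff:
  "X1_genus N = 0 \<longleftrightarrow> (\<forall>f\<in>X1_differentials N. \<forall>\<tau>\<in>upper_half_plane. f \<tau> = 0)"
proof -
  define G where "G = {enat g | g. \<exists>\<omega> :: nat \<Rightarrow> complex \<Rightarrow> complex.
     (\<forall>i<g. \<omega> i \<in> X1_differentials N) \<and>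
     (\<forall>f\<in>X1_differentials N. \<exists>c :: nat \<Rightarrow> complex. \<forall>\<tau>\<in>upper_half_plane.
        f \<tau> = (\<Sum>i<g. c i * \<omega> i \<tau>))}"
  have "X1_genus N = Inf G" by (simp add: X1_genus_def G_def)
  moreover have "Inf G = 0 \<longleftrightarrow> 0 \<in> G"
  proof
    assume *: "Inf G = 0"
    then have "G \<noteq> {}" by (auto simp: Inf_enat_def)
    then have "Inf G \<in> G" unfolding Inf_enat_def using LeastI[of "\<lambda>x. x \<in> G"] by auto
    with * show "0 \<in> G" by simp
  next
    assume "0 \<in> G"
    then have "Inf G \<le> 0" by (rule Inf_lower)
    then show "Inf G = 0" by simp
  qed
  moreover have "0 \<in> G \<longleftrightarrow> (\<forall>f\<in>X1_differentials N. \<forall>\<tau>\<in>upper_half_plane. f \<tau> = 0)"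
    by (auto simp: G_def zero_enat_def)
  ultimately show ?thesis by simp
qed

section \<open>Exponent vectors as lists\<close>

text \<open>The extensional function \<open>{1..m} \<rightarrow> \<int>\<close> with the values \<open>a\<^sub>1, \<dots>, a\<^sub>m\<close>; with lists, the conditions
  for a given level become executable.\<close>

definition vec_of :: "int list \<Rightarrow> nat \<Rightarrow> int" where
  "vec_of as = (\<lambda>j\<in>{1..length as}. as ! (j - 1))"

text \<open>\<open>\<Sum> f(j) a\<^sub>j\<close>, with \<open>j\<close> counted from \<open>1\<close>.\<close>

definition weighted_sum :: "(int \<Rightarrow> int) \<Rightarrow> int list \<Rightarrow> int" where
  "weighted_sum f as = sum_list (map2 (\<lambda>j x. f (int j) * x) [1..<length as + 1] as)"

lemma sum_vec_of: "(\<Sum>j = 1..length as. f (int j) * vec_of as j) = weighted_sum f as"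
proof -
  have "(\<Sum>j = 1..length as. f (int j) * vec_of as j) = (\<Sum>i<length as. f (int (Suc i)) * as ! i)"
    by (rule sum.reindex_bij_witness[of _ Suc "\<lambda>j. j - 1"]) (auto simp: vec_of_def)
  also have "\<dots> = weighted_sum f as"
    unfolding weighted_sum_def sum_list_sum_nth by (rule sum.cong) (auto simp del: upt_Suc simp: atLeast0LessThan)
  finally show ?thesis .
qed

text \<open>The pairs \<open>(g, A)\<close> with \<open>g\<close> dividing \<open>N\<close> and \<open>A\<close> a residue prime to \<open>g\<close>; the orders at a cusp depend only on
  such a pair.\<close>

definition cusp_list :: "int \<Rightarrow> (int \<times> int) list" where
  "cusp_list N = [(g, A). g \<leftarrow> [1..N], g dvd N, A \<leftarrow> [0..g - 1], gcd A g = 1]"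

lemma all_cusps_iff:
  assumes N: "N > 0"
  shows "(\<forall>g A. g > 0 \<longrightarrow> g dvd N \<longrightarrow> coprime A g \<longrightarrow> P g (cusp_ord s J e g A)) \<longleftrightarrow>
    (\<forall>(g, A)\<in>set (cusp_list N). P g (cusp_ord s J e g A))"
proof
  assume *: "\<forall>(g, A)\<in>set (cusp_list N). P g (cusp_ord s J e g A)"
  show "\<forall>g A. g > 0 \<longrightarrow> g dvd N \<longrightarrow> coprime A g \<longrightarrow> P g (cusp_ord s J e g A)"
  proof (intro allI impI)
    fix g A :: int assume g: "g > 0" "g dvd N" "coprime A g"
    have "coprime (A mod g) g" using g(1,3) by (simp add: coprime_mod_left_iff)
    then have "gcd (A mod g) g = 1" by simp
    moreover have "g \<le> N" using g(2) N by (rule zdvd_imp_le)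
    ultimately have "(g, A mod g) \<in> set (cusp_list N)"
      using g by (auto simp: cusp_list_def)
    then have "P g (cusp_ord s J e g (A mod g))" using * by blast
    then show "P g (cusp_ord s J e g A)" unfolding cusp_ord_mod .
  qed
qed (auto simp: cusp_list_def coprime_iff_gcd_eq_1)

text \<open>The list version of \<open>cusp_ord\<close>.\<close>

definition ord_list :: "int \<Rightarrow> int list \<Rightarrow> int \<Rightarrow> int \<Rightarrow> int" where
  "ord_list s as g A = 2 * g\<^sup>2 * s - weighted_sum (\<lambda>j. (j * A mod g) * (g - j * A mod g)) as"

lemma cusp_ord_vec_of: "cusp_ord s {1..length as} (vec_of as) g A = ord_list s as g A"
  unfolding cusp_ord_def ord_list_def using sum_vec_of[of "\<lambda>j. (j * A mod g) * (g - j * A mod g)" as]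
  by (simp add: mult.commute)

lemma S2_vec_of:
  assumes "length as = N div 2"
  shows "S2 N (vec_of as) = weighted_sum (\<lambda>j. j * (int N - j)) as"
proof -
  have "S2 N (vec_of as) = (\<Sum>j = 1..length as. (int j * (int N - int j)) * vec_of as j)"
    unfolding S2_def assms by (rule sum.cong) (auto simp: of_nat_diff)
  then show ?thesis using sum_vec_of[of "\<lambda>j. j * (int N - j)" as] by simp
qed

lemma sum_vec_of_1: "(\<Sum>j = 1..length as. vec_of as j) = sum_list as"
proof -
  have "map2 (\<lambda>j x. 1 * x) [1..<length as + 1] as = as"
    by (rule nth_equalityI) (auto simp del: upt_Suc)
  then show ?thesis using sum_vec_of[of "\<lambda>_. 1" as] by (simp add: weighted_sum_def)
qed

section \<open>Levels of genus zero\<close>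

text \<open>The vector \<open>as\<close> defines a weight-\<open>2\<close> product, invariant under \<open>\<Gamma>\<^sub>1(N)\<close>, of order at most \<open>1\<close> in the local
  parameter at every cusp and less than \<open>1\<close> at some cusp.\<close>

definition zero_level :: "nat \<Rightarrow> int \<Rightarrow> int list \<Rightarrow> bool" where
  "zero_level N s as \<longleftrightarrow> N > 0 \<and> length as = N div 2 \<and> 12 * s - sum_list as = 2 \<and>
     weighted_sum (\<lambda>j. j * (int N - j)) as mod (2 * int N) = 0 \<and>
     list_all (\<lambda>(g, A). ord_list s as g A \<le> 2 * g) (cusp_list (int N)) \<and>
     list_ex (\<lambda>(g, A). ord_list s as g A < 2 * g) (cusp_list (int N))"

lemma zero_level_imp_genus_0:
  assumes "zero_level N s as"
  shows "X1_genus N = 0"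
proof -
  have N: "N > 0" and len: "length as = N div 2" and wt: "12 * s - sum_list as = 2"
    and S2: "2 * int N dvd S2 N (vec_of as)"
    and ord: "\<forall>(g, A)\<in>set (cusp_list (int N)). ord_list s as g A \<le> 2 * g"
    and ex: "\<exists>(g, A)\<in>set (cusp_list (int N)). ord_list s as g A < 2 * g"
    using assms S2_vec_of[of as N] by (auto simp: zero_level_def list_all_iff list_ex_iff mod_eq_0_iff_dvd)
  let ?J = "{1..N div 2}"
  have co: "cusp_ord s ?J (vec_of as) g A = ord_list s as g A" for g A
    using cusp_ord_vec_of[of s as g A] by (simp add: len)
  have "\<forall>(g, A)\<in>set (cusp_list (int N)). cusp_ord s ?J (vec_of as) g A \<le> 2 * g"
    unfolding co by (rule ord)
  then have ord': "cusp_ord s ?J (vec_of as) g A \<le> 2 * g" if "g > 0" "g dvd int N" "coprime A g" for g A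
    using all_cusps_iff[of "int N" "\<lambda>g x. x \<le> 2 * g" s ?J "vec_of as"] N that by simp
  obtain g0 A0 where g0: "(g0, A0) \<in> set (cusp_list (int N))" "ord_list s as g0 A0 < 2 * g0" using ex by blast
  then have g0': "g0 > 0" "g0 dvd int N" "coprime A0 g0"
    by (auto simp: cusp_list_def coprime_iff_gcd_eq_1)
  have wt': "12 * s - (\<Sum>j\<in>?J. vec_of as j) = 2" using wt sum_vec_of_1[of as] by (simp add: len)
  have tm: "trivial_multiplier N ?J (vec_of as)" using S2 trivial_multiplier_iff_S2[OF N] by simp
  have "f \<tau> = 0" if "f \<in> X1_differentials N" "Im \<tau> > 0" for f \<tau>
    using X1_differentials_zero[OF N _ not_dvd_half[OF N] wt' tm ord' g0' _ that] g0(2) unfolding co by simp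
  then show ?thesis unfolding X1_genus_eq_0_iff by simp
qed

text \<open>The vectors solve the linear equations expressing that the orders in the local parameters are
  all \<open>1\<close>, except for \<open>0\<close> at the cusps of one or two types.\<close>

lemma genus_0_levels:
  assumes "N \<in> {5, 6, 7, 8, 9, 10, 12}"
  shows "X1_genus N = 0"
proof -
  have "zero_level 5 0 [-1, -1]" by code_simp
  moreover have "zero_level 6 0 [-1, -2, 1]" by code_simp
  moreover have "zero_level 7 1 [2, 5, 3]" by code_simp
  moreover have "zero_level 8 0 [-2, 1, -2, 1]" by code_simp
  moreover have "zero_level 9 1 [3, 3, 1, 3]" by code_simp
  moreover have "zero_level 10 0 [-2, 1, -2, 1, 0]" by code_simp
  moreover have "zero_level 12 0 [-2, 0, 0, 1, -2, 1]" by code_simp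
  ultimately show ?thesis using assms zero_level_imp_genus_0 by auto
qed

section \<open>Levels of positive genus\<close>

text \<open>Some product of Klein forms is a cusp form of weight \<open>2\<close> on \<open>\<Gamma>\<^sub>1(N)\<close>, recognised by its exponents.\<close>

definition has_cusp_product :: "nat \<Rightarrow> bool" where
  "has_cusp_product N \<longleftrightarrow> N > 0 \<and> (\<exists>s J e. finite J \<and> (\<forall>j\<in>J. \<not> N dvd j) \<and> 12 * s - (\<Sum>j\<in>J. e j) = 2 \<and>
     trivial_multiplier N J e \<and> (\<forall>g A. g > 0 \<longrightarrow> g dvd int N \<longrightarrow> coprime A g \<longrightarrow> cusp_ord s J e g A > 0))"

lemma has_cusp_product_imp_genus:
  assumes "has_cusp_product N" "N dvd M" "M > 0"
  shows "X1_genus M \<noteq> 0"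
proof -
  from assms(1) obtain s J e where *: "N > 0" "finite J" "\<forall>j\<in>J. \<not> N dvd j" "12 * s - (\<Sum>j\<in>J. e j) = 2"
    "trivial_multiplier N J e" "\<forall>g A. g > 0 \<longrightarrow> g dvd int N \<longrightarrow> coprime A g \<longrightarrow> cusp_ord s J e g A > 0"
    unfolding has_cusp_product_def by blast
  from X1_differential_exists[OF *(1,2) _ *(4,5) _ assms(3,2)] *(3,6) obtain f where "f \<in> X1_differentials M" "f \<i> \<noteq> 0" by blast
  then show ?thesis unfolding X1_genus_eq_0_iff by force
qed

text \<open>An executable sufficient condition, with \<open>\<Delta>(N\<tau>)\<close> to the first power, hence \<open>\<Sum>a\<^sub>j = 10\<close>.\<close>

definition positive_level :: "nat \<Rightarrow> int list \<Rightarrow> bool" where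
  "positive_level N as \<longleftrightarrow> N > 0 \<and> length as = N div 2 \<and> sum_list as = 10 \<and>
     weighted_sum (\<lambda>j. j * (int N - j)) as mod (2 * int N) = 0 \<and>
     list_all (\<lambda>(g, A). ord_list 1 as g A > 0) (cusp_list (int N))"

lemma positive_level_imp_cusp_product:
  assumes "positive_level N as"
  shows "has_cusp_product N"
proof -
  have N: "N > 0" and len: "length as = N div 2" and wt: "sum_list as = 10"
    and S2: "2 * int N dvd S2 N (vec_of as)"
    and ord: "\<forall>(g, A)\<in>set (cusp_list (int N)). ord_list 1 as g A > 0"
    using assms S2_vec_of[of as N] by (auto simp: positive_level_def list_all_iff mod_eq_0_iff_dvd)
  let ?J = "{1..N div 2}"
  have co: "cusp_ord 1 ?J (vec_of as) g A = ord_list 1 as g A" for g A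
    using cusp_ord_vec_of[of 1 as g A] by (simp add: len)
  have "\<forall>(g, A)\<in>set (cusp_list (int N)). cusp_ord 1 ?J (vec_of as) g A > 0"
    unfolding co by (rule ord)
  have "\<forall>g A. g > 0 \<longrightarrow> g dvd int N \<longrightarrow> coprime A g \<longrightarrow> cusp_ord 1 ?J (vec_of as) g A > 0"
    using \<open>\<forall>(g, A)\<in>set (cusp_list (int N)). cusp_ord 1 ?J (vec_of as) g A > 0\<close>
      all_cusps_iff[of "int N" "\<lambda>g x. x > 0" 1 ?J "vec_of as"] N by simp
  moreover have "12 * 1 - (\<Sum>j\<in>?J. vec_of as j) = 2" using wt sum_vec_of_1[of as] by (simp add: len)
  moreover have "trivial_multiplier N ?J (vec_of as)" using S2 trivial_multiplier_iff_S2[OF N] by simp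
  ultimately show ?thesis
    unfolding has_cusp_product_def using N not_dvd_half[OF N] by blast
qed

lemma has_cusp_product_small:
  assumes "N \<in> {11, 14, 15, 16, 18, 20, 21, 24, 27}"
  shows "has_cusp_product N"
proof -
  have "positive_level 11 [2, 2, 2, 2, 2]" by code_simp
  moreover have "positive_level 14 [1, 2, 1, 2, 1, 2, 1]" by code_simp
  moreover have "positive_level 15 [1, 1, 2, 1, 2, 2, 1]" by code_simp
  moreover have "positive_level 16 [0, 2, 2, 1, 2, 1, 0, 2]" by code_simp
  moreover have "positive_level 18 [0, 2, 1, 1, 1, 2, 1, 1, 1]" by code_simp
  moreover have "positive_level 20 [1, 1, 0, 1, 1, 1, 1, 2, 1, 1]" by code_simp
  moreover have "positive_level 21 [0, 2, 2, 0, 2, 0, 2, 0, 2, 0]" by code_simp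
  moreover have "positive_level 24 [1, 0, 1, 1, 0, 1, 0, 1, 1, 2, 1, 1]" by code_simp
  moreover have "positive_level 27 [1, 1, 2, 1, 1, 1, 1, 0, 1, 0, 1, 0, 0]" by code_simp
  ultimately show ?thesis using assms positive_level_imp_cusp_product by blast
qed

text \<open>A product that works for all levels prime to \<open>6\<close> from \<open>13\<close> on: the theta block
  \<open>\<Delta> k\<^sub>1\<^sup>3 k\<^sub>2\<^sup>2 k\<^sub>3\<^sup>2 k\<^sub>4 k\<^sub>5\<^sup>2 k\<^sub>7 / k\<^sub>1\<^sub>2\<close>, where \<open>k\<^sub>n\<close> is the Klein form with characteristic \<open>(n / N, 0)\<close>.
  Its exponents satisfy \<open>\<Sum> c\<^sub>n = 10\<close> and \<open>\<Sum> c\<^sub>n n\<^sup>2 = 0\<close>. By the latter, the order at the cusp \<open>A / g\<close>,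
  divided by \<open>g\<close>, is a piecewise linear function of \<open>A / g\<close>, with breakpoints at the multiples of
  \<open>1/5\<close>, \<open>1/7\<close> and \<open>1/12\<close>. On \<open>[0, 1/2]\<close> it is nonnegative and vanishes only at \<open>1/6\<close>, \<open>1/4\<close>, \<open>1/3\<close>
  and \<open>1/2\<close>, which are not of the form \<open>A / g\<close> with \<open>g\<close> prime to \<open>6\<close>.\<close>

definition block :: "nat \<Rightarrow> int" where
  "block n = (if n = 1 then 3 else if n = 2 \<or> n = 3 \<or> n = 5 then 2 else if n = 4 \<or> n = 7 then 1 else -1)"

abbreviation block_support :: "nat set" where "block_support \<equiv> {1, 2, 3, 4, 5, 7, 12}"

text \<open>Both ends of the interval are admitted, so that adjacent pieces overlap at the breakpoints.\<close>

lemma mod_parabola: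
  fixes g x m :: int
  assumes "g > 0" "m * g \<le> x" "x \<le> (m + 1) * g"
  shows "(x mod g) * (g - x mod g) = (x - m * g) * ((m + 1) * g - x)"
proof (cases "x = (m + 1) * g")
  case False
  then have lt: "x < m * g + g" using assms(3) by (simp add: algebra_simps)
  have "x mod g = (x - m * g + m * g) mod g" by simp
  also have "\<dots> = (x - m * g) mod g" by (rule mod_mult_self1)
  also have "\<dots> = x - m * g" by (rule mod_pos_pos_trivial) (use assms(2) lt in linarith)+
  finally have eq: "x mod g = x - m * g" .
  show ?thesis unfolding eq by (simp add: algebra_simps)
qed simp

text \<open>One linear piece: \<open>m\<^sub>n\<close> is the integer part of \<open>n A / g\<close> on it.\<close>

lemma theta_block_pos:
  fixes g A :: int
  assumes g: "g > 0"
    and m: "m1 * g \<le> 1 * A" "1 * A \<le> (m1 + 1) * g" "m2 * g \<le> 2 * A" "2 * A \<le> (m2 + 1) * g"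
      "m3 * g \<le> 3 * A" "3 * A \<le> (m3 + 1) * g" "m4 * g \<le> 4 * A" "4 * A \<le> (m4 + 1) * g"
      "m5 * g \<le> 5 * A" "5 * A \<le> (m5 + 1) * g" "m7 * g \<le> 7 * A" "7 * A \<le> (m7 + 1) * g"
      "m12 * g \<le> 12 * A" "12 * A \<le> (m12 + 1) * g"
    and lin: "A * (3 * (1 + 2 * m1) + 4 * (1 + 2 * m2) + 6 * (1 + 2 * m3) + 4 * (1 + 2 * m4) + 10 * (1 + 2 * m5)
        + 7 * (1 + 2 * m7) - 12 * (1 + 2 * m12))
      < g * (2 + 3 * (m1 * (m1 + 1)) + 2 * (m2 * (m2 + 1)) + 2 * (m3 * (m3 + 1)) + m4 * (m4 + 1) + 2 * (m5 * (m5 + 1))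
        + m7 * (m7 + 1) - m12 * (m12 + 1))"
  shows "cusp_ord 1 block_support block g A > 0"
proof -
  have "cusp_ord 1 block_support block g A = g * (g * (2 + 3 * (m1 * (m1 + 1)) + 2 * (m2 * (m2 + 1)) + 2 * (m3 * (m3 + 1)) + m4 * (m4 + 1) + 2 * (m5 * (m5 + 1))
        + m7 * (m7 + 1) - m12 * (m12 + 1)) - A * (3 * (1 + 2 * m1) + 4 * (1 + 2 * m2) + 6 * (1 + 2 * m3) + 4 * (1 + 2 * m4) + 10 * (1 + 2 * m5)
        + 7 * (1 + 2 * m7) - 12 * (1 + 2 * m12)))"
    using mod_parabola[OF g m(1,2)] mod_parabola[OF g m(3,4)] mod_parabola[OF g m(5,6)] mod_parabola[OF g m(7,8)]
      mod_parabola[OF g m(9,10)] mod_parabola[OF g m(11,12)] mod_parabola[OF g m(13,14)]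
    by (simp add: cusp_ord_def block_def) (simp add: algebra_simps power2_eq_square)
  then show ?thesis using g lin by simp
qed

lemma cusp_ord_minus: "g > 0 \<Longrightarrow> cusp_ord s J e g (- A) = cusp_ord s J e g A"
  unfolding cusp_ord_def by (auto simp: zmod_zminus1_eq_if intro!: sum.cong)

lemma has_cusp_product_coprime_6:
  assumes N: "N \<ge> 13" "odd N" "\<not> 3 dvd N"
  shows "has_cusp_product N"
proof -
  have pos: "cusp_ord 1 block_support block g A > 0"
    if g: "g > 0" "odd g" "\<not> 3 dvd g" and A: "0 \<le> A" "2 * A \<le> g" and cop: "coprime A g" for g A :: int
  proof -
    have nz: "2 * A \<noteq> g" "3 * A \<noteq> g" "4 * A \<noteq> g" "6 * A \<noteq> g"
      using g(2,3) by presburger+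
    note A = A g(1)
    consider (1) "0 * g \<le> 1 * A" "12 * A \<le> 1 * g"
      | (2) "1 * g \<le> 12 * A" "7 * A \<le> 1 * g"
      | (3) "1 * g \<le> 7 * A" "6 * A \<le> 1 * g"
      | (4) "1 * g \<le> 6 * A" "5 * A \<le> 1 * g"
      | (5) "1 * g \<le> 5 * A" "4 * A \<le> 1 * g"
      | (6) "1 * g \<le> 4 * A" "7 * A \<le> 2 * g"
      | (7) "2 * g \<le> 7 * A" "3 * A \<le> 1 * g"
      | (8) "1 * g \<le> 3 * A" "5 * A \<le> 2 * g"
      | (9) "2 * g \<le> 5 * A" "12 * A \<le> 5 * g"
      | (10) "5 * g \<le> 12 * A" "7 * A \<le> 3 * g"
      | (11) "3 * g \<le> 7 * A" "2 * A \<le> 1 * g"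
      using A by linarith
    then show ?thesis
    proof cases
      case 1
      show ?thesis
        by (rule theta_block_pos[of g 0 A 0 0 0 0 0 0]) (use A 1 nz in auto)
    next
      case 2
      show ?thesis
        by (rule theta_block_pos[of g 0 A 0 0 0 0 0 1]) (use A 2 nz in auto)
    next
      case 3
      show ?thesis
        by (rule theta_block_pos[of g 0 A 0 0 0 0 1 1]) (use A 3 nz in auto)
    next
      case 4
      show ?thesis
        by (rule theta_block_pos[of g 0 A 0 0 0 0 1 2]) (use A 4 nz in auto)
    next
      case 5
      show ?thesis
        by (rule theta_block_pos[of g 0 A 0 0 0 1 1 2]) (use A 5 nz in auto)
    next
      case 6
      show ?thesis
        by (rule theta_block_pos[of g 0 A 0 0 1 1 1 3]) (use A 6 nz in auto)
    next
      case 7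
      show ?thesis
        by (rule theta_block_pos[of g 0 A 0 0 1 1 2 3]) (use A 7 nz in auto)
    next
      case 8
      show ?thesis
        by (rule theta_block_pos[of g 0 A 0 1 1 1 2 4]) (use A 8 nz in auto)
    next
      case 9
      show ?thesis
        by (rule theta_block_pos[of g 0 A 0 1 1 2 2 4]) (use A 9 nz in auto)
    next
      case 10
      show ?thesis
        by (rule theta_block_pos[of g 0 A 0 1 1 2 2 5]) (use A 10 nz in auto)
    next
      case 11
      show ?thesis
        by (rule theta_block_pos[of g 0 A 0 1 1 2 3 5]) (use A 11 nz in auto)
    qed
  qed
  have "cusp_ord 1 block_support block g A > 0" if g: "g > 0" "g dvd int N" "coprime A g" for g A
  proof -
    have odd: "odd g" using g(2) N(2) by (meson dvd_trans even_of_nat)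
    have three: "\<not> 3 dvd g" using g(2) N(3) by (metis dvd_trans int_dvd_int_iff of_nat_numeral)
    define B where "B = A mod g"
    have B: "0 \<le> B" "B < g" using g(1) by (auto simp: B_def)
    have cB: "coprime B g" using g(1,3) by (simp add: B_def coprime_mod_left_iff)
    have eq: "cusp_ord 1 block_support block g A = cusp_ord 1 block_support block g B"
      by (simp only: B_def cusp_ord_mod)
    show ?thesis
    proof (cases "2 * B \<le> g")
      case True
      then show ?thesis unfolding eq using pos g(1) odd three B cB by blast
    next
      case False
      have "cusp_ord 1 block_support block g (- B mod g) = cusp_ord 1 block_support block g B"
        by (simp only: cusp_ord_mod cusp_ord_minus[OF g(1)])
      moreover have "- B mod g = g - B" using B False by (simp add: zmod_zminus1_eq_if)
      moreover have "coprime (g - B) g"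
      proof (rule coprimeI)
        fix l assume l: "l dvd g - B" "l dvd g"
        then have "l dvd B" by (simp add: dvd_diff_right_iff)
        with l(2) cB show "is_unit l" by (meson coprime_common_divisor)
      qed
      moreover have "0 \<le> g - B" "2 * (g - B) \<le> g" using B False by auto
      ultimately show ?thesis unfolding eq using pos[of g "g - B"] g(1) odd three by simp
    qed
  qed
  moreover have "trivial_multiplier N block_support block"
    unfolding trivial_multiplier_def by (rule exI[of _ 0]) (simp add: block_def)
  moreover have "12 * 1 - (\<Sum>j\<in>block_support. block j) = 2" by (simp add: block_def)
  moreover have "\<forall>j\<in>block_support. \<not> N dvd j" using N(1) by (auto dest!: dvd_imp_le)
  ultimately show ?thesis
    unfolding has_cusp_product_def using N(1) by (intro conjI exI[of _ 1] exI[of _ block_support] exI[of _ block]) auto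
qed

text \<open>Dividing by \<open>2\<close> or \<open>3\<close> as long as the quotient is neither below \<open>5\<close> nor one of the seven levels leads
  to a level prime to \<open>6\<close> or to one of the small levels.\<close>

lemma exists_cusp_product_divisor:
  assumes "N \<ge> 5" "N \<notin> {5, 6, 7, 8, 9, 10, 12}"
  shows "\<exists>d. d dvd N \<and> has_cusp_product d"
  using assms
proof (induction N rule: less_induct)
  case (less N)
  have step: ?case if N: "N = p * M" "p > 1" and M: "M \<notin> {1, 2, 3, 4, 5, 6, 7, 8, 9, 10, 12}" for p M
  proof -
    have "M > 0" using N less.prems by (cases M) auto
    have "M \<ge> 5"
    proof (rule ccontr)
      assume "\<not> M \<ge> 5"
      then have "M = 0 \<or> M = 1 \<or> M = 2 \<or> M = 3 \<or> M = 4" by linarith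
      with M \<open>M > 0\<close> show False by auto
    qed
    moreover have "M \<notin> {5, 6, 7, 8, 9, 10, 12}" "M < N" using M N \<open>M > 0\<close> by auto
    ultimately have "\<exists>d. d dvd M \<and> has_cusp_product d" using less.IH by blast
    then show ?thesis unfolding N by (auto intro: dvd_mult)
  qed
  have small: ?case if "N \<in> {11, 14, 15, 16, 18, 20, 21, 24, 27}"
    using has_cusp_product_small[OF that] by (intro exI[of _ N]) simp
  show ?case
  proof (cases "even N")
    case True
    then obtain M where M: "N = 2 * M" by (rule evenE)
    show ?thesis
    proof (cases "M \<in> {1, 2, 3, 4, 5, 6, 7, 8, 9, 10, 12}")
      case True
      then show ?thesis using M less.prems by (intro small) auto
    next
      case False
      then show ?thesis using step[OF M] by simp
    qed
  next
    case odd: False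
    show ?thesis
    proof (cases "3 dvd N")
      case True
      then obtain M where M: "N = 3 * M" by (rule dvdE)
      show ?thesis
      proof (cases "M \<in> {1, 2, 3, 4, 5, 6, 7, 8, 9, 10, 12}")
        case True
        then show ?thesis using M less.prems odd by (intro small) auto
      next
        case False
        then show ?thesis using step[OF M] by simp
      qed
    next
      case False
      show ?thesis
      proof (cases "N \<ge> 13")
        case True
        then show ?thesis
          using has_cusp_product_coprime_6[OF True odd False] by (intro exI[of _ N]) simp
      next
        case False
        then have "N = 5 \<or> N = 6 \<or> N = 7 \<or> N = 8 \<or> N = 9 \<or> N = 10 \<or> N = 11 \<or> N = 12"
          using less.prems(1) by linarith
        then have "N = 11" using less.prems(2) by auto
        then show ?thesis by (intro small) simp
      qed
    qed
  qed
qed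

theorem X1_genus_0_iff:
  assumes "N \<ge> 5"
  shows "X1_genus N = 0 \<longleftrightarrow> N \<in> {5, 6, 7, 8, 9, 10, 12}"
proof (cases "N \<in> {5, 6, 7, 8, 9, 10, 12}")
  case True
  then show ?thesis using genus_0_levels[OF True] by simp
next
  case False
  then obtain d where "d dvd N" "has_cusp_product d"
    using exists_cusp_product_divisor[OF assms] by blast
  then show ?thesis using has_cusp_product_imp_genus[of d N] assms False by simp
qed

section \<open>Counting solutions of linear equations\<close>

text \<open>Solutions of \<open>\<Sum> w\<^sub>i y\<^sub>i = n\<close> in natural numbers.\<close>

definition weighted_solutions :: "nat list \<Rightarrow> nat \<Rightarrow> nat list set" where
  "weighted_solutions ws n = {ys. length ys = length ws \<and> sum_list (map2 (*) ws ys) = n}"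

lemma finite_weighted_solutions:
  assumes "\<forall>w\<in>set ws. w > 0"
  shows "finite (weighted_solutions ws n)"
proof -
  have "set ys \<subseteq> {0..n}" if "length ys = length ws" "sum_list (map2 (*) ws ys) = n" for ys
    using that assms
  proof (induction ys ws arbitrary: n rule: list_induct2)
    case (Cons y ys w ws)
    have n: "w * y + sum_list (map2 (*) ws ys) = n" using Cons.prems(1) by simp
    have "1 * y \<le> w * y" using Cons.prems(2) by (intro mult_right_mono) auto
    then have "y \<le> n" using n by linarith
    moreover have "set ys \<subseteq> {0..n - w * y}" using n Cons.prems(2) by (intro Cons.IH) auto
    ultimately show ?case by fastforce
  qed simp
  then have "weighted_solutions ws n \<subseteq> {ys. set ys \<subseteq> {0..n} \<and> length ys = length ws}"
    by (auto simp: weighted_solutions_def)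
  then show ?thesis using finite_subset finite_lists_length_eq[of "{0..n}" "length ws"] by blast
qed

lemma card_weighted_solutions_ones:
  "card (weighted_solutions (replicate r 1) n) = (n + r - 1) choose n"
proof -
  have "map2 (*) (replicate (length ys) 1) ys = ys" for ys :: "nat list"
    by (rule nth_equalityI) auto
  then have "weighted_solutions (replicate r 1) n = {ys. length ys = r \<and> sum_list ys = n}"
    by (auto simp: weighted_solutions_def)
  then show ?thesis by (simp add: card_length_sum_list)
qed

lemma card_weighted_solutions_split:
  assumes w: "w > 0" and vs: "\<forall>v\<in>set vs. v > 0"
  shows "card (weighted_solutions (replicate p w @ vs) n) =
    (\<Sum>j = 0..n div w. card (weighted_solutions (replicate p 1) j) * card (weighted_solutions vs (n - w * j)))"
proof -
  define A where "A j = (\<lambda>(xs, ys). xs @ ys) ` (weighted_solutions (replicate p 1) j \<times> weighted_solutions vs (n - w * j))" for j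
  have ones: "map2 (*) (replicate (length xs) 1) xs = xs" for xs :: "nat list"
    by (rule nth_equalityI) auto
  have scaled: "sum_list (map2 (*) (replicate (length xs) w) xs) = w * sum_list xs" for xs :: "nat list"
    by (induction xs) (auto simp: distrib_left)
  have "weighted_solutions (replicate p w @ vs) n = (\<Union>j\<in>{0..n div w}. A j)"
  proof (intro equalityI subsetI)
    fix zs assume "zs \<in> weighted_solutions (replicate p w @ vs) n"
    then have len: "length zs = p + length vs" and sum: "sum_list (map2 (*) (replicate p w @ vs) zs) = n"
      by (auto simp: weighted_solutions_def)
    define xs ys where "xs = take p zs" and "ys = drop p zs"
    have zs: "zs = xs @ ys" and l: "length xs = p" "length ys = length vs" using len by (auto simp: xs_def ys_def)
    have s: "w * sum_list xs + sum_list (map2 (*) vs ys) = n"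
      using sum l scaled[of xs] by (simp add: zs)
    then have "sum_list xs * w \<le> n" by (simp add: mult.commute)
    then have "sum_list xs \<le> n div w" using w by (simp add: less_eq_div_iff_mult_less_eq)
    moreover have "xs \<in> weighted_solutions (replicate p 1) (sum_list xs)"
      using l ones[of xs] by (simp add: weighted_solutions_def)
    moreover have "ys \<in> weighted_solutions vs (n - w * sum_list xs)"
      using l s by (simp add: weighted_solutions_def)
    ultimately show "zs \<in> (\<Union>j\<in>{0..n div w}. A j)" unfolding A_def zs by force
  next
    fix zs assume "zs \<in> (\<Union>j\<in>{0..n div w}. A j)"
    then obtain j xs ys where j: "j \<le> n div w" and zs: "zs = xs @ ys"
      and xs: "xs \<in> weighted_solutions (replicate p 1) j" and ys: "ys \<in> weighted_solutions vs (n - w * j)"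
      by (auto simp: A_def)
    have "w * j \<le> n" using j w by (simp add: less_eq_div_iff_mult_less_eq mult.commute)
    then show "zs \<in> weighted_solutions (replicate p w @ vs) n"
      using xs ys scaled[of xs] ones[of xs] by (auto simp: weighted_solutions_def zs)
  qed
  also have "card \<dots> = (\<Sum>j\<in>{0..n div w}. card (A j))"
  proof (rule card_UN_disjoint)
    show "\<forall>j\<in>{0..n div w}. finite (A j)"
      unfolding A_def using vs by (intro ballI finite_imageI finite_cartesian_product finite_weighted_solutions) auto
    show "\<forall>i\<in>{0..n div w}. \<forall>j\<in>{0..n div w}. i \<noteq> j \<longrightarrow> A i \<inter> A j = {}"
    proof (intro ballI impI equals0I)
      fix i j zs assume "i \<noteq> j" "zs \<in> A i \<inter> A j"
      then have zs: "zs \<in> A i" "zs \<in> A j" by auto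
      obtain xs ys where x: "zs = xs @ ys" "xs \<in> weighted_solutions (replicate p 1) i"
        using zs(1) unfolding A_def by auto
      obtain xs' ys' where x': "zs = xs' @ ys'" "xs' \<in> weighted_solutions (replicate p 1) j"
        using zs(2) unfolding A_def by auto
      have "length xs = length xs'" using x x' by (simp add: weighted_solutions_def)
      then have "xs = xs'" using x x' by simp
      then show False using x x' \<open>i \<noteq> j\<close> by (simp add: weighted_solutions_def)
    qed
  qed simp
  also have "\<dots> = (\<Sum>j = 0..n div w. card (weighted_solutions (replicate p 1) j) * card (weighted_solutions vs (n - w * j)))"
  proof (rule sum.cong)
    fix j
    have "inj_on (\<lambda>(xs, ys). xs @ ys) (weighted_solutions (replicate p 1) j \<times> weighted_solutions vs (n - w * j))"
      by (auto simp: inj_on_def weighted_solutions_def)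
    then show "card (A j) = card (weighted_solutions (replicate p 1) j) * card (weighted_solutions vs (n - w * j))"
      unfolding A_def by (simp add: card_image card_cartesian_product)
  qed simp
  finally show ?thesis .
qed

section \<open>The exponent vectors as solutions of linear equations\<close>

text \<open>The numerical conditions for modularity: \<open>12 s = k + \<Sum>a\<^sub>j\<close> and \<open>2 N t = S\<^sub>2\<close> with nonnegative
  orders at all cusps.\<close>

definition admissible :: "nat \<Rightarrow> nat \<Rightarrow> int \<Rightarrow> int \<Rightarrow> int list \<Rightarrow> bool" where
  "admissible N k s t a \<longleftrightarrow> int k + sum_list a = 12 * s \<and>
     weighted_sum (\<lambda>j. j * (int N - j)) a = 2 * int N * t \<and>
     list_all (\<lambda>(g, A). 0 \<le> ord_list s a g A) (cusp_list (int N))"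

lemma vec_of_in_L_iff:
  assumes N: "N > 0" and len: "length a = N div 2"
  shows "vec_of a \<in> L N k \<longleftrightarrow> (\<exists>s t. admissible N k s t a)"
proof -
  have co: "cusp_ord s {1..N div 2} (vec_of a) g A = ord_list s a g A" for s g A
    using cusp_ord_vec_of[of s a g A] by (simp add: len)
  have "vec_of a \<in> {1..N div 2} \<rightarrow>\<^sub>E UNIV" by (simp add: vec_of_def len)
  moreover have "(\<Sum>j = 1..N div 2. vec_of a j) = sum_list a" using sum_vec_of_1[of a] by (simp add: len)
  moreover have "(\<forall>g A. g > 0 \<longrightarrow> g dvd int N \<longrightarrow> coprime A g \<longrightarrow> ord_list s a g A \<ge> 0) \<longleftrightarrow>
      list_all (\<lambda>(g, A). 0 \<le> ord_list s a g A) (cusp_list (int N))" for s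
    using all_cusps_iff[of "int N" "\<lambda>g x. x \<ge> 0" s "{1..N div 2}" "vec_of a"] N unfolding co list_all_iff by simp
  ultimately show ?thesis
    unfolding L_characterisation[OF N] co S2_vec_of[OF len] admissible_def by (auto simp: dvd_def)
qed

lemma L_obtain_vec_of:
  assumes "x \<in> L N k"
  obtains a where "length a = N div 2" "x = vec_of a"
proof -
  have x: "x \<in> {1..N div 2} \<rightarrow>\<^sub>E UNIV" using assms by (simp add: L_def)
  define a where "a = map x [1..<N div 2 + 1]"
  have "length a = N div 2" by (simp add: a_def)
  moreover have "x = vec_of a"
  proof
    show "x j = vec_of a j" for j
      using x by (auto simp: vec_of_def a_def PiE_def extensional_def nth_map_upt simp del: upt_Suc)
  qed
  ultimately show ?thesis by (rule that)
qed

lemma vec_of_inject: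
  assumes "vec_of a = vec_of b" "length a = length b"
  shows "a = b"
proof (rule nth_equalityI)
  fix i assume "i < length a"
  then show "a ! i = b ! i"
    using fun_cong[OF assms(1), of "Suc i"] assms(2) by (simp add: vec_of_def)
qed (rule assms(2))

text \<open>\<open>F\<close> turns the vector \<open>y\<close> of orders at the cusps into the exponents, \<open>s_of\<close> and \<open>t_of\<close> compute \<open>s\<close> and \<open>t\<close> from
  \<open>y\<close>, and \<open>G\<close> recovers \<open>y\<close> from \<open>s\<close>, \<open>t\<close> and the exponents.\<close>

definition compatible :: "nat \<Rightarrow> nat \<Rightarrow> (int list \<Rightarrow> int list) \<Rightarrow> (int list \<Rightarrow> int) \<Rightarrow> (int list \<Rightarrow> int) \<Rightarrow>
    (int \<Rightarrow> int \<Rightarrow> int list \<Rightarrow> int list) \<Rightarrow> int list \<Rightarrow> bool" where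
  "compatible N k F s_of t_of G y \<longleftrightarrow> length (F y) = N div 2 \<and> int k + sum_list (F y) = 12 * s_of y \<and>
     weighted_sum (\<lambda>j. j * (int N - j)) (F y) = 2 * int N * t_of y \<and>
     list_all (\<lambda>(g, A). 0 \<le> ord_list (s_of y) (F y) g A) (cusp_list (int N)) \<and>
     G (s_of y) (t_of y) (F y) = y"

lemma compatibleD:
  assumes "compatible N k F s_of t_of G y"
  shows "12 * s_of y = int k + sum_list (F y)" "2 * int N * t_of y = weighted_sum (\<lambda>j. j * (int N - j)) (F y)"
    "G (s_of y) (t_of y) (F y) = y" "length (F y) = N div 2"
  using assms unfolding compatible_def by (simp_all only: simp_thms)

lemma sum_list_map2_int:
  "length ws = length ys \<Longrightarrow> sum_list (map2 (*) (map int ws) (map int ys)) = int (sum_list (map2 (*) ws ys))"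
  by (induction ws ys rule: list_induct2) auto

text \<open>The exponent vectors of weight \<open>k\<close> correspond to the vectors of orders: the total number of zeros is
  fixed by the weight, and \<open>ws\<close> counts the cusps that share an order.\<close>

lemma card_L_eqI:
  fixes F :: "int list \<Rightarrow> int list"
  assumes N: "N > 0"
    and F: "\<And>y. length y = length ws \<Longrightarrow> \<forall>x\<in>set y. 0 \<le> x \<Longrightarrow> sum_list (map2 (*) (map int ws) y) = int n \<Longrightarrow>
      compatible N k F s_of t_of G y"
    and G: "\<And>s t a. length a = N div 2 \<Longrightarrow> admissible N k s t a \<Longrightarrow>
      length (G s t a) = length ws \<and> (\<forall>x\<in>set (G s t a). 0 \<le> x) \<and>
      sum_list (map2 (*) (map int ws) (G s t a)) = int n \<and> F (G s t a) = a"
  shows "card (L N k) = card (weighted_solutions ws n)"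
proof -
  define f where "f ys = vec_of (F (map int ys))" for ys
  have comp: "compatible N k F s_of t_of G (map int ys)" if "ys \<in> weighted_solutions ws n" for ys
    using that by (intro F) (auto simp: weighted_solutions_def sum_list_map2_int)
  have "inj_on f (weighted_solutions ws n)"
  proof (rule inj_onI)
    fix ys zs assume "ys \<in> weighted_solutions ws n" "zs \<in> weighted_solutions ws n" and eq: "f ys = f zs"
    then have y: "compatible N k F s_of t_of G (map int ys)" and z: "compatible N k F s_of t_of G (map int zs)"
      using comp by auto
    have Feq: "F (map int ys) = F (map int zs)"
      using eq compatibleD(4)[OF y] compatibleD(4)[OF z] unfolding f_def by (intro vec_of_inject) simp_all
    have s: "s_of (map int ys) = s_of (map int zs)"
      using compatibleD(1)[OF y] compatibleD(1)[OF z] unfolding Feq by linarith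
    have t: "t_of (map int ys) = t_of (map int zs)"
      using trans[OF compatibleD(2)[OF y, unfolded Feq] compatibleD(2)[OF z, symmetric]] N by simp
    have "map int ys = G (s_of (map int ys)) (t_of (map int ys)) (F (map int ys))"
      by (rule compatibleD(3)[OF y, symmetric])
    also have "\<dots> = map int zs"
      unfolding s t Feq by (rule compatibleD(3)[OF z])
    finally have "map int ys = map int zs" .
    then show "ys = zs" by (simp add: inj_map_eq_map inj_of_nat)
  qed
  moreover have "f ` weighted_solutions ws n = L N k"
  proof (intro equalityI subsetI)
    fix a assume "a \<in> f ` weighted_solutions ws n"
    then obtain ys where "ys \<in> weighted_solutions ws n" "a = vec_of (F (map int ys))" by (auto simp: f_def)
    with comp show "a \<in> L N k"
      using vec_of_in_L_iff[OF N] unfolding compatible_def admissible_def by blast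
  next
    fix x assume x: "x \<in> L N k"
    then obtain a where a: "length a = N div 2" "x = vec_of a" by (rule L_obtain_vec_of)
    then obtain s t where st: "admissible N k s t a" using x vec_of_in_L_iff[OF N] by blast
    note y = G[OF a(1) st]
    have nat: "map int (map nat (G s t a)) = G s t a" using y by (auto intro: map_idI)
    have "sum_list (map2 (*) (map int ws) (map int (map nat (G s t a)))) = int n" unfolding nat using y by simp
    then have "sum_list (map2 (*) ws (map nat (G s t a))) = n"
      using y by (subst (asm) sum_list_map2_int) (auto simp del: map_map)
    then have "map nat (G s t a) \<in> weighted_solutions ws n" using y by (simp add: weighted_solutions_def)
    moreover have "x = f (map nat (G s t a))" unfolding f_def nat using y a by simp
    ultimately show "x \<in> f ` weighted_solutions ws n" by blast
  qed
  ultimately show ?thesis using card_image by metis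
qed

text \<open>The data for the seven levels. The entries of \<open>y\<close> are the orders \<open>cusp_ord / (2g)\<close> in the local
  parameters at the cusps \<open>A / g\<close>, for \<open>A\<close> up to sign modulo \<open>g\<close>, sorted by decreasing number of cusps with
  that order. At \<open>g = 1\<close> the order is \<open>s\<close>, at \<open>A / g = 1 / N\<close> it is \<open>N s - t\<close>. The rows of \<open>F\<close> come from the
  inverse of the matrix of orders; multiples of the relation \<open>\<Sum> w\<^sub>i y\<^sub>i = c k\<close> are added to make them
  integral. Likewise the rows of \<open>G\<close> are the orders, with multiples of \<open>2 N t = S\<^sub>2\<close> added.\<close>

lemma card_L_5: "card (L 5 k) = card (weighted_solutions [2, 1, 1] k)"
proof -
  define F where "F y = [5 * y!0 + 2 * y!1 - 3 * y!2, 5 * y!0 - 3 * y!1 + 2 * y!2]" for y :: "int list"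
  define G where "G s t a = [s, 5 * s - t, 5 * s + t - a!0 - a!1]" for s t :: int and a :: "int list"
  have cusps: "cusp_list 5 =
      [(1, 0), (5, 1), (5, 2), (5, 3), (5, 4)]"
    by code_simp
  note eval = F_def G_def cusps ord_list_def weighted_sum_def upt_rec_numeral
  show ?thesis
  proof (rule card_L_eqI[where F = F and G = G and s_of = "\<lambda>y. y!0" and t_of = "\<lambda>y. 5 * y!0 - y!1"])
    fix y :: "int list"
    assume len: "length y = length [2 :: nat, 1, 1]" and y: "\<forall>x\<in>set y. 0 \<le> x"
      "sum_list (map2 (*) (map int [2 :: nat, 1, 1]) y) = int k"
    from len obtain y0 y1 y2 where "y = [y0, y1, y2]" by (auto simp: length_Suc_conv)
    with y show "compatible 5 k F (\<lambda>y. y!0) (\<lambda>y. 5 * y!0 - y!1) G y"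
      unfolding compatible_def by (simp add: eval)
  next
    fix s t :: int and a :: "int list"
    assume len: "length a = 5 div 2" and a: "admissible 5 k s t a"
    from len have "length a = 2" by simp
    then obtain a1 a2 where "a = [a1, a2]" by (auto simp: length_Suc_conv numeral_eq_Suc)
    with a show "length (G s t a) = length [2 :: nat, 1, 1] \<and> (\<forall>x\<in>set (G s t a). 0 \<le> x) \<and>
        sum_list (map2 (*) (map int [2 :: nat, 1, 1]) (G s t a)) = int k \<and> F (G s t a) = a"
      unfolding admissible_def by (simp add: eval)
  qed simp
qed

lemma card_L_6: "card (L 6 k) = card (weighted_solutions [1, 1, 1, 1] k)"
proof -
  define F where "F y = [6 * y!0 - 3 * y!1 - 2 * y!2 + y!3, 3 * y!0 + 3 * y!1 - y!2 - y!3, 2 * y!0 - y!1 + 2 * y!2 - y!3]" for y :: "int list"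
  define G where "G s t a = [s, 2 * s - 3 * t + a!0 + 2 * a!1 + 2 * a!2, 3 * s + 4 * t - 2 * a!0 - 3 * a!1 - 3 * a!2,
      6 * s - t]" for s t :: int and a :: "int list"
  have cusps: "cusp_list 6 =
      [(1, 0), (2, 1), (3, 1), (3, 2), (6, 1), (6, 5)]"
    by code_simp
  note eval = F_def G_def cusps ord_list_def weighted_sum_def upt_rec_numeral
  show ?thesis
  proof (rule card_L_eqI[where F = F and G = G and s_of = "\<lambda>y. y!0" and t_of = "\<lambda>y. 6 * y!0 - y!3"])
    fix y :: "int list"
    assume len: "length y = length [1 :: nat, 1, 1, 1]" and y: "\<forall>x\<in>set y. 0 \<le> x"
      "sum_list (map2 (*) (map int [1 :: nat, 1, 1, 1]) y) = int k"
    from len obtain y0 y1 y2 y3 where "y = [y0, y1, y2, y3]" by (auto simp: length_Suc_conv)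
    with y show "compatible 6 k F (\<lambda>y. y!0) (\<lambda>y. 6 * y!0 - y!3) G y"
      unfolding compatible_def by (simp add: eval)
  next
    fix s t :: int and a :: "int list"
    assume len: "length a = 6 div 2" and a: "admissible 6 k s t a"
    from len have "length a = 3" by simp
    then obtain a1 a2 a3 where "a = [a1, a2, a3]" by (auto simp: length_Suc_conv numeral_eq_Suc)
    with a show "length (G s t a) = length [1 :: nat, 1, 1, 1] \<and> (\<forall>x\<in>set (G s t a). 0 \<le> x) \<and>
        sum_list (map2 (*) (map int [1 :: nat, 1, 1, 1]) (G s t a)) = int k \<and> F (G s t a) = a"
      unfolding admissible_def by (simp add: eval)
  qed simp
qed

lemma card_L_7: "card (L 7 k) = card (weighted_solutions [3, 1, 1, 1] (2 * k))"
proof -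
  define F where "F y = [2 * y!0 + y!1 - y!2 - 2 * y!3 + int k, 2 * y!0 - y!1 - 2 * y!2 + y!3 + int k,
      2 * y!0 - 2 * y!1 + y!2 - y!3 + int k]" for y :: "int list"
  define G where "G s t a = [s, 7 * s - t, 7 * s + 3 * t - 2 * a!0 - 3 * a!1 - 3 * a!2, 7 * s - 2 * t + a!1 + a!2]" for s t :: int and a :: "int list"
  have cusps: "cusp_list 7 =
      [(1, 0), (7, 1), (7, 2), (7, 3), (7, 4), (7, 5), (7, 6)]"
    by code_simp
  note eval = F_def G_def cusps ord_list_def weighted_sum_def upt_rec_numeral
  show ?thesis
  proof (rule card_L_eqI[where F = F and G = G and s_of = "\<lambda>y. y!0" and t_of = "\<lambda>y. 7 * y!0 - y!1"])
    fix y :: "int list"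
    assume len: "length y = length [3 :: nat, 1, 1, 1]" and y: "\<forall>x\<in>set y. 0 \<le> x"
      "sum_list (map2 (*) (map int [3 :: nat, 1, 1, 1]) y) = int (2 * k)"
    from len obtain y0 y1 y2 y3 where "y = [y0, y1, y2, y3]" by (auto simp: length_Suc_conv)
    with y show "compatible 7 k F (\<lambda>y. y!0) (\<lambda>y. 7 * y!0 - y!1) G y"
      unfolding compatible_def by (simp add: eval)
  next
    fix s t :: int and a :: "int list"
    assume len: "length a = 7 div 2" and a: "admissible 7 k s t a"
    from len have "length a = 3" by simp
    then obtain a1 a2 a3 where "a = [a1, a2, a3]" by (auto simp: length_Suc_conv numeral_eq_Suc)
    with a show "length (G s t a) = length [3 :: nat, 1, 1, 1] \<and> (\<forall>x\<in>set (G s t a). 0 \<le> x) \<and>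
        sum_list (map2 (*) (map int [3 :: nat, 1, 1, 1]) (G s t a)) = int (2 * k) \<and> F (G s t a) = a"
      unfolding admissible_def by (simp add: eval)
  qed simp
qed

lemma card_L_8: "card (L 8 k) = card (weighted_solutions [2, 1, 1, 1, 1] (2 * k))"
proof -
  define F where "F y = [4 * y!0 - 2 * y!1 + y!3 - y!4, 2 * y!0 + 3 * y!1 - 2 * y!2, 4 * y!0 - 2 * y!1 - y!3 + y!4,
      y!2 - y!3 - y!4 + int k]" for y :: "int list"
  define G where "G s t a = [s, 2 * s + 4 * t - 2 * a!0 - 3 * a!1 - 4 * a!2 - 4 * a!3,
      4 * s + 6 * t - 3 * a!0 - 5 * a!1 - 6 * a!2 - 6 * a!3, 8 * s - t,
      8 * s + 7 * t - 4 * a!0 - 6 * a!1 - 7 * a!2 - 8 * a!3]" for s t :: int and a :: "int list"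
  have cusps: "cusp_list 8 =
      [(1, 0), (2, 1), (4, 1), (4, 3), (8, 1), (8, 3), (8, 5), (8, 7)]"
    by code_simp
  note eval = F_def G_def cusps ord_list_def weighted_sum_def upt_rec_numeral
  show ?thesis
  proof (rule card_L_eqI[where F = F and G = G and s_of = "\<lambda>y. y!0" and t_of = "\<lambda>y. 8 * y!0 - y!3"])
    fix y :: "int list"
    assume len: "length y = length [2 :: nat, 1, 1, 1, 1]" and y: "\<forall>x\<in>set y. 0 \<le> x"
      "sum_list (map2 (*) (map int [2 :: nat, 1, 1, 1, 1]) y) = int (2 * k)"
    from len obtain y0 y1 y2 y3 y4 where "y = [y0, y1, y2, y3, y4]" by (auto simp: length_Suc_conv)
    with y show "compatible 8 k F (\<lambda>y. y!0) (\<lambda>y. 8 * y!0 - y!3) G y"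
      unfolding compatible_def by (simp add: eval)
  next
    fix s t :: int and a :: "int list"
    assume len: "length a = 8 div 2" and a: "admissible 8 k s t a"
    from len have "length a = 4" by simp
    then obtain a1 a2 a3 a4 where "a = [a1, a2, a3, a4]" by (auto simp: length_Suc_conv numeral_eq_Suc)
    with a show "length (G s t a) = length [2 :: nat, 1, 1, 1, 1] \<and> (\<forall>x\<in>set (G s t a). 0 \<le> x) \<and>
        sum_list (map2 (*) (map int [2 :: nat, 1, 1, 1, 1]) (G s t a)) = int (2 * k) \<and> F (G s t a) = a"
      unfolding admissible_def by (simp add: eval)
  qed simp
qed

lemma card_L_9: "card (L 9 k) = card (weighted_solutions [3, 2, 1, 1, 1] (3 * k))"
proof -
  define F where "F y = [3 * y!0 - y!1 + y!2 - y!4, 3 * y!0 - y!1 - y!3 + y!4, 3 * y!0 + 3 * y!1 - int k,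
      3 * y!0 - y!1 - y!2 + y!3]" for y :: "int list"
  define G where "G s t a = [s, 3 * s - 3 * t + a!0 + 2 * a!1 + 3 * a!2 + 3 * a!3, 9 * s - t,
      9 * s - 4 * t + a!0 + 2 * a!1 + 3 * a!2 + 4 * a!3,
      9 * s + 2 * t - 2 * a!0 - 2 * a!1 - 3 * a!2 - 3 * a!3]" for s t :: int and a :: "int list"
  have cusps: "cusp_list 9 =
      [(1, 0), (3, 1), (3, 2), (9, 1), (9, 2), (9, 4), (9, 5), (9, 7), (9, 8)]"
    by code_simp
  note eval = F_def G_def cusps ord_list_def weighted_sum_def upt_rec_numeral
  show ?thesis
  proof (rule card_L_eqI[where F = F and G = G and s_of = "\<lambda>y. y!0" and t_of = "\<lambda>y. 9 * y!0 - y!2"])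
    fix y :: "int list"
    assume len: "length y = length [3 :: nat, 2, 1, 1, 1]" and y: "\<forall>x\<in>set y. 0 \<le> x"
      "sum_list (map2 (*) (map int [3 :: nat, 2, 1, 1, 1]) y) = int (3 * k)"
    from len obtain y0 y1 y2 y3 y4 where "y = [y0, y1, y2, y3, y4]" by (auto simp: length_Suc_conv)
    with y show "compatible 9 k F (\<lambda>y. y!0) (\<lambda>y. 9 * y!0 - y!2) G y"
      unfolding compatible_def by (simp add: eval)
  next
    fix s t :: int and a :: "int list"
    assume len: "length a = 9 div 2" and a: "admissible 9 k s t a"
    from len have "length a = 4" by simp
    then obtain a1 a2 a3 a4 where "a = [a1, a2, a3, a4]" by (auto simp: length_Suc_conv numeral_eq_Suc)
    with a show "length (G s t a) = length [3 :: nat, 2, 1, 1, 1] \<and> (\<forall>x\<in>set (G s t a). 0 \<le> x) \<and>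
        sum_list (map2 (*) (map int [3 :: nat, 2, 1, 1, 1]) (G s t a)) = int (3 * k) \<and> F (G s t a) = a"
      unfolding admissible_def by (simp add: eval)
  qed simp
qed

lemma card_L_10: "card (L 10 k) = card (weighted_solutions [2, 2, 1, 1, 1, 1] (3 * k))"
proof -
  define F where "F y = [4 * y!0 - y!1 + y!2 - y!3 + y!4 - int k, y!0 + y!1 - 2 * y!2 + y!3 - y!5 + int k,
      4 * y!0 - y!1 - y!2 + y!3 + y!5 - int k, y!0 + y!1 + y!2 - 2 * y!3 - y!4 + int k,
      2 * y!0 + y!2 + y!3 - int k]" for y :: "int list"
  define G where "G s t a = [s, 2 * s - 5 * t + 2 * a!0 + 4 * a!1 + 5 * a!2 + 6 * a!3 + 6 * a!4,
      5 * s + 8 * t - 4 * a!0 - 7 * a!1 - 9 * a!2 - 10 * a!3 - 10 * a!4,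
      5 * s - 8 * t + 3 * a!0 + 6 * a!1 + 8 * a!2 + 9 * a!3 + 10 * a!4, 10 * s - t,
      10 * s - 9 * t + 3 * a!0 + 6 * a!1 + 9 * a!2 + 10 * a!3 + 10 * a!4]" for s t :: int and a :: "int list"
  have cusps: "cusp_list 10 =
      [(1, 0), (2, 1), (5, 1), (5, 2), (5, 3), (5, 4), (10, 1), (10, 3), (10, 7), (10, 9)]"
    by code_simp
  note eval = F_def G_def cusps ord_list_def weighted_sum_def upt_rec_numeral
  show ?thesis
  proof (rule card_L_eqI[where F = F and G = G and s_of = "\<lambda>y. y!0" and t_of = "\<lambda>y. 10 * y!0 - y!4"])
    fix y :: "int list"
    assume len: "length y = length [2 :: nat, 2, 1, 1, 1, 1]" and y: "\<forall>x\<in>set y. 0 \<le> x"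
      "sum_list (map2 (*) (map int [2 :: nat, 2, 1, 1, 1, 1]) y) = int (3 * k)"
    from len obtain y0 y1 y2 y3 y4 y5 where "y = [y0, y1, y2, y3, y4, y5]" by (auto simp: length_Suc_conv)
    with y show "compatible 10 k F (\<lambda>y. y!0) (\<lambda>y. 10 * y!0 - y!4) G y"
      unfolding compatible_def by (simp add: eval)
  next
    fix s t :: int and a :: "int list"
    assume len: "length a = 10 div 2" and a: "admissible 10 k s t a"
    from len have "length a = 5" by simp
    then obtain a1 a2 a3 a4 a5 where "a = [a1, a2, a3, a4, a5]" by (auto simp: length_Suc_conv numeral_eq_Suc)
    with a show "length (G s t a) = length [2 :: nat, 2, 1, 1, 1, 1] \<and> (\<forall>x\<in>set (G s t a). 0 \<le> x) \<and>
        sum_list (map2 (*) (map int [2 :: nat, 2, 1, 1, 1, 1]) (G s t a)) = int (3 * k) \<and> F (G s t a) = a"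
      unfolding admissible_def by (simp add: eval)
  qed simp
qed

lemma card_L_12: "card (L 12 k) = card (weighted_solutions [2, 2, 2, 1, 1, 1, 1] (4 * k))"
proof -
  define F where "F y = [2 * y!0 - 2 * y!1 - y!2 - 2 * y!3 - y!6 + 2 * int k,
      y!0 - y!1 - 2 * y!2 + 2 * y!3 - y!4 + int k, 2 * y!0 + 2 * y!1 - y!3 - y!4,
      2 * y!0 + 2 * y!2 + y!3 - int k, 2 * y!0 - 2 * y!1 - y!2 - 2 * y!3 - y!5 + 2 * int k,
      y!0 + y!1 + y!3 + y!4 - int k]" for y :: "int list"
  define G where "G s t a = [s, 3 * s + 8 * t - 4 * a!0 - 7 * a!1 - 9 * a!2 - 11 * a!3 - 12 * a!4 - 12 * a!5,
      4 * s - 3 * t + a!0 + 2 * a!1 + 3 * a!2 + 4 * a!3 + 4 * a!4 + 4 * a!5,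
      2 * s + 6 * t - 3 * a!0 - 5 * a!1 - 7 * a!2 - 8 * a!3 - 9 * a!4 - 9 * a!5,
      6 * s + 10 * t - 5 * a!0 - 9 * a!1 - 12 * a!2 - 14 * a!3 - 15 * a!4 - 15 * a!5, 12 * s - t,
      12 * s - t - a!0 + a!4]" for s t :: int and a :: "int list"
  have cusps: "cusp_list 12 =
      [(1, 0), (2, 1), (3, 1), (3, 2), (4, 1), (4, 3), (6, 1), (6, 5), (12, 1), (12, 5), (12, 7),
      (12, 11)]"
    by code_simp
  note eval = F_def G_def cusps ord_list_def weighted_sum_def upt_rec_numeral
  show ?thesis
  proof (rule card_L_eqI[where F = F and G = G and s_of = "\<lambda>y. y!0" and t_of = "\<lambda>y. 12 * y!0 - y!5"])
    fix y :: "int list"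
    assume len: "length y = length [2 :: nat, 2, 2, 1, 1, 1, 1]" and y: "\<forall>x\<in>set y. 0 \<le> x"
      "sum_list (map2 (*) (map int [2 :: nat, 2, 2, 1, 1, 1, 1]) y) = int (4 * k)"
    from len obtain y0 y1 y2 y3 y4 y5 y6 where "y = [y0, y1, y2, y3, y4, y5, y6]" by (auto simp: length_Suc_conv)
    with y show "compatible 12 k F (\<lambda>y. y!0) (\<lambda>y. 12 * y!0 - y!5) G y"
      unfolding compatible_def by (simp add: eval)
  next
    fix s t :: int and a :: "int list"
    assume len: "length a = 12 div 2" and a: "admissible 12 k s t a"
    from len have "length a = 6" by simp
    then obtain a1 a2 a3 a4 a5 a6 where "a = [a1, a2, a3, a4, a5, a6]" by (auto simp: length_Suc_conv numeral_eq_Suc)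
    with a show "length (G s t a) = length [2 :: nat, 2, 2, 1, 1, 1, 1] \<and> (\<forall>x\<in>set (G s t a). 0 \<le> x) \<and>
        sum_list (map2 (*) (map int [2 :: nat, 2, 2, 1, 1, 1, 1]) (G s t a)) = int (4 * k) \<and> F (G s t a) = a"
      unfolding admissible_def by (simp add: eval)
  qed simp
qed

section \<open>The cardinalities\<close>

lemma card_weighted_solutions_ones_numeral:
  "card (weighted_solutions (replicate 1 1) n) = 1"
  "card (weighted_solutions (replicate 2 1) n) = n + 1"
  "card (weighted_solutions (replicate 3 1) n) = (n + 2) choose 2"
  "card (weighted_solutions [1, 1] n) = (n + 1) choose 1"
  "card (weighted_solutions [1, 1, 1] n) = (n + 2) choose 2"
  "card (weighted_solutions [1, 1, 1, 1] n) = (n + 3) choose 3"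
proof -
  have *: "card (weighted_solutions (replicate (Suc r) 1) n) = (n + r) choose r" for r
    using card_weighted_solutions_ones[of "Suc r" n] binomial_symmetric[of n "n + r"] by simp
  show "card (weighted_solutions (replicate 1 1) n) = 1"
    "card (weighted_solutions (replicate 2 1) n) = n + 1"
    "card (weighted_solutions (replicate 3 1) n) = (n + 2) choose 2"
    "card (weighted_solutions [1, 1] n) = (n + 1) choose 1"
    "card (weighted_solutions [1, 1, 1] n) = (n + 2) choose 2"
    "card (weighted_solutions [1, 1, 1, 1] n) = (n + 3) choose 3"
    using *[of 0] *[of 1] *[of 2] *[of 3] by (simp_all add: numeral_eq_Suc)
qed

theorem card_L:
  "card (L 5 k) = (\<Sum>j = 0..k div 2. (k - 2 * j + 1) choose 1)"
  "card (L 6 k) = (k + 3) choose 3"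
  "card (L 7 k) = (\<Sum>j = 0..(2 * k) div 3. (2 * k - 3 * j + 2) choose 2)"
  "card (L 8 k) = (\<Sum>j = 0..k. (2 * k - 2 * j + 3) choose 3)"
  "card (L 9 k) = (\<Sum>j = 0..k. \<Sum>l = 0..(3 * k - 3 * j) div 2. (3 * k - 3 * j - 2 * l + 2) choose 2)"
  "card (L 10 k) = (\<Sum>j = 0..(3 * k) div 2. (j + 1) * ((3 * k - 2 * j + 3) choose 3))"
  "card (L 12 k) = (\<Sum>j = 0..2 * k. ((j + 2) choose 2) * ((4 * k - 2 * j + 3) choose 3))"
proof -
  note split1 = card_weighted_solutions_split[where p = 1, simplified, unfolded card_weighted_solutions_ones_numeral(1)[simplified]]
  note split2 = card_weighted_solutions_split[where p = 2 and w = 2, unfolded card_weighted_solutions_ones_numeral(2)]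
  note split3 = card_weighted_solutions_split[where p = 3 and w = 2, unfolded card_weighted_solutions_ones_numeral(3)]
  note ones = card_weighted_solutions_ones_numeral(4-6)
  show "card (L 5 k) = (\<Sum>j = 0..k div 2. (k - 2 * j + 1) choose 1)"
    unfolding card_L_5 by (subst split1) (simp_all add: ones[simplified])
  show "card (L 6 k) = (k + 3) choose 3"
    unfolding card_L_6 by (rule ones)
  show "card (L 7 k) = (\<Sum>j = 0..(2 * k) div 3. (2 * k - 3 * j + 2) choose 2)"
    unfolding card_L_7 by (subst split1) (simp_all add: ones[simplified])
  show "card (L 8 k) = (\<Sum>j = 0..k. (2 * k - 2 * j + 3) choose 3)"
    unfolding card_L_8 by (subst split1) (simp_all add: ones[simplified])
  show "card (L 9 k) = (\<Sum>j = 0..k. \<Sum>l = 0..(3 * k - 3 * j) div 2. (3 * k - 3 * j - 2 * l + 2) choose 2)"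
  proof -
    have "card (weighted_solutions [2, 1, 1, 1] n) = (\<Sum>l = 0..n div 2. (n - 2 * l + 2) choose 2)" for n
      by (subst split1) (simp_all add: ones[simplified])
    then show ?thesis
      unfolding card_L_9 by (subst split1) simp_all
  qed
  show "card (L 10 k) = (\<Sum>j = 0..(3 * k) div 2. (j + 1) * ((3 * k - 2 * j + 3) choose 3))"
  proof -
    have "[2, 2, 1, 1, 1, 1] = replicate 2 2 @ [1, 1, 1, 1 :: nat]" by (simp add: numeral_eq_Suc)
    then show ?thesis
      unfolding card_L_10 using split2[of "[1, 1, 1, 1]" "3 * k"] by (simp only: ones) simp
  qed
  show "card (L 12 k) = (\<Sum>j = 0..2 * k. ((j + 2) choose 2) * ((4 * k - 2 * j + 3) choose 3))"
  proof -
    have "[2, 2, 2, 1, 1, 1, 1] = replicate 3 2 @ [1, 1, 1, 1 :: nat]" by (simp add: numeral_eq_Suc)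
    moreover have "4 * k div 2 = 2 * k" by simp
    ultimately show ?thesis
      unfolding card_L_12 using split3[of "[1, 1, 1, 1]" "4 * k"] by (simp only: ones) simp
  qed
qed

theorem theorem5p1:
  shows "(\<forall>k::nat.
      card (L 5 k) = (\<Sum>j = 0..k div 2. (k - 2 * j + 1) choose 1)
    \<and> card (L 6 k) = (k + 3) choose 3
    \<and> card (L 7 k) = (\<Sum>j = 0..(2 * k) div 3. (2 * k - 3 * j + 2) choose 2)
    \<and> card (L 8 k) = (\<Sum>j = 0..k. (2 * k - 2 * j + 3) choose 3)
    \<and> card (L 9 k) = (\<Sum>j = 0..k. \<Sum>l = 0..(3 * k - 3 * j) div 2.
                          (3 * k - 3 * j - 2 * l + 2) choose 2)
    \<and> card (L 10 k) = (\<Sum>j = 0..(3 * k) div 2. (j + 1) * ((3 * k - 2 * j + 3) choose 3))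
    \<and> card (L 12 k) = (\<Sum>j = 0..2 * k. ((j + 2) choose 2) * ((4 * k - 2 * j + 3) choose 3)))
    \<and> (\<forall>N\<ge>5. X1_genus N = 0 \<longleftrightarrow> N \<in> {5, 6, 7, 8, 9, 10, 12})"
  by (intro conjI allI impI card_L X1_genus_0_iff)


end
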